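(* Let $G$ be a controllable graph on $n$ vertices with $L$ and the system ( * ) as in the context. Then $G$ has a generalized cospectral mate if and only if ( * ) has $n$ solutions $\xi_1,\ldots,\xi_n$, not all trivial, such that $\xi_i^T\xi_j=0$ and $\xi_i^TA(G)\xi_j\in\{0,L^2\}$ for all distinct $i,j$.
   Context: Graphs are simple, undirected on $n$ vertices; $A=A(G)$, $e$ the all-ones vector, $J$ the all-ones matrix. $W(G)=[e,Ae,\ldots,A^{n-1}e]$; $G$ is controllable if $\mathrm{rank}\,W(G)=n$. A generalized cospectral mate of $G$ is a graph not isomorphic to $G$ having the same spectrum as $G$ and whose complement has the same spectrum as the complement of $G$. $d_n(M)$ is the last invariant factor of an integral matrix, $\mathrm{ord}_p$ the $p$-adic exponent, $\Delta(G)$ the discriminant of $\det(xI-A)$. $M_p(G;x)$: for odd $p$, $\chi(A;x)/\mathrm{sfp}(\gcd(\chi(A;x),\chi(A+J;x)))$ in $\mathbb{F}_p[x]$ ($\chi(B;x)=\det(xI-B)$, $\mathrm{sfp}$ = product of distinct monic irreducible factors); for $p=2$, with $\chi(A;x)=x^n+c_1x^{n-1}+\cdots+c_n$, $k=\lfloor n/2\rfloor$, it is $x^k+c_2x^{k-1}+\cdots+c_n$ ($n$ even) or $x(x^k+c_2x^{k-1}+\cdots+c_{n-1})$ ($n$ odd) mod 2; coefficients in $\{0,\ldots,p-1\}$, $s_p=\deg M_p$, $M_p(A)e\equiv0\pmod p$. For $p$ with $\mathrm{rank}_pW(G)\le n-1$: $W^{(p)}(G)=[e,\ldots,A^{s_p-1}e,\frac{M_p(A)e}{p},\ldots,\frac{A^{n-1-s_p}M_p(A)e}{p}]$.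 Let $d=d_n(W(G))$, $S=\{2\}\cup\{p\text{ odd prime}: p\mid\gcd(\Delta(G),d),\ p^2\mid\Delta(G)\}$; the potential primes $p_1,\ldots,p_s$ are the $p\in S$ with $\mathrm{rank}_pW(G)\le n-1$ and $\mathrm{ord}_p(d_n(W^{(p)}(G)))\ge1$; $t_i=\mathrm{ord}_{p_i}(d_n(W^{(p_i)}(G)))$, $L=\prod p_i^{t_i}$ ($L=1$ if $s=0$). System ( * ) for an integral vector $x$: $(W^{(p_i)}(G))^Tx\equiv0\pmod{p_i^{t_i}}$ ($i=1,\ldots,s$), $x^Tx=L^2$, $e^Tx=L$, $x^TA(G)x=0$. The solutions $Le^{(k)}$ ($e^{(k)}$ the $k$-th unit vector) are called trivial; all other solutions (those with $x\not\equiv0\pmod L$) nontrivial. *)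

theory Defs
  imports
    "Jordan_Normal_Form.Char_Poly"
    "Jordan_Normal_Form.DL_Rank"
    "Subresultants.Resultant_Prelim"
    "Berlekamp_Zassenhaus.Poly_Mod"
begin

section \<open>Graphs on the vertex set \<open>{0, ..., n - 1}\<close>\<close>

definition complete_edges :: "nat \<Rightarrow> nat set set" where
  "complete_edges n = {{u, v} | u v. u < n \<and> v < n \<and> u \<noteq> v}"

definition simple_graph :: "nat \<Rightarrow> nat set set \<Rightarrow> bool" where
  "simple_graph n E \<longleftrightarrow> E \<subseteq> complete_edges n"

definition complement_edges :: "nat \<Rightarrow> nat set set \<Rightarrow> nat set set" where
  "complement_edges n E = complete_edges n - E"

definition graph_iso :: "nat \<Rightarrow> nat set set \<Rightarrow> nat \<Rightarrow> nat set set \<Rightarrow> bool" where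
  "graph_iso n E m F \<longleftrightarrow>
     (\<exists>f. bij_betw f {..<n} {..<m} \<and> (\<forall>u<n. \<forall>v<n. {u, v} \<in> E \<longleftrightarrow> {f u, f v} \<in> F))"

definition adj :: "nat \<Rightarrow> nat set set \<Rightarrow> int mat" where
  "adj n E = mat n n (\<lambda>(i, j). if {i, j} \<in> E then 1 else 0)"

text \<open>The spectrum is a multiset: eigenvalues are counted with algebraic multiplicity.\<close>

definition graph_spectrum :: "nat \<Rightarrow> nat set set \<Rightarrow> complex multiset" where
  "graph_spectrum n E = proots (char_poly (map_mat of_int (adj n E)))"

definition gen_cospectral_mate :: "nat \<Rightarrow> nat set set \<Rightarrow> nat \<Rightarrow> nat set set \<Rightarrow> bool" where
  "gen_cospectral_mate n E m F \<longleftrightarrow>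
     simple_graph m F \<and> \<not> graph_iso n E m F \<and>
     graph_spectrum m F = graph_spectrum n E \<and>
     graph_spectrum m (complement_edges m F) = graph_spectrum n (complement_edges n E)"


section \<open>Walk matrix and controllability\<close>

definition ones :: "nat \<Rightarrow> int vec" where
  "ones n = vec n (\<lambda>_. 1)"

definition all_ones_mat :: "nat \<Rightarrow> int mat" where
  "all_ones_mat n = mat n n (\<lambda>_. 1)"

definition walk_matrix :: "nat \<Rightarrow> nat set set \<Rightarrow> int mat" where
  "walk_matrix n E = mat n n (\<lambda>(i, j). ((adj n E ^\<^sub>m j) *\<^sub>v ones n) $ i)"

definition controllable :: "nat \<Rightarrow> nat set set \<Rightarrow> bool" where
  "controllable n E \<longleftrightarrow>
     vec_space.rank n (map_mat of_int (walk_matrix n E) :: rat mat) = n"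


section \<open>Integral matrices: last invariant factor and rank modulo a prime\<close>

definition smith_normal_form :: "int mat \<Rightarrow> bool" where
  "smith_normal_form D \<longleftrightarrow>
     diagonal_mat D \<and>
     (\<forall>i < min (dim_row D) (dim_col D). D $$ (i, i) \<ge> 0) \<and>
     (\<forall>i. Suc i < min (dim_row D) (dim_col D) \<longrightarrow> D $$ (i, i) dvd D $$ (Suc i, Suc i))"

text \<open>Over the integers, \<open>invertible_mat\<close> says that the matrix is unimodular. The value is
  meaningful only for matrices with at least one row and one column.\<close>

definition last_invariant_factor :: "int mat \<Rightarrow> int" where
  "last_invariant_factor M =
     (THE d. \<exists>U V. U \<in> carrier_mat (dim_row M) (dim_row M) \<and> invertible_mat U \<and>
                   V \<in> carrier_mat (dim_col M) (dim_col M) \<and> invertible_mat V \<and>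
                   smith_normal_form (U * M * V) \<and>
                   (let k = min (dim_row M) (dim_col M) - 1 in d = (U * M * V) $$ (k, k)))"

definition lin_indep_cols_mod :: "int \<Rightarrow> int mat \<Rightarrow> nat set \<Rightarrow> bool" where
  "lin_indep_cols_mod p M C \<longleftrightarrow>
     (\<forall>c :: nat \<Rightarrow> int.
        (\<forall>i < dim_row M. p dvd (\<Sum>j\<in>C. c j * M $$ (i, j))) \<longrightarrow>
        (\<forall>j\<in>C. p dvd c j))"

definition rank_mod :: "int \<Rightarrow> int mat \<Rightarrow> nat" where
  "rank_mod p M = Max {card C | C. C \<subseteq> {..<dim_col M} \<and> lin_indep_cols_mod p M C}"


section \<open>Polynomials over the prime field with p elements\<close>

text \<open>An element of the polynomial ring over the field with p elements is represented by the
  unique integer polynomial with coefficients in \<open>{0, ..., p - 1}\<close> that reduces to it, that is, by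
  a fixed point of \<open>poly_mod.Mp p\<close>.\<close>

definition gcd_mod :: "int \<Rightarrow> int poly \<Rightarrow> int poly \<Rightarrow> int poly" where
  "gcd_mod p f g =
     (THE h. poly_mod.Mp p h = h \<and> monic h \<and>
             poly_mod.dvdm p h f \<and> poly_mod.dvdm p h g \<and>
             (\<forall>k. poly_mod.dvdm p k f \<longrightarrow> poly_mod.dvdm p k g \<longrightarrow> poly_mod.dvdm p k h))"

definition sfp_mod :: "int \<Rightarrow> int poly \<Rightarrow> int poly" where
  "sfp_mod p f =
     poly_mod.Mp p (\<Prod>q \<in> {q. poly_mod.Mp p q = q \<and> monic q \<and> poly_mod.irreducible_m p q \<and>
                              poly_mod.dvdm p q f}. q)"

definition quotient_mod :: "int \<Rightarrow> int poly \<Rightarrow> int poly \<Rightarrow> int poly" where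
  "quotient_mod p f g = (THE q. poly_mod.Mp p q = q \<and> poly_mod.Mp p (q * g) = poly_mod.Mp p f)"

definition discriminant :: "int poly \<Rightarrow> int" where
  \<comment> \<open>for monic polynomials, where no division by the leading coefficient is needed\<close>
  "discriminant f = (-1) ^ (degree f * (degree f - 1) div 2) * resultant f (pderiv f)"


section \<open>The matrices \<open>W\<^sup>(\<^sup>p\<^sup>)(G)\<close>\<close>

text \<open>Here \<open>coeff (char_poly A) (n - i)\<close> is the coefficient \<open>c\<^sub>i\<close> of
  \<open>x^n + c\<^sub>1 x^(n-1) + \<dots> + c\<^sub>n\<close>.\<close>

definition M_two :: "nat \<Rightarrow> nat set set \<Rightarrow> int poly" where
  "M_two n E =
     (let k = n div 2;
          h = (\<Sum>j\<le>k. monom (coeff (char_poly (adj n E)) (n - 2 * j)) (k - j))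
      in poly_mod.Mp 2 (if even n then h else monom 1 1 * h))"

definition M_odd :: "int \<Rightarrow> nat \<Rightarrow> nat set set \<Rightarrow> int poly" where
  "M_odd p n E =
     quotient_mod p (char_poly (adj n E))
       (sfp_mod p (gcd_mod p (char_poly (adj n E)) (char_poly (adj n E + all_ones_mat n))))"

definition M_pol :: "int \<Rightarrow> nat \<Rightarrow> nat set set \<Rightarrow> int poly" where
  "M_pol p n E = (if p = 2 then M_two n E else M_odd p n E)"

text \<open>\<open>poly_walk q n E i\<close> is the vector \<open>A^i q(A) e\<close>.\<close>

definition poly_walk :: "int poly \<Rightarrow> nat \<Rightarrow> nat set set \<Rightarrow> nat \<Rightarrow> int vec" where
  "poly_walk q n E i =
     vec n (\<lambda>r. \<Sum>l\<le>degree q. coeff q l * ((adj n E ^\<^sub>m (i + l)) *\<^sub>v ones n) $ r)"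

text \<open>The integer division by p is exact, as \<open>M_p(A) e\<close> vanishes modulo p.\<close>

definition walk_matrix_mod :: "int \<Rightarrow> nat \<Rightarrow> nat set set \<Rightarrow> int mat" where
  "walk_matrix_mod p n E =
     (let s = degree (M_pol p n E) in
      mat n n (\<lambda>(i, j). if j < s then ((adj n E ^\<^sub>m j) *\<^sub>v ones n) $ i
                        else poly_walk (M_pol p n E) n E (j - s) $ i div p))"


section \<open>Potential primes and the system of equations\<close>

definition candidate_primes :: "nat \<Rightarrow> nat set set \<Rightarrow> int set" where
  "candidate_primes n E =
     (let \<Delta> = discriminant (char_poly (adj n E)) in
      {2} \<union> {p. prime p \<and> odd p \<and>
                 p dvd gcd \<Delta> (last_invariant_factor (walk_matrix n E)) \<and> p\<^sup>2 dvd \<Delta>})"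

definition potential_exponent :: "int \<Rightarrow> nat \<Rightarrow> nat set set \<Rightarrow> nat" where
  "potential_exponent p n E = multiplicity p (last_invariant_factor (walk_matrix_mod p n E))"

definition potential_primes :: "nat \<Rightarrow> nat set set \<Rightarrow> int set" where
  "potential_primes n E =
     {p \<in> candidate_primes n E.
        rank_mod p (walk_matrix n E) < n \<and> potential_exponent p n E \<ge> 1}"

definition system_level :: "nat \<Rightarrow> nat set set \<Rightarrow> int" where
  "system_level n E = (\<Prod>p\<in>potential_primes n E. p ^ potential_exponent p n E)"

definition system_solution :: "nat \<Rightarrow> nat set set \<Rightarrow> int vec \<Rightarrow> bool" where
  "system_solution n E x \<longleftrightarrow>
     x \<in> carrier_vec n \<and>
     (\<forall>p\<in>potential_primes n E. \<forall>i<n.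
        p ^ potential_exponent p n E dvd (transpose_mat (walk_matrix_mod p n E) *\<^sub>v x) $ i) \<and>
     x \<bullet> x = (system_level n E)\<^sup>2 \<and>
     ones n \<bullet> x = system_level n E \<and>
     x \<bullet> (adj n E *\<^sub>v x) = 0"

definition trivial_solution :: "nat \<Rightarrow> nat set set \<Rightarrow> int vec \<Rightarrow> bool" where
  "trivial_solution n E x \<longleftrightarrow> (\<exists>k<n. x = system_level n E \<cdot>\<^sub>v unit_vec n k)"

end

(*
For a controllable graph G, the generalized cospectral mates H correspond to the rational orthogonal
matrices Q with Q^T e = e for which Q^T A(G) Q is an adjacency matrix, and Q is unique because
Q^T W(G) = W(H). The columns of L Q are the solutions of the system; the point is that L Q is integral.

Let l be the level of Q, N = l Q, and p a prime divisor of l, so that N is nonzero mod p.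
Since N^T W(G) = l W(H), l divides the last invariant factor of W(G). The same holds for W^(p), since
N^T W^(p)(G) = l W^(p)(H) with W^(p)(H) integral: M_p depends only on the two characteristic polynomials,
and M_p(A) e = 0 mod p. For odd p this holds since every common irreducible factor of chi(A) and chi(A + J)
divides adj(x - A) e mod p, and for p = 2 since M_2^2 is chi or x chi mod 2.
Finally p^2 divides the discriminant +-det(chi'(A)): the column space of N mod p is A-invariant and totally
isotropic, so chi'(A) annihilates a nonzero vector N y mod p, while (N y)^T chi'(A) (N y) = 0 mod p^2.
*)

theory Submission
  imports Defs "HOL-Library.Z2"
begin

section \<open>Integral matrices\<close>

text \<open>Q exists because the Gram matrices W^T W and W^T A W contain only walk counts e^T A^k e,
  and these are determined by the characteristic polynomials of A and A + J. The uniqueness of Q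
  also gives the converse: a graph read off from solutions that are not all trivial cannot be
  isomorphic to G, since an isomorphism would make Q a permutation matrix. The complement enters
  only through chi(A + J), because chi(A - J), which is its characteristic polynomial up to sign and
  a substitution, is determined by chi(A) and chi(A + J).

  The obstacle is that the arguments mod p call for eigenvectors over extensions of F_p. Everything
  stays in Z[x] instead: an eigenvalue becomes x modulo an ideal, an eigenvector a polynomial vector
  w for which the entries of (x - A) w lie in that ideal. One identity, obtained by comparing adj(x
  - A) with the adjugate of a rank-one update, replaces the fact that the adjugate of a singular
  matrix has rank at most one. It serves both the discriminant and the odd M_p.\<close>

lemma smult_one_mat_mult_vec:
  fixes c :: "'a :: comm_ring_1"
  assumes "u \<in> carrier_vec n"
  shows "(c \<cdot>\<^sub>m 1\<^sub>m n) *\<^sub>v u = c \<cdot>\<^sub>v u"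
proof (rule eq_vecI)
  fix i assume "i < dim_vec (c \<cdot>\<^sub>v u)"
  hence i: "i < n" using assms by simp
  have "row (c \<cdot>\<^sub>m 1\<^sub>m n) i = c \<cdot>\<^sub>v unit_vec n i" using i by (intro eq_vecI) auto
  thus "((c \<cdot>\<^sub>m 1\<^sub>m n) *\<^sub>v u) $ i = (c \<cdot>\<^sub>v u) $ i"
    using i assms by (simp add: scalar_prod_left_unit)
qed (use assms in auto)

lemma mult_mat_vec_smult:
  fixes k :: "'a :: comm_ring_1"
  assumes "A \<in> carrier_mat nr nc" "v \<in> carrier_vec nc"
  shows "A *\<^sub>v (k \<cdot>\<^sub>v v) = k \<cdot>\<^sub>v (A *\<^sub>v v)"
  using assms by (intro eq_vecI) auto

lemma mult_mat_vec_index_sum: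
  assumes "M \<in> carrier_mat m n" "x \<in> carrier_vec n" "i < m"
  shows "(M *\<^sub>v x) $ i = (\<Sum>j\<in>{0..<n}. M $$ (i, j) * x $ j)"
  using assms by (simp add: scalar_prod_def)

lemma smult_smult_mat:
  fixes a :: "'a :: comm_ring_1"
  shows "a \<cdot>\<^sub>m (b \<cdot>\<^sub>m A) = (a * b) \<cdot>\<^sub>m A"
  by (intro eq_matI) (auto simp: mult.assoc)

lemma smult_mat_cancel:
  fixes c :: "'a :: idom"
  assumes "c \<noteq> 0" "A \<in> carrier_mat n m" "B \<in> carrier_mat n m"
  shows "c \<cdot>\<^sub>m A = c \<cdot>\<^sub>m B \<longleftrightarrow> A = B"
proof
  assume "c \<cdot>\<^sub>m A = c \<cdot>\<^sub>m B"
  hence e: "(c \<cdot>\<^sub>m A) $$ (i, j) = (c \<cdot>\<^sub>m B) $$ (i, j)" for i j by simp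
  have "A $$ (i, j) = B $$ (i, j)" if "i < n" "j < m" for i j using e[of i j] that assms by simp
  thus "A = B" using assms by (intro eq_matI) auto
qed simp

lemma symmetric_mat_index:
  assumes "A \<in> carrier_mat n n" "A\<^sup>T = A" "a < n" "b < n"
  shows "A $$ (a, b) = A $$ (b, a)"
  using assms by (metis carrier_matD index_transpose_mat(1))

lemma dvd_mult_mat_vec:
  fixes p :: int
  assumes "M \<in> carrier_mat m n" "u \<in> carrier_vec n" "\<And>i. i < n \<Longrightarrow> p dvd u $ i" "i < m"
  shows "p dvd (M *\<^sub>v u) $ i"
  using assms by (auto simp: scalar_prod_def intro!: dvd_sum)

lemma mat_mult_cancel_right:
  fixes W :: "'a :: idom mat"
  assumes X: "X \<in> carrier_mat m n" and Y: "Y \<in> carrier_mat m n" and W: "W \<in> carrier_mat n n"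
    and det0: "det W \<noteq> 0" and eq: "X * W = Y * W"
  shows "X = Y"
proof -
  note R = adj_mat[OF W]
  have *: "X * W * adj_mat W = det W \<cdot>\<^sub>m X" if X: "X \<in> carrier_mat m n" for X
    unfolding assoc_mult_mat[OF X W R(1)] R(2) using mult_smult_distrib[OF X one_carrier_mat] X by simp
  have "det W \<cdot>\<^sub>m X = det W \<cdot>\<^sub>m Y" using *[OF X] *[OF Y] eq by simp
  hence e: "(det W \<cdot>\<^sub>m X) $$ (i, j) = (det W \<cdot>\<^sub>m Y) $$ (i, j)" for i j by simp
  have "X $$ (i, j) = Y $$ (i, j)" if "i < m" "j < n" for i j using e[of i j] that X Y det0 by simp
  thus ?thesis using X Y by (intro eq_matI) auto
qed

lemma mat_mult_cancel_left:
  fixes W :: "'a :: idom mat"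
  assumes X: "X \<in> carrier_mat n m" and Y: "Y \<in> carrier_mat n m" and W: "W \<in> carrier_mat n n"
    and det0: "det W \<noteq> 0" and eq: "W * X = W * Y"
  shows "X = Y"
proof -
  have "X\<^sup>T * W\<^sup>T = Y\<^sup>T * W\<^sup>T"
    using transpose_mult[OF W X] transpose_mult[OF W Y] eq by simp
  hence "X\<^sup>T = Y\<^sup>T"
    by (rule mat_mult_cancel_right[rotated 4, where m=m and n=n]) (use X Y W det0 in \<open>auto simp: det_transpose\<close>)
  thus ?thesis by (metis transpose_transpose)
qed

text \<open>Taking determinants gives (det N)^2 = c^n, which is nonzero, so \<open>N\<close> can be
  cancelled from N (N^T N) = c N. This replaces the inverse over the fraction field.\<close>

lemma scaled_orthogonal_transpose:
  fixes N :: "'a :: idom mat"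
  assumes N: "N \<in> carrier_mat n n" and NN: "N * N\<^sup>T = c \<cdot>\<^sub>m 1\<^sub>m n" and c: "c \<noteq> 0"
  shows "N\<^sup>T * N = c \<cdot>\<^sub>m 1\<^sub>m n" "det N \<noteq> 0"
proof -
  have Nt: "N\<^sup>T \<in> carrier_mat n n" using N by simp
  have "det N * det N = c ^ n"
    using det_mult[OF N Nt] det_transpose[OF N] unfolding NN by (simp add: det_smult)
  thus d: "det N \<noteq> 0" using c by auto
  show "N\<^sup>T * N = c \<cdot>\<^sub>m 1\<^sub>m n"
  proof (rule mat_mult_cancel_left[OF _ _ N d])
    have "N * (N\<^sup>T * N) = N * N\<^sup>T * N" by (rule assoc_mult_mat[symmetric, OF N Nt N])
    also have "\<dots> = c \<cdot>\<^sub>m N" unfolding NN using mult_smult_assoc_mat[OF one_carrier_mat N] N by simp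
    also have "\<dots> = N * (c \<cdot>\<^sub>m 1\<^sub>m n)" using mult_smult_distrib[OF N one_carrier_mat] N by simp
    finally show "N * (N\<^sup>T * N) = N * (c \<cdot>\<^sub>m 1\<^sub>m n)" .
  qed (use N in auto)
qed

section \<open>Polynomials of a matrix\<close>

abbreviation const_vec :: "'b :: zero vec \<Rightarrow> 'b poly vec" where
  "const_vec \<equiv> map_vec (\<lambda>a. [:a:])"

text \<open>Horner's scheme, so that induction along \<open>pCons\<close> is available.\<close>

definition mat_poly :: "'a :: comm_ring_1 mat \<Rightarrow> 'a poly \<Rightarrow> 'a mat" where
  "mat_poly A f = fold_coeffs (\<lambda>a M. a \<cdot>\<^sub>m 1\<^sub>m (dim_row A) + A * M) f (0\<^sub>m (dim_row A) (dim_row A))"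

lemma mat_poly_0 [simp]: "mat_poly A 0 = 0\<^sub>m (dim_row A) (dim_row A)"
  by (simp add: mat_poly_def)

lemma mat_poly_pCons':
  "a \<noteq> 0 \<or> f \<noteq> 0 \<Longrightarrow> mat_poly A (pCons a f) = a \<cdot>\<^sub>m 1\<^sub>m (dim_row A) + A * mat_poly A f"
  unfolding mat_poly_def
  by (cases "a = 0") (simp_all add: fold_coeffs_pCons_coeff_not_0_eq fold_coeffs_pCons_not_0_0_eq)

lemma dim_mat_poly [simp]:
  "dim_row (mat_poly A f) = dim_row A" "dim_col (mat_poly A f) = dim_row A"
  by (induction f) (simp_all add: mat_poly_pCons')

lemma mat_poly_carrier [simp]:
  assumes "A \<in> carrier_mat n n"
  shows "mat_poly A f \<in> carrier_mat n n"
  using assms by (auto intro!: carrier_matI)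

lemma mat_poly_pCons:
  assumes "A \<in> carrier_mat n n"
  shows "mat_poly A (pCons a f) = a \<cdot>\<^sub>m 1\<^sub>m n + A * mat_poly A f"
  using assms by (cases "a = 0 \<and> f = 0") (auto simp: mat_poly_pCons' intro!: eq_matI)

context
  fixes A :: "'a :: comm_ring_1 mat" and n :: nat
  assumes A: "A \<in> carrier_mat n n"
begin

lemma mat_poly_add: "mat_poly A (f + g) = mat_poly A f + mat_poly A g"
proof (induction f g rule: poly_induct2)
  case 0 show ?case using A by simp
next
  case (pCons a f b g)
  have "mat_poly A (pCons a f + pCons b g) = (a + b) \<cdot>\<^sub>m 1\<^sub>m n + A * (mat_poly A f + mat_poly A g)"
    using pCons by (simp add: mat_poly_pCons[OF A])
  also have "A * (mat_poly A f + mat_poly A g) = A * mat_poly A f + A * mat_poly A g"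
    by (rule mult_add_distrib_mat[OF A mat_poly_carrier[OF A] mat_poly_carrier[OF A]])
  also have "(a + b) \<cdot>\<^sub>m 1\<^sub>m n + (A * mat_poly A f + A * mat_poly A g)
      = (a \<cdot>\<^sub>m 1\<^sub>m n + A * mat_poly A f) + (b \<cdot>\<^sub>m 1\<^sub>m n + A * mat_poly A g)"
    (is "_ + (?P + ?Q) = _")
  proof -
    have "?P \<in> carrier_mat n n" "?Q \<in> carrier_mat n n" using A mat_poly_carrier[OF A] by auto
    thus ?thesis by (intro eq_matI) (auto simp: distrib_right simp del: index_mult_mat(1))
  qed
  finally show ?case by (simp add: mat_poly_pCons[OF A])
qed

lemma mat_poly_smult: "mat_poly A (Polynomial.smult c f) = c \<cdot>\<^sub>m mat_poly A f"
proof (induction f)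
  case 0 show ?case using A by (intro eq_matI) auto
next
  case (pCons a f)
  have "A * (c \<cdot>\<^sub>m mat_poly A f) = c \<cdot>\<^sub>m (A * mat_poly A f)"
    by (rule mult_smult_distrib[OF A mat_poly_carrier[OF A]])
  moreover have "A * mat_poly A f \<in> carrier_mat n n" using A mat_poly_carrier[OF A] by auto
  ultimately show ?case using A pCons
    by (intro eq_matI) (auto simp: mat_poly_pCons[OF A] distrib_left simp del: index_mult_mat(1))
qed

lemma mat_poly_minus: "mat_poly A (f - g) = mat_poly A f - mat_poly A g"
proof -
  have "mat_poly A (f - g) = mat_poly A (f + Polynomial.smult (-1) g)" by simp
  also have "\<dots> = mat_poly A f + (-1) \<cdot>\<^sub>m mat_poly A g" by (simp only: mat_poly_add mat_poly_smult)
  finally show ?thesis using A mat_poly_carrier[OF A, of f] mat_poly_carrier[OF A, of g]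
    by (intro eq_matI) (auto)
qed

lemma mat_poly_mult: "mat_poly A (f * g) = mat_poly A f * mat_poly A g"
proof (induction f)
  case 0 show ?case using A left_mult_zero_mat[OF mat_poly_carrier[OF A, of g], of n] by simp
next
  case (pCons a f)
  note C = mat_poly_carrier[OF A]
  have "mat_poly A (pCons a f * g) = mat_poly A (Polynomial.smult a g + pCons 0 (f * g))" by simp
  also have "\<dots> = a \<cdot>\<^sub>m mat_poly A g + A * (mat_poly A f * mat_poly A g)"
    using pCons A by (auto simp: mat_poly_add mat_poly_smult mat_poly_pCons[OF A] intro!: eq_matI)
  also have "\<dots> = (a \<cdot>\<^sub>m 1\<^sub>m n) * mat_poly A g + (A * mat_poly A f) * mat_poly A g"
    using assoc_mult_mat[OF A C C] mult_smult_assoc_mat[OF one_carrier_mat C] C by (simp add: left_mult_one_mat[OF C])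
  also have "\<dots> = (a \<cdot>\<^sub>m 1\<^sub>m n + A * mat_poly A f) * mat_poly A g"
    by (rule add_mult_distrib_mat[symmetric, OF _ _ C]) (use A C in auto)
  finally show ?case by (simp add: mat_poly_pCons[OF A])
qed

lemma mat_poly_1: "mat_poly A 1 = 1\<^sub>m n"
  unfolding one_pCons mat_poly_pCons[OF A] using A by (intro eq_matI) auto

lemma mat_poly_X: "mat_poly A [:0, 1:] = A"
proof -
  have "mat_poly A [:0, 1:] = 0 \<cdot>\<^sub>m 1\<^sub>m n + A"
    unfolding mat_poly_pCons[OF A, of 0] using A mat_poly_1 by (simp add: pCons_one)
  thus ?thesis using A by (auto intro!: eq_matI)
qed

lemma mat_poly_pCons_0: "mat_poly A (pCons 0 f) = A * mat_poly A f"
  using A mat_poly_carrier[OF A, of f] by (intro eq_matI) (auto simp: mat_poly_pCons[OF A])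

lemma mat_poly_pCons_0': "mat_poly A (pCons 0 f) = mat_poly A f * A"
proof -
  have "pCons 0 f = f * [:0, 1:]" by simp
  thus ?thesis by (simp only: mat_poly_mult mat_poly_X)
qed

lemma mat_poly_transpose:
  assumes "A\<^sup>T = A"
  shows "(mat_poly A f)\<^sup>T = mat_poly A f"
proof (induction f)
  case 0 show ?case using A by (auto simp: zero_transpose_mat)
next
  case (pCons a f)
  note C = mat_poly_carrier[OF A]
  have "(mat_poly A (pCons a f))\<^sup>T = (a \<cdot>\<^sub>m 1\<^sub>m n)\<^sup>T + (A * mat_poly A f)\<^sup>T"
    unfolding mat_poly_pCons[OF A] by (rule transpose_add) (use A C in auto)
  also have "(A * mat_poly A f)\<^sup>T = mat_poly A f * A"
    using transpose_mult[OF A C, of f] pCons assms by simp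
  also have "\<dots> = A * mat_poly A f" using mat_poly_pCons_0 mat_poly_pCons_0' by metis
  also have "(a \<cdot>\<^sub>m 1\<^sub>m n)\<^sup>T = a \<cdot>\<^sub>m 1\<^sub>m n" by (intro eq_matI) auto
  finally show ?case by (simp add: mat_poly_pCons[OF A])
qed

lemma mat_poly_intertwine:
  assumes B: "B \<in> carrier_mat m m" and N: "N \<in> carrier_mat n m" and AN: "A * N = N * B"
  shows "mat_poly A f * N = N * mat_poly B f"
proof (induction f)
  case 0 show ?case using A B N by simp
next
  case (pCons a f)
  note C = mat_poly_carrier[OF A] and D = mat_poly_carrier[OF B]
  have "mat_poly A (pCons a f) * N = (a \<cdot>\<^sub>m 1\<^sub>m n) * N + (A * mat_poly A f) * N"
    unfolding mat_poly_pCons[OF A] by (rule add_mult_distrib_mat) (use A N C in auto)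
  also have "(A * mat_poly A f) * N = A * (N * mat_poly B f)"
    using assoc_mult_mat[OF A C N] pCons by simp
  also have "\<dots> = N * (B * mat_poly B f)"
    using assoc_mult_mat[OF A N D] assoc_mult_mat[OF N B D] AN by metis
  also have "(a \<cdot>\<^sub>m 1\<^sub>m n) * N = N * (a \<cdot>\<^sub>m 1\<^sub>m m)"
    using mult_smult_assoc_mat[OF one_carrier_mat N] mult_smult_distrib[OF N one_carrier_mat] N by simp
  also have "N * (a \<cdot>\<^sub>m 1\<^sub>m m) + N * (B * mat_poly B f) = N * (a \<cdot>\<^sub>m 1\<^sub>m m + B * mat_poly B f)"
    by (rule mult_add_distrib_mat[symmetric, OF N]) (use B D in auto)
  finally show ?case by (simp add: mat_poly_pCons[OF B])
qed

lemma mat_poly_intertwine_vec: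
  assumes B: "B \<in> carrier_mat m m" and N: "N \<in> carrier_mat n m" and AN: "A * N = N * B"
    and y: "y \<in> carrier_vec m"
  shows "mat_poly A f *\<^sub>v (N *\<^sub>v y) = N *\<^sub>v (mat_poly B f *\<^sub>v y)"
  using mat_poly_intertwine[OF B N AN, of f] assoc_mult_mat_vec[OF mat_poly_carrier[OF A] N y, of f]
    assoc_mult_mat_vec[OF N mat_poly_carrier[OF B] y, of f]
  by simp

lemma pow_mat_Suc_left: "A ^\<^sub>m (Suc k) = A * A ^\<^sub>m k"
proof (induction k)
  case 0 show ?case using A by simp
next
  case (Suc k)
  have "A ^\<^sub>m (Suc (Suc k)) = A * A ^\<^sub>m k * A" using Suc by simp
  also have "\<dots> = A * (A ^\<^sub>m k * A)" by (rule assoc_mult_mat) (use A in auto)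
  finally show ?case by simp
qed

lemma mat_poly_monom: "mat_poly A (monom 1 k) = A ^\<^sub>m k"
proof (induction k)
  case 0 show ?case using A mat_poly_1 by (simp add: monom_0 pCons_one)
next
  case (Suc k)
  thus ?case by (simp add: monom_Suc mat_poly_pCons_0' del: pow_mat.simps(2)) simp
qed

lemma mat_poly_mult_vec_index:
  assumes u: "u \<in> carrier_vec n" and r: "r < n"
  shows "(mat_poly A f *\<^sub>v u) $ r = (\<Sum>l\<le>degree f. coeff f l * ((A ^\<^sub>m l) *\<^sub>v u) $ r)"
  using r
proof (induction f arbitrary: r)
  case 0 thus ?case using A u by (auto simp: scalar_prod_def)
next
  case (pCons a f)
  note C = mat_poly_carrier[OF A]
  show ?case
  proof (cases "f = 0")
    case True
    have "mat_poly A [:a:] = a \<cdot>\<^sub>m 1\<^sub>m n" using A by (auto simp: mat_poly_pCons[OF A] intro!: eq_matI)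
    with True pCons(3) show ?thesis using A u by (simp add: smult_one_mat_mult_vec)
  next
    case False
    have "mat_poly A (pCons a f) *\<^sub>v u = (a \<cdot>\<^sub>m 1\<^sub>m n) *\<^sub>v u + (A * mat_poly A f) *\<^sub>v u"
      unfolding mat_poly_pCons[OF A] by (rule add_mult_distrib_mat_vec) (use A C u in auto)
    also have "(A * mat_poly A f) *\<^sub>v u = A *\<^sub>v (mat_poly A f *\<^sub>v u)"
      by (rule assoc_mult_mat_vec[OF A C u])
    finally have "(mat_poly A (pCons a f) *\<^sub>v u) $ r = ((a \<cdot>\<^sub>m 1\<^sub>m n) *\<^sub>v u) $ r + (A *\<^sub>v (mat_poly A f *\<^sub>v u)) $ r"
      using pCons(3) A by simp
    also have "((a \<cdot>\<^sub>m 1\<^sub>m n) *\<^sub>v u) $ r = a * u $ r"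
      using pCons(3) u by (simp add: smult_one_mat_mult_vec)
    also have "(A *\<^sub>v (mat_poly A f *\<^sub>v u)) $ r = (\<Sum>j\<in>{0..<n}. A $$ (r, j) * (mat_poly A f *\<^sub>v u) $ j)"
      using pCons(3) A C[of f] by (auto simp: scalar_prod_def)
    also have "\<dots> = (\<Sum>j\<in>{0..<n}. A $$ (r, j) * (\<Sum>l\<le>degree f. coeff f l * ((A ^\<^sub>m l) *\<^sub>v u) $ j))"
      using pCons(2) by (intro sum.cong) auto
    also have "\<dots> = (\<Sum>l\<le>degree f. coeff f l * (\<Sum>j\<in>{0..<n}. A $$ (r, j) * ((A ^\<^sub>m l) *\<^sub>v u) $ j))"
      unfolding sum_distrib_left by (subst sum.swap) (simp add: ac_simps)
    also have "\<dots> = (\<Sum>l\<le>degree f. coeff f l * ((A ^\<^sub>m Suc l) *\<^sub>v u) $ r)"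
    proof (intro sum.cong refl arg_cong2[of _ _ _ _ "(*)"])
      fix l
      have "(A ^\<^sub>m Suc l) *\<^sub>v u = A *\<^sub>v ((A ^\<^sub>m l) *\<^sub>v u)"
        unfolding pow_mat_Suc_left by (rule assoc_mult_mat_vec[OF A _ u]) (use A in auto)
      thus "(\<Sum>j\<in>{0..<n}. A $$ (r, j) * ((A ^\<^sub>m l) *\<^sub>v u) $ j) = ((A ^\<^sub>m Suc l) *\<^sub>v u) $ r"
        using pCons(3) A by (auto simp: scalar_prod_def)
    qed
    also have "a * u $ r + \<dots> = (\<Sum>l\<le>Suc (degree f). coeff (pCons a f) l * ((A ^\<^sub>m l) *\<^sub>v u) $ r)"
      unfolding sum.atMost_Suc_shift using u A by (simp del: pow_mat.simps(2))
    finally show ?thesis using False by simp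
  qed
qed

text \<open>If w is the sum of x^k w_k with constant vectors w_k, this is the sum of A^k w_k: the
  matrix is substituted to the left of the coefficients.\<close>

definition vec_poly_eval :: "'a poly vec \<Rightarrow> 'a vec" where
  "vec_poly_eval w = vec n (\<lambda>r. \<Sum>j\<in>{0..<n}. mat_poly A (w $ j) $$ (r, j))"

lemma char_poly_matrix_mult_vec:
  assumes w: "w \<in> carrier_vec n" and i: "i < n"
  shows "(char_poly_matrix A *\<^sub>v w) $ i = [:0, 1:] * w $ i - (\<Sum>j\<in>{0..<n}. Polynomial.smult (A $$ (i, j)) (w $ j))"
proof -
  have "(char_poly_matrix A *\<^sub>v w) $ i
    = (\<Sum>j\<in>{0..<n}. (if i = j then [:0, 1:] * w $ j else 0) - Polynomial.smult (A $$ (i, j)) (w $ j))"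
    using A w i unfolding char_poly_matrix_def by (auto simp: scalar_prod_def algebra_simps intro!: sum.cong)
  also have "\<dots> = (\<Sum>j\<in>{0..<n}. (if i = j then [:0, 1:] * w $ j else 0)) - (\<Sum>j\<in>{0..<n}. Polynomial.smult (A $$ (i, j)) (w $ j))"
    by (rule sum_subtractf)
  finally show ?thesis using i by simp
qed

lemma mat_poly_sum:
  assumes "finite S" "i < n" "j < n"
  shows "mat_poly A (\<Sum>x\<in>S. f x) $$ (i, j) = (\<Sum>x\<in>S. mat_poly A (f x) $$ (i, j))"
  using assms(1)
proof induction
  case empty show ?case using A assms by simp
next
  case (insert x F)
  thus ?case using assms A mat_poly_carrier[OF A] by (auto simp: mat_poly_add)
qed

text \<open>Substituting \<open>A\<close> for \<open>x\<close> in \<open>(x - A) w(x)\<close>: this is the remainder theorem for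
  polynomials with vector coefficients.\<close>

lemma vec_poly_eval_char_poly_matrix:
  assumes w: "w \<in> carrier_vec n"
  shows "vec_poly_eval (char_poly_matrix A *\<^sub>v w) = 0\<^sub>v n"
proof (rule eq_vecI)
  fix r assume "r < dim_vec (0\<^sub>v n :: 'a vec)"
  hence r: "r < n" by simp
  note C = mat_poly_carrier[OF A]
  have "vec_poly_eval (char_poly_matrix A *\<^sub>v w) $ r
    = (\<Sum>i\<in>{0..<n}. (mat_poly A (w $ i) * A) $$ (r, i) - (\<Sum>j\<in>{0..<n}. A $$ (i, j) * mat_poly A (w $ j) $$ (r, i)))"
    unfolding vec_poly_eval_def using r A C
    by (auto intro!: sum.cong simp: char_poly_matrix_mult_vec[OF w] mat_poly_minus mat_poly_pCons_0'
      mat_poly_sum mat_poly_smult simp del: index_mult_mat(1))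
  also have "\<dots> = (\<Sum>i\<in>{0..<n}. \<Sum>k\<in>{0..<n}. mat_poly A (w $ i) $$ (r, k) * A $$ (k, i))
     - (\<Sum>i\<in>{0..<n}. \<Sum>j\<in>{0..<n}. A $$ (i, j) * mat_poly A (w $ j) $$ (r, i))"
    unfolding sum_subtractf using r A C by (auto simp: scalar_prod_def intro!: sum.cong)
  also have "(\<Sum>i\<in>{0..<n}. \<Sum>k\<in>{0..<n}. mat_poly A (w $ i) $$ (r, k) * A $$ (k, i))
     = (\<Sum>i\<in>{0..<n}. \<Sum>j\<in>{0..<n}. A $$ (i, j) * mat_poly A (w $ j) $$ (r, i))"
    by (subst sum.swap) (simp add: ac_simps)
  finally show "vec_poly_eval (char_poly_matrix A *\<^sub>v w) $ r = 0\<^sub>v n $ r" using r by simp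
qed (auto simp: vec_poly_eval_def)

lemma vec_poly_eval_smult_const:
  assumes u: "u \<in> carrier_vec n"
  shows "vec_poly_eval (g \<cdot>\<^sub>v const_vec u) = mat_poly A g *\<^sub>v u"
  using u A mat_poly_carrier[OF A, of g]
  by (intro eq_vecI) (auto simp: vec_poly_eval_def scalar_prod_def mat_poly_smult mult.commute intro!: sum.cong)

lemma vec_poly_eval_add:
  assumes "v \<in> carrier_vec n" "w \<in> carrier_vec n"
  shows "vec_poly_eval (v + w) = vec_poly_eval v + vec_poly_eval w"
  using assms A mat_poly_carrier[OF A]
  by (intro eq_vecI) (auto simp: vec_poly_eval_def mat_poly_add sum.distrib)

lemma vec_poly_eval_smult:
  assumes "v \<in> carrier_vec n"
  shows "vec_poly_eval ([:c:] \<cdot>\<^sub>v v) = c \<cdot>\<^sub>v vec_poly_eval v"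
  using assms A mat_poly_carrier[OF A]
  by (intro eq_vecI) (auto simp: vec_poly_eval_def mat_poly_smult sum_distrib_left)

text \<open>Substituting A makes (x - A) w vanish. With c = 0 this yields Cayley-Hamilton; with c =
  p it turns a congruence between polynomial vectors into g(A) u = 0 mod p.\<close>

lemma mat_poly_mult_vec_eq:
  assumes w: "w \<in> carrier_vec n" and z: "z \<in> carrier_vec n" and u: "u \<in> carrier_vec n"
    and eq: "char_poly_matrix A *\<^sub>v w = g \<cdot>\<^sub>v const_vec u + [:c:] \<cdot>\<^sub>v z"
  shows "mat_poly A g *\<^sub>v u = (- c) \<cdot>\<^sub>v vec_poly_eval z"
proof -
  have "0\<^sub>v n = mat_poly A g *\<^sub>v u + c \<cdot>\<^sub>v vec_poly_eval z"
    using vec_poly_eval_char_poly_matrix[OF w] u z unfolding eq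
    by (simp add: vec_poly_eval_add vec_poly_eval_smult_const[OF u] vec_poly_eval_smult[OF z])
  hence eq: "0\<^sub>v n $ r = (mat_poly A g *\<^sub>v u + c \<cdot>\<^sub>v vec_poly_eval z) $ r" for r by simp
  have "(mat_poly A g *\<^sub>v u) $ r = - c * vec_poly_eval z $ r" if "r < n" for r
    using eq[of r] that A mat_poly_carrier[OF A, of g] by (auto simp: vec_poly_eval_def add_eq_0_iff)
  thus ?thesis using mat_poly_carrier[OF A, of g] by (intro eq_vecI) (auto simp: vec_poly_eval_def)
qed

end

section \<open>Rank-one updates and the adjugate of the characteristic matrix\<close>

lemma adj_mat_mult_vec:
  assumes X: "X \<in> carrier_mat n n" and w: "w \<in> carrier_vec n"
  shows "X *\<^sub>v (adj_mat X *\<^sub>v w) = det X \<cdot>\<^sub>v w" "adj_mat X *\<^sub>v (X *\<^sub>v w) = det X \<cdot>\<^sub>v w"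
proof -
  note R = adj_mat[OF X]
  note * = smult_one_mat_mult_vec[OF w, of "det X"]
  show "X *\<^sub>v (adj_mat X *\<^sub>v w) = det X \<cdot>\<^sub>v w"
    using assoc_mult_mat_vec[OF X R(1) w] R(2) * by simp
  show "adj_mat X *\<^sub>v (X *\<^sub>v w) = det X \<cdot>\<^sub>v w"
    using assoc_mult_mat_vec[OF R(1) X w] R(3) * by simp
qed

text \<open>The matrix determinant lemma with the adjugate in place of the inverse: the determinant
  of the bordered matrix with blocks 1, T, S, X is evaluated in two ways.\<close>

lemma det_rank_one_update_mat:
  fixes X :: "'a :: idom mat"
  assumes X: "X \<in> carrier_mat n n" and S: "S \<in> carrier_mat n 1" and T: "T \<in> carrier_mat 1 n"
    and d0: "det X \<noteq> 0"
  shows "det (X - S * T) = det X - (T * (adj_mat X * S)) $$ (0, 0)"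
proof -
  note R = adj_mat[OF X]
  let ?d = "det X" and ?R = "adj_mat X"
  define M where "M = four_block_mat (1\<^sub>m 1) T S X"
  have RS: "?R * S \<in> carrier_mat n 1" using R S by auto
  have TRS: "T * (?R * S) \<in> carrier_mat 1 1" using T RS by auto
  have XRS: "X * (?R * S) = ?d \<cdot>\<^sub>m S"
  proof -
    have "X * (?R * S) = X * ?R * S" using assoc_mult_mat[OF X R(1) S] by simp
    also have "\<dots> = ?d \<cdot>\<^sub>m (1\<^sub>m n * S)" unfolding R(2) using S by (simp add: mult_smult_assoc_mat[of _ n n _ 1])
    finally show ?thesis using S by simp
  qed
  have M1: "M = four_block_mat (1\<^sub>m 1) (0\<^sub>m 1 n) S (1\<^sub>m n) * four_block_mat (1\<^sub>m 1) T (0\<^sub>m n 1) (X - S * T)"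
    unfolding M_def
    by (subst mult_four_block_mat[of _ 1 1 _ n _ n _ _ 1 _ n])
       (use X S T in \<open>auto simp: right_mult_zero_mat left_mult_zero_mat intro!: cong_four_block_mat\<close>)
  have XST: "X - S * T \<in> carrier_mat n n" using X S T by auto
  have "det M = det (X - S * T)"
    unfolding M1 using S T XST
    by (subst det_mult[of _ "1 + n"])
      (auto simp: det_four_block_mat_upper_right_zero[OF one_carrier_mat refl S one_carrier_mat]
        det_four_block_mat_lower_left_zero[OF one_carrier_mat T refl XST] simp del: One_nat_def)
  \<comment> \<open>Multiplying by a block triangular matrix of determinant det X clears the lower
    left block, since X adj(X) S = (det X) S; the factor det X cancels at the end.\<close>
  moreover have "det M * ?d = (?d - (T * (?R * S)) $$ (0, 0)) * ?d"
  proof -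
    have "T * - (?R * S) = - (T * (?R * S))" "X * - (?R * S) = - (?d \<cdot>\<^sub>m S)"
      using X S T R RS XRS by (auto intro!: eq_matI simp: uminus_mult_right_mat)
    hence P: "M * four_block_mat (?d \<cdot>\<^sub>m 1\<^sub>m 1) (0\<^sub>m 1 n) (- (?R * S)) (1\<^sub>m n)
      = four_block_mat (?d \<cdot>\<^sub>m 1\<^sub>m 1 - T * (?R * S)) T (0\<^sub>m n 1) X"
      unfolding M_def
      by (subst mult_four_block_mat[of _ 1 1 _ n _ n _ _ 1 _ n])
         (use X S T RS XRS TRS in \<open>auto intro!: cong_four_block_mat eq_matI simp: mult_smult_distrib[OF S one_carrier_mat]\<close>)
    have "det M * ?d = det (M * four_block_mat (?d \<cdot>\<^sub>m 1\<^sub>m 1) (0\<^sub>m 1 n) (- (?R * S)) (1\<^sub>m n))"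
      by (subst det_mult[of _ "1 + n"])
        (use X S T RS in \<open>auto simp: M_def det_four_block_mat_upper_right_zero[where n=1 and m=n]\<close>)
    also have "\<dots> = det (?d \<cdot>\<^sub>m 1\<^sub>m 1 - T * (?R * S)) * ?d" unfolding P
      by (rule det_four_block_mat_lower_left_zero[where n=1 and m=n])
         (use X T minus_carrier_mat[OF TRS] in \<open>auto simp del: One_nat_def\<close>)
    also have "det (?d \<cdot>\<^sub>m 1\<^sub>m 1 - T * (?R * S)) = ?d - (T * (?R * S)) $$ (0, 0)"
      by (subst det_single[OF minus_carrier_mat[OF TRS]]) (use T RS in auto)
    finally show ?thesis .
  qed
  ultimately show ?thesis using d0 by simp
qed

definition outer :: "'a :: comm_ring_1 vec \<Rightarrow> 'a vec \<Rightarrow> 'a mat" where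
  "outer s t = mat (dim_vec s) (dim_vec t) (\<lambda>(i, j). s $ i * t $ j)"

lemma outer_carrier: "s \<in> carrier_vec n \<Longrightarrow> t \<in> carrier_vec n \<Longrightarrow> outer s t \<in> carrier_mat n n"
  by (auto simp: outer_def)

lemma outer_mult_vec:
  assumes "s \<in> carrier_vec n" "t \<in> carrier_vec n" "w \<in> carrier_vec n"
  shows "outer s t *\<^sub>v w = (t \<bullet> w) \<cdot>\<^sub>v s"
  using assms by (intro eq_vecI) (auto simp: outer_def scalar_prod_def sum_distrib_left ac_simps)

lemma det_rank_one_update:
  fixes X :: "'a :: idom mat"
  assumes X: "X \<in> carrier_mat n n" and s: "s \<in> carrier_vec n" and t: "t \<in> carrier_vec n"
    and d0: "det X \<noteq> 0"
  shows "det (X - outer s t) = det X - t \<bullet> (adj_mat X *\<^sub>v s)"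
proof -
  let ?S = "mat n 1 (\<lambda>(i, _). s $ i)" and ?T = "mat 1 n (\<lambda>(_, j). t $ j)"
  have o: "outer s t = ?S * ?T"
    using s t by (intro eq_matI) (auto simp: outer_def scalar_prod_def)
  have *: "(?T * (adj_mat X * ?S)) $$ (0, 0) = t \<bullet> (adj_mat X *\<^sub>v s)"
    using s t adj_mat(1)[OF X] by (auto simp: scalar_prod_def intro!: sum.cong)
  show ?thesis unfolding o using det_rank_one_update_mat[OF X _ _ d0, of ?S ?T] * by simp
qed

text \<open>Put Y = X - s t^T. From Y adj(X) s = (det Y) s follows adj(Y) s = adj(X) s; now apply
  adj(Y) to Y w = X w - (t . w) s. Modulo det X and the entries of X w the identity says that adj(X)
  s is proportional to w.\<close>

lemma adj_mat_rank_one_update: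
  fixes X :: "'a :: idom mat"
  assumes X: "X \<in> carrier_mat n n" and s: "s \<in> carrier_vec n" and t: "t \<in> carrier_vec n"
    and w: "w \<in> carrier_vec n"
    and d0: "det X \<noteq> 0" and d1: "det (X - outer s t) \<noteq> 0" and i: "i < n"
  shows "(t \<bullet> (adj_mat X *\<^sub>v s)) * w $ i - (t \<bullet> w) * (adj_mat X *\<^sub>v s) $ i
    = det X * w $ i - (adj_mat (X - outer s t) *\<^sub>v (X *\<^sub>v w)) $ i"
proof -
  define Y where "Y = X - outer s t"
  have O: "outer s t \<in> carrier_mat n n" using outer_carrier[OF s t] .
  have Y: "Y \<in> carrier_mat n n" unfolding Y_def using X O by auto
  note R = adj_mat[OF X] and R2 = adj_mat[OF Y]
  define \<delta> where "\<delta> = det Y"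
  define v where "v = adj_mat X *\<^sub>v s"
  have v: "v \<in> carrier_vec n" unfolding v_def using R s by auto
  have \<delta>: "\<delta> = det X - t \<bullet> v" unfolding \<delta>_def Y_def v_def by (rule det_rank_one_update[OF X s t d0])
  have Yw: "Y *\<^sub>v x = X *\<^sub>v x - (t \<bullet> x) \<cdot>\<^sub>v s" if "x \<in> carrier_vec n" for x
    unfolding Y_def using that X O s t by (simp add: minus_mult_distrib_mat_vec[of _ n n] outer_mult_vec)
  have RY: "adj_mat Y *\<^sub>v (Y *\<^sub>v x) = \<delta> \<cdot>\<^sub>v x" if "x \<in> carrier_vec n" for x
    unfolding \<delta>_def using adj_mat_mult_vec(2)[OF Y that] .
  have Xv: "X *\<^sub>v v = det X \<cdot>\<^sub>v s"
    unfolding v_def using adj_mat_mult_vec(1)[OF X s] .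
  have Yv: "Y *\<^sub>v v = \<delta> \<cdot>\<^sub>v s" unfolding Yw[OF v] Xv \<delta> using s v t
    by (intro eq_vecI) (auto simp: algebra_simps)
  have "\<delta> \<cdot>\<^sub>v v = \<delta> \<cdot>\<^sub>v (adj_mat Y *\<^sub>v s)"
    using RY[OF v] unfolding Yv using mult_mat_vec_smult[OF R2(1) s] by simp
  hence "\<delta> * v $ j = \<delta> * (adj_mat Y *\<^sub>v s) $ j" if "j < n" for j
    using that v R2(1) s by (metis carrier_matD(1) carrier_vecD dim_mult_mat_vec index_smult_vec(1))
  hence vs: "v $ j = (adj_mat Y *\<^sub>v s) $ j" if "j < n" for j
    using that d1 unfolding \<delta>_def Y_def by auto
  have "\<delta> \<cdot>\<^sub>v w = adj_mat Y *\<^sub>v (X *\<^sub>v w - (t \<bullet> w) \<cdot>\<^sub>v s)" using RY[OF w] Yw[OF w] by simp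
  also have "\<dots> = adj_mat Y *\<^sub>v (X *\<^sub>v w) - (t \<bullet> w) \<cdot>\<^sub>v (adj_mat Y *\<^sub>v s)"
    using R2(1) X w s by (simp add: mult_minus_distrib_mat_vec[of _ n n] mult_mat_vec_smult)
  finally have "(\<delta> \<cdot>\<^sub>v w) $ i = (adj_mat Y *\<^sub>v (X *\<^sub>v w) - (t \<bullet> w) \<cdot>\<^sub>v (adj_mat Y *\<^sub>v s)) $ i" by simp
  hence "\<delta> * w $ i = (adj_mat Y *\<^sub>v (X *\<^sub>v w)) $ i - (t \<bullet> w) * v $ i"
    using i w R2(1) vs[OF i] by simp
  thus ?thesis unfolding \<delta> v_def[symmetric] Y_def[symmetric] by (simp add: algebra_simps)
qed

lemma dim_char_poly_matrix [simp]:
  "dim_row (char_poly_matrix A) = dim_row A" "dim_col (char_poly_matrix A) = dim_col A"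
  by (simp_all add: char_poly_matrix_def)

lemma char_poly_matrix_outer:
  fixes A :: "'a :: comm_ring_1 mat"
  assumes A: "A \<in> carrier_mat n n" and s: "s \<in> carrier_vec n" and t: "t \<in> carrier_vec n"
  shows "char_poly_matrix A - outer (const_vec s) (const_vec t)
    = char_poly_matrix (A + outer s t)"
  using assms by (intro eq_matI) (auto simp: char_poly_matrix_def outer_def)

lemma char_poly_nonzero:
  fixes A :: "'a :: comm_ring_1 mat"
  assumes A: "A \<in> carrier_mat n n"
  shows "char_poly A \<noteq> 0"
  using degree_monic_char_poly[OF A] by auto

text \<open>The case X = x - A. Both determinants are characteristic polynomials, hence monic and
  nonzero.\<close>

lemma adj_char_poly_matrix_identity:
  fixes A :: "'a :: idom mat"
  assumes A: "A \<in> carrier_mat n n" and s: "s \<in> carrier_vec n" and t: "t \<in> carrier_vec n"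
    and w: "w \<in> carrier_vec n" and i: "i < n"
  defines "X \<equiv> char_poly_matrix A" and "s' \<equiv> const_vec s" and "t' \<equiv> const_vec t"
  shows "(t' \<bullet> (adj_mat X *\<^sub>v s')) * w $ i - (t' \<bullet> w) * (adj_mat X *\<^sub>v s') $ i
    = char_poly A * w $ i - (adj_mat (char_poly_matrix (A + outer s t)) *\<^sub>v (X *\<^sub>v w)) $ i"
proof -
  have X: "X \<in> carrier_mat n n" unfolding X_def using A by simp
  have c: "s' \<in> carrier_vec n" "t' \<in> carrier_vec n" using s t by (auto simp: s'_def t'_def)
  have Y: "X - outer s' t' = char_poly_matrix (A + outer s t)"
    unfolding X_def s'_def t'_def by (rule char_poly_matrix_outer[OF A s t])
  have "A + outer s t \<in> carrier_mat n n" using A outer_carrier[OF s t] by auto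
  hence "det (X - outer s' t') \<noteq> 0" unfolding Y using char_poly_nonzero by (auto simp: char_poly_def)
  moreover have "det X \<noteq> 0" using char_poly_nonzero[OF A] unfolding X_def char_poly_def by simp
  ultimately show ?thesis using adj_mat_rank_one_update[OF X c w _ _ i] Y by (simp add: X_def char_poly_def)
qed

lemma char_poly_rank_one_update:
  fixes A :: "'a :: idom mat"
  assumes A: "A \<in> carrier_mat n n" and s: "s \<in> carrier_vec n" and t: "t \<in> carrier_vec n"
  shows "char_poly (A + outer s t) = char_poly A -
    const_vec t \<bullet> (adj_mat (char_poly_matrix A) *\<^sub>v const_vec s)"
  unfolding char_poly_def[of "A + outer s t"] char_poly_matrix_outer[OF A s t, symmetric]
  by (subst det_rank_one_update[of _ n]) (use assms char_poly_nonzero[OF A] in \<open>auto simp: char_poly_def\<close>)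

text \<open>Column j of adj(x - A) solves (x - A) w = chi e_j; substituting A gives chi(A) e_j =
  0.\<close>

theorem cayley_hamilton_mat:
  fixes A :: "'a :: comm_ring_1 mat"
  assumes A: "A \<in> carrier_mat n n"
  shows "mat_poly A (char_poly A) = 0\<^sub>m n n"
proof (rule eq_matI)
  fix i j assume "i < dim_row (0\<^sub>m n n :: 'a mat)" "j < dim_col (0\<^sub>m n n :: 'a mat)"
  hence ij: "i < n" "j < n" by auto
  let ?X = "char_poly_matrix A" and ?e = "unit_vec n j :: 'a vec"
  let ?e' = "const_vec ?e"
  have X: "?X \<in> carrier_mat n n" using A by simp
  have "?X *\<^sub>v (adj_mat ?X *\<^sub>v ?e') = char_poly A \<cdot>\<^sub>v ?e'"
    unfolding char_poly_def by (rule adj_mat_mult_vec[OF X]) auto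
  hence "?X *\<^sub>v (adj_mat ?X *\<^sub>v ?e') = char_poly A \<cdot>\<^sub>v ?e' + [:0:] \<cdot>\<^sub>v (0\<^sub>v n)"
    by (auto intro!: eq_vecI)
  hence "mat_poly A (char_poly A) *\<^sub>v ?e = (- 0) \<cdot>\<^sub>v vec_poly_eval A n (0\<^sub>v n)"
    by (intro mat_poly_mult_vec_eq[OF A]) (use adj_mat(1)[OF X] in auto)
  hence "(mat_poly A (char_poly A) *\<^sub>v ?e) $ i = 0" using ij by (simp add: vec_poly_eval_def[OF A])
  thus "mat_poly A (char_poly A) $$ (i, j) = 0\<^sub>m n n $$ (i, j)" using ij A by simp
qed (use A in auto)

lemma adj_mat_symmetric:
  fixes X :: "'a :: comm_ring_1 mat"
  assumes X: "X \<in> carrier_mat n n" and sym: "X\<^sup>T = X" and ij: "i < n" "j < n"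
  shows "adj_mat X $$ (i, j) = adj_mat X $$ (j, i)"
proof -
  have e: "X $$ (a, b) = X $$ (b, a)" if "a < n" "b < n" for a b
    by (rule symmetric_mat_index[OF X sym that])
  obtain m where m: "n = Suc m" using ij by (cases n) auto
  have "mat_delete X j i = (mat_delete X i j)\<^sup>T"
    using X ij by (intro eq_matI) (auto simp: mat_delete_def m intro!: e)
  moreover have "mat_delete X i j \<in> carrier_mat m m" using X m by (auto simp: mat_delete_def)
  ultimately have "det (mat_delete X j i) = det (mat_delete X i j)" using det_transpose by metis
  thus ?thesis using X ij by (simp add: adj_mat_def cofactor_def add.commute)
qed

lemma char_poly_matrix_symmetric:
  assumes "A \<in> carrier_mat n n" "A\<^sup>T = A"
  shows "(char_poly_matrix A)\<^sup>T = char_poly_matrix A"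
proof -
  have e: "A $$ (a, b) = A $$ (b, a)" if "a < n" "b < n" for a b
    by (rule symmetric_mat_index[OF assms that])
  show ?thesis using assms(1) by (intro eq_matI) (auto simp: char_poly_matrix_def intro!: e)
qed

lemma pderiv_char_poly_trace:
  fixes A :: "'a :: idom mat"
  assumes A: "A \<in> carrier_mat n n"
  shows "pderiv (char_poly A) = (\<Sum>i<n. adj_mat (char_poly_matrix A) $$ (i, i))"
  unfolding pderiv_char_poly[OF A]
proof (rule sum.cong)
  fix i assume i: "i \<in> {..<n}"
  have "mat_delete (char_poly_matrix A) i i = char_poly_matrix (mat_delete A i i)"
    using A i by (intro eq_matI) (auto simp: mat_delete_def char_poly_matrix_def)
  thus "char_poly (mat_delete A i i) = adj_mat (char_poly_matrix A) $$ (i, i)"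
    using A i by (auto simp: adj_mat_def cofactor_def char_poly_def)
qed simp

section \<open>Smith normal form and the last invariant factor\<close>

text \<open>The determinant condition is easy to check for elementary and block triangular matrices;
  \<open>unimodular_iff_invertible\<close> links it to the \<open>invertible_mat\<close> in the
  definition of the last invariant factor.\<close>

definition unimodular :: "nat \<Rightarrow> int mat \<Rightarrow> bool" where
  "unimodular n U \<longleftrightarrow> U \<in> carrier_mat n n \<and> det U dvd 1"

lemma unimodular_carrier: "unimodular n U \<Longrightarrow> U \<in> carrier_mat n n"
  by (simp add: unimodular_def)

lemma unimodular_one: "unimodular n (1\<^sub>m n)"
  by (simp add: unimodular_def)

lemma unimodular_mult: "unimodular n U \<Longrightarrow> unimodular n V \<Longrightarrow> unimodular n (U * V)"
  unfolding unimodular_def by (auto simp: det_mult abs_mult)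

lemma unimodular_transpose: "unimodular n U \<Longrightarrow> unimodular n (U\<^sup>T)"
  unfolding unimodular_def by (auto simp: det_transpose)

lemma unimodular_inverse:
  assumes "unimodular n U"
  obtains U' where "U' \<in> carrier_mat n n" "U * U' = 1\<^sub>m n" "U' * U = 1\<^sub>m n"
proof -
  have U: "U \<in> carrier_mat n n" using assms by (simp add: unimodular_def)
  obtain e where e: "det U * e = 1" using assms unfolding unimodular_def dvd_def by auto
  note R = adj_mat[OF U]
  have "U * (e \<cdot>\<^sub>m adj_mat U) = 1\<^sub>m n" "(e \<cdot>\<^sub>m adj_mat U) * U = 1\<^sub>m n"
    using mult_smult_distrib[OF U R(1), of e] mult_smult_assoc_mat[OF R(1) U, of e] R(2,3) e
    by (auto intro!: eq_matI simp: mult.commute)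
  thus ?thesis using that[of "e \<cdot>\<^sub>m adj_mat U"] R(1) by simp
qed

lemma unimodular_iff_invertible:
  assumes U: "U \<in> carrier_mat n n"
  shows "unimodular n U \<longleftrightarrow> invertible_mat U"
proof
  assume "unimodular n U"
  then obtain U' where "U' \<in> carrier_mat n n" "U * U' = 1\<^sub>m n" "U' * U = 1\<^sub>m n"
    by (rule unimodular_inverse)
  thus "invertible_mat U" unfolding invertible_mat_def inverts_mat_def using U by auto
next
  assume "invertible_mat U"
  then obtain B where B: "U * B = 1\<^sub>m n" "B * U = 1\<^sub>m (dim_row B)"
    using U unfolding invertible_mat_def inverts_mat_def by auto
  have "dim_col (U * B) = n" "dim_col (B * U) = dim_row B" using B by auto
  hence "B \<in> carrier_mat n n" using U by (intro carrier_matI) auto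
  hence "det U * det B = 1" using det_mult[OF U, of B] B(1) by simp
  thus "unimodular n U" using U unfolding unimodular_def by (metis dvd_triv_left)
qed

text \<open>The Smith normal form is obtained from an equivalent matrix with an entry of minimal
  absolute value; minimality is what forces all the divisibilities.\<close>

lemma minimal_entry_dvd_column:
  assumes C: "\<And>N. N \<in> C \<Longrightarrow> N \<in> carrier_mat n n"
    and closed: "\<And>N U. N \<in> C \<Longrightarrow> unimodular n U \<Longrightarrow> U * N \<in> C"
    and min: "\<And>N i j. N \<in> C \<Longrightarrow> i < n \<Longrightarrow> j < n \<Longrightarrow> N $$ (i, j) \<noteq> 0 \<Longrightarrow> k \<le> \<bar>N $$ (i, j)\<bar>"
    and k: "k > 0" and N: "N \<in> C" "N $$ (0, 0) = k" and i: "i < n"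
  shows "k dvd N $$ (i, 0)"
proof (cases "i = 0")
  case True thus ?thesis using N by simp
next
  case False
  have n: "0 < n" using i by simp
  \<comment> \<open>Adding this multiple of row 0 leaves N(i,0) mod k, which the minimality of k
    forces to be 0.\<close>
  define q where "q = - (N $$ (i, 0) div k)"
  have NC: "N \<in> carrier_mat n n" using C N by auto
  have u: "unimodular n (addrow_mat n q i 0)"
    unfolding unimodular_def using det_addrow_mat[of i 0 n q] False by simp
  have *: "addrow_mat n q i 0 * N = addrow q i 0 N"
    using addrow_mat[OF NC, of 0 q i] n by simp
  have "addrow q i 0 N \<in> C" using closed[OF N(1) u] * by simp
  moreover have "addrow q i 0 N $$ (i, 0) = N $$ (i, 0) mod k"
    using i n NC N(2) by (simp add: q_def minus_div_mult_eq_mod[symmetric])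
  ultimately have "N $$ (i, 0) mod k \<noteq> 0 \<Longrightarrow> k \<le> \<bar>N $$ (i, 0) mod k\<bar>"
    using min[of "addrow q i 0 N" i 0] i n by simp
  moreover have "0 \<le> N $$ (i, 0) mod k" "N $$ (i, 0) mod k < k" using k by auto
  ultimately show ?thesis by (auto simp: dvd_eq_mod_eq_0)
qed

lemma swap_to_first_row:
  assumes NC: "N \<in> carrier_mat n n" and i: "i < n" and j: "j < n"
  obtains U where "unimodular n U" "(U * N) $$ (0, j) = N $$ (i, j)"
proof (cases "i = 0")
  case True
  thus ?thesis using that[of "1\<^sub>m n"] unimodular_one NC by simp
next
  case False
  have u: "unimodular n (swaprows_mat n 0 i)"
    unfolding unimodular_def using det_swaprows_mat[of 0 n i, where ?'a = int] False i by auto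
  have "swaprows_mat n 0 i * N = swaprows 0 i N"
    using swaprows_mat[OF NC, of 0 i] i by simp
  thus ?thesis using that[OF u] i j NC by simp
qed

lemma smith_normal_form_exists:
  assumes "M \<in> carrier_mat n n"
  shows "\<exists>U V. unimodular n U \<and> unimodular n V \<and> smith_normal_form (U * M * V)"
  using assms
proof (induction n arbitrary: M)
  case 0
  hence "smith_normal_form (1\<^sub>m 0 * M * 1\<^sub>m 0)"
    by (auto simp: smith_normal_form_def diagonal_mat_def)
  thus ?case using unimodular_one by blast
next
  case (Suc m)
  let ?n = "Suc m"
  note M = Suc.prems
  show ?case
  proof (cases "\<exists>i<?n. \<exists>j<?n. M $$ (i, j) \<noteq> 0")
    case False
    hence "M = 0\<^sub>m ?n ?n" using M by (intro eq_matI) auto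
    hence "1\<^sub>m ?n * M * 1\<^sub>m ?n = 0\<^sub>m ?n ?n" by simp
    hence "smith_normal_form (1\<^sub>m ?n * M * 1\<^sub>m ?n)"
      by (simp only:) (auto simp: smith_normal_form_def diagonal_mat_def)
    thus ?thesis using unimodular_one by blast
  next
    case True
    \<comment> \<open>All matrices equivalent to \<open>M\<close>. \<open>CT\<close> holds their
      transposes, so that the lemma on columns serves for rows as well.\<close>
    define C where "C = {U * M * V | U V. unimodular ?n U \<and> unimodular ?n V}"
    define CT where "CT = transpose_mat ` C"
    have CC: "N \<in> carrier_mat ?n ?n" if "N \<in> C" for N
      using that M unfolding C_def by (auto dest!: unimodular_carrier)
    have CL: "U * N \<in> C" if N: "N \<in> C" and U: "unimodular ?n U" for N U
    proof -
      obtain U1 V1 where *: "N = U1 * M * V1" "unimodular ?n U1" "unimodular ?n V1"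
        using N unfolding C_def by auto
      have "U * N = (U * U1) * M * V1"
        using * M U by (auto dest!: unimodular_carrier simp: assoc_mult_mat[of _ ?n ?n _ ?n _ ?n])
      thus ?thesis unfolding C_def using * U unimodular_mult by blast
    qed
    have CR: "N * V \<in> C" if N: "N \<in> C" and V: "unimodular ?n V" for N V
    proof -
      obtain U1 V1 where *: "N = U1 * M * V1" "unimodular ?n U1" "unimodular ?n V1"
        using N unfolding C_def by auto
      have "N * V = U1 * M * (V1 * V)"
        using * M V by (auto dest!: unimodular_carrier simp: assoc_mult_mat[of _ ?n ?n _ ?n _ ?n])
      thus ?thesis unfolding C_def using * V unimodular_mult by blast
    qed
    have TC: "N \<in> carrier_mat ?n ?n" if "N \<in> CT" for N using that CC unfolding CT_def by auto
    have TL: "U * N \<in> CT" if NT: "N \<in> CT" and U: "unimodular ?n U" for N U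
    proof -
      obtain N' where N': "N' \<in> C" "N = N'\<^sup>T" using NT unfolding CT_def by auto
      have "U * N = (N' * U\<^sup>T)\<^sup>T"
        using transpose_mult[OF CC[OF N'(1)], of "U\<^sup>T" ?n] unimodular_carrier[OF U] N' by simp
      thus ?thesis unfolding CT_def using CR[OF N'(1) unimodular_transpose[OF U]] by auto
    qed
    have MC: "M \<in> C"
    proof -
      have "M = 1\<^sub>m ?n * M * 1\<^sub>m ?n" using M by simp
      thus ?thesis unfolding C_def using unimodular_one by blast
    qed
    define Q where "Q x \<longleftrightarrow> (\<exists>N\<in>C. \<exists>i<?n. \<exists>j<?n. N $$ (i, j) \<noteq> 0 \<and> nat \<bar>N $$ (i, j)\<bar> = x)" for x
    have "\<exists>x. Q x" using True MC unfolding Q_def by blast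
    hence QL: "Q (LEAST x. Q x)" by (auto intro: LeastI_ex)
    define k where "k = int (LEAST x. Q x)"
    have min: "k \<le> \<bar>N $$ (i, j)\<bar>" if "N \<in> C" "i < ?n" "j < ?n" "N $$ (i, j) \<noteq> 0" for N i j
    proof -
      have "Q (nat \<bar>N $$ (i, j)\<bar>)" unfolding Q_def using that by blast
      from Least_le[of Q, OF this] show ?thesis unfolding k_def by linarith
    qed
    have minT: "k \<le> \<bar>N $$ (i, j)\<bar>" if NT: "N \<in> CT" and ij: "i < ?n" "j < ?n" "N $$ (i, j) \<noteq> 0" for N i j
    proof -
      obtain N' where N': "N' \<in> C" "N = N'\<^sup>T" using NT unfolding CT_def by auto
      thus ?thesis using min[OF N'(1) ij(2,1)] ij CC[OF N'(1)] by auto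
    qed
    obtain N i j where N: "N \<in> C" "i < ?n" "j < ?n" "N $$ (i, j) \<noteq> 0" "\<bar>N $$ (i, j)\<bar> = k"
      using QL unfolding Q_def k_def by auto
    have k: "k > 0" using N by auto
    obtain U where U: "unimodular ?n U" "(U * N) $$ (0, j) = N $$ (i, j)"
      using swap_to_first_row[OF CC[OF N(1)] N(2,3)] by auto
    define N1 where "N1 = U * N"
    have N1: "N1 \<in> C" unfolding N1_def by (rule CL[OF N(1) U(1)])
    obtain V where V: "unimodular ?n V" "(V * N1\<^sup>T) $$ (0, 0) = N1\<^sup>T $$ (j, 0)"
      using swap_to_first_row[of "N1\<^sup>T" ?n j 0] CC[OF N1] N(3) by auto
    define N2 where "N2 = N1 * V\<^sup>T"
    have N2: "N2 \<in> C" unfolding N2_def by (rule CR[OF N1 unimodular_transpose[OF V(1)]])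
    have "N2\<^sup>T = V * N1\<^sup>T"
      unfolding N2_def using transpose_mult[OF CC[OF N1], of "V\<^sup>T" ?n] unimodular_carrier[OF V(1)] by simp
    hence "N2\<^sup>T $$ (0, 0) = N1\<^sup>T $$ (j, 0)" using V(2) by simp
    hence N200: "N2 $$ (0, 0) = N $$ (i, j)" using U(2) CC[OF N1] CC[OF N2] N(3) by (simp add: N1_def[symmetric])
    define e :: int where "e = (if N $$ (i, j) < 0 then -1 else 1)"
    have eu: "unimodular ?n (e \<cdot>\<^sub>m 1\<^sub>m ?n)" unfolding unimodular_def by (auto simp: e_def)
    define N3 where "N3 = (e \<cdot>\<^sub>m 1\<^sub>m ?n) * N2"
    have N3: "N3 \<in> C" unfolding N3_def by (rule CL[OF N2 eu])
    have "N3 = e \<cdot>\<^sub>m N2" unfolding N3_def using mult_smult_assoc_mat[OF one_carrier_mat CC[OF N2], of e] CC[OF N2] by simp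
    hence N300: "N3 $$ (0, 0) = k" using N200 N CC[OF N2] by (auto simp: e_def)
    have dvd_col: "k dvd N $$ (i, 0)" if "N \<in> C" "N $$ (0, 0) = k" "i < ?n" for N i
      by (rule minimal_entry_dvd_column[of C, OF CC CL min k that])
    have dvd_row: "k dvd N $$ (0, j)" if "N \<in> C" "N $$ (0, 0) = k" "j < ?n" for N j
    proof -
      have "k dvd N\<^sup>T $$ (j, 0)"
        by (rule minimal_entry_dvd_column[of CT, OF TC TL minT k]) (use that CC[OF that(1)] in \<open>auto simp: CT_def\<close>)
      thus ?thesis using CC[OF that(1)] that by simp
    qed
    define K where "K = mat 1 1 (\<lambda>_. k)"
    define c where "c = mat m 1 (\<lambda>(i, _). N3 $$ (Suc i, 0) div k)"
    define r where "r = mat 1 m (\<lambda>(_, j). N3 $$ (0, Suc j) div k)"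
    define M1 where "M1 = mat m m (\<lambda>(i, j). N3 $$ (Suc i, Suc j))"
    have carr: "K \<in> carrier_mat 1 1" "c \<in> carrier_mat m 1" "r \<in> carrier_mat 1 m" "M1 \<in> carrier_mat m m"
      unfolding K_def c_def r_def M1_def by auto
    have N3b: "N3 = four_block_mat K (k \<cdot>\<^sub>m r) (k \<cdot>\<^sub>m c) M1"
    proof (rule eq_matI)
      fix i j assume "i < dim_row (four_block_mat K (k \<cdot>\<^sub>m r) (k \<cdot>\<^sub>m c) M1)" "j < dim_col (four_block_mat K (k \<cdot>\<^sub>m r) (k \<cdot>\<^sub>m c) M1)"
      hence ij: "i < ?n" "j < ?n" using carr by auto
      show "N3 $$ (i, j) = four_block_mat K (k \<cdot>\<^sub>m r) (k \<cdot>\<^sub>m c) M1 $$ (i, j)"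
        using ij N300 dvd_col[OF N3 N300, of i] dvd_row[OF N3 N300, of j] carr
        by (cases i; cases j) (auto simp: K_def c_def r_def M1_def)
    qed (use carr CC[OF N3] in auto)
    define M2 where "M2 = M1 - k \<cdot>\<^sub>m (c * r)"
    have M2: "M2 \<in> carrier_mat m m" unfolding M2_def using carr by auto
    define L where "L = four_block_mat (1\<^sub>m 1) (0\<^sub>m 1 m) (- c) (1\<^sub>m m)"
    define R where "R = four_block_mat (1\<^sub>m 1) (- r) (0\<^sub>m m 1) (1\<^sub>m m)"
    have uL: "unimodular ?n L"
      unfolding unimodular_def L_def
      using carr by (auto simp: det_four_block_mat_upper_right_zero[of _ 1 _ m])
    have uR: "unimodular ?n R"
      unfolding unimodular_def R_def
      using carr by (auto simp: det_four_block_mat_lower_left_zero[of _ 1 _ m])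
    define N4 where "N4 = L * N3 * R"
    have N4: "N4 \<in> C" unfolding N4_def by (intro CR[OF CL[OF N3 uL] uR])
    have Kc: "c * K = k \<cdot>\<^sub>m c" "K * r = k \<cdot>\<^sub>m r"
      using carr by (auto intro!: eq_matI simp: K_def scalar_prod_def)
    have LN: "L * N3 = four_block_mat K (k \<cdot>\<^sub>m r) (0\<^sub>m m 1) M2"
    proof -
      have "(- c) * (k \<cdot>\<^sub>m r) = - (k \<cdot>\<^sub>m (c * r))"
        using carr mult_smult_distrib[OF carr(2,3), of k] by (simp add: uminus_mult_left_mat[symmetric])
      moreover have "(- c) * K = - (k \<cdot>\<^sub>m c)" using carr Kc by (simp add: uminus_mult_left_mat[symmetric])
      ultimately show ?thesis unfolding L_def N3b
        by (subst mult_four_block_mat[of _ 1 1 _ m _ m _ _ 1 _ m])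
           (use carr M2 in \<open>auto intro!: cong_four_block_mat eq_matI simp: M2_def\<close>)
    qed
    have N4b: "N4 = four_block_mat K (0\<^sub>m 1 m) (0\<^sub>m m 1) M2"
    proof -
      have "K * (- r) = - (k \<cdot>\<^sub>m r)" using carr Kc by (simp add: uminus_mult_right_mat[symmetric])
      thus ?thesis unfolding N4_def LN R_def
        by (subst mult_four_block_mat[of _ 1 1 _ m _ m _ _ 1 _ m])
           (use carr M2 in \<open>auto intro!: cong_four_block_mat eq_matI\<close>)
    qed
    \<comment> \<open>Adding row \<open>Suc i\<close> to row 0 keeps \<open>k\<close> in the corner,
      because column 0 of \<open>N4\<close> vanishes below it, and copies a row of \<open>M2\<close>
      beside it. Row divisibility thus reaches the interior.\<close>
    have M2dvd: "k dvd M2 $$ (i, j)" if ij: "i < m" "j < m" for i j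
    proof -
      have u: "unimodular ?n (addrow_mat ?n 1 0 (Suc i))"
        unfolding unimodular_def using det_addrow_mat[of 0 "Suc i" ?n "1 :: int"] by simp
      have *: "addrow_mat ?n 1 0 (Suc i) * N4 = addrow 1 0 (Suc i) N4"
        using addrow_mat[OF CC[OF N4], of "Suc i" 1 0] ij by simp
      have A: "addrow 1 0 (Suc i) N4 \<in> C" using CL[OF N4 u] * by simp
      have "addrow 1 0 (Suc i) N4 $$ (0, 0) = k" "addrow 1 0 (Suc i) N4 $$ (0, Suc j) = M2 $$ (i, j)"
        using ij carr M2 unfolding N4b by (auto simp: K_def)
      thus ?thesis using dvd_row[OF A, of "Suc j"] ij by simp
    qed
    obtain U' V' where UV: "unimodular m U'" "unimodular m V'" "smith_normal_form (U' * M2 * V')"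
      using Suc.IH[OF M2] by auto
    note UVc = unimodular_carrier[OF UV(1)] unimodular_carrier[OF UV(2)]
    define S where "S = U' * M2 * V'"
    have S: "S \<in> carrier_mat m m" unfolding S_def using UVc M2 by auto
    have Sdvd: "k dvd S $$ (i, j)" if ij: "i < m" "j < m" for i j
    proof -
      define T where "T = U' * M2"
      have T: "T \<in> carrier_mat m m" unfolding T_def using UVc M2 by auto
      have "k dvd T $$ (i, l)" if "l < m" for l
        using ij that UVc M2 M2dvd unfolding T_def by (auto simp: scalar_prod_def intro!: dvd_sum)
      thus ?thesis using ij UVc T unfolding S_def T_def[symmetric]
        by (auto simp: scalar_prod_def intro!: dvd_sum)
    qed
    define U2 where "U2 = four_block_mat (1\<^sub>m 1) (0\<^sub>m 1 m) (0\<^sub>m m 1) U'"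
    define V2 where "V2 = four_block_mat (1\<^sub>m 1) (0\<^sub>m 1 m) (0\<^sub>m m 1) V'"
    have uU2: "unimodular ?n U2" and uV2: "unimodular ?n V2"
      unfolding unimodular_def U2_def V2_def using UVc UV
      by (auto simp: det_four_block_mat_upper_right_zero[of _ 1 _ m] unimodular_def)
    define F where "F = four_block_mat K (0\<^sub>m 1 m) (0\<^sub>m m 1) S"
    have "U2 * N4 * V2 \<in> C" by (intro CR[OF CL[OF N4 uU2] uV2])
    moreover have D: "U2 * N4 * V2 = F"
    proof -
      have "U2 * N4 = four_block_mat K (0\<^sub>m 1 m) (0\<^sub>m m 1) (U' * M2)"
        unfolding U2_def N4b
        by (subst mult_four_block_mat[of _ 1 1 _ m _ m _ _ 1 _ m])
           (use carr M2 UVc in \<open>auto intro!: cong_four_block_mat\<close>)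
      moreover have "U' * M2 \<in> carrier_mat m m" using UVc M2 by auto
      ultimately show ?thesis unfolding V2_def S_def F_def
        by (simp only:, subst mult_four_block_mat[of _ 1 1 _ m _ m _ _ 1 _ m])
           (use carr UVc in \<open>auto intro!: cong_four_block_mat\<close>)
    qed
    moreover have "smith_normal_form F"
    proof -
      have Ss: "smith_normal_form S" using UV(3) unfolding S_def .
      have ent: "F $$ (i, j) =
        (if i = 0 \<and> j = 0 then k else if i = 0 \<or> j = 0 then 0 else S $$ (i - 1, j - 1))" if "i < ?n" "j < ?n" for i j
        using that carr S by (auto simp: K_def F_def)
      have dim: "dim_row F = ?n" "dim_col F = ?n"
        using carr S by (auto simp: F_def)
      show ?thesis unfolding smith_normal_form_def diagonal_mat_def dim
      proof (intro conjI allI impI)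
        fix i j assume "i < ?n" "j < ?n" "i \<noteq> j"
        thus "F $$ (i, j) = 0"
          using Ss S by (cases i; cases j) (auto simp: ent smith_normal_form_def diagonal_mat_def)
      next
        fix i assume "i < min ?n ?n"
        thus "F $$ (i, i) \<ge> 0"
          using Ss S k by (cases i) (auto simp: ent smith_normal_form_def)
      next
        fix i assume i: "Suc i < min ?n ?n"
        show "F $$ (i, i) dvd F $$ (Suc i, Suc i)"
          using i Ss S Sdvd[of 0 0] by (cases i) (auto simp: ent smith_normal_form_def)
      qed
    qed
    ultimately have "F \<in> C" "smith_normal_form F" by auto
    thus ?thesis unfolding C_def by blast
  qed
qed

section \<open>The last invariant factor as the denominator of the inverse matrix\<close>

lemma smith_normal_form_diag_dvd:
  assumes "smith_normal_form D" "D \<in> carrier_mat n n" "i \<le> j" "j < n"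
  shows "D $$ (i, i) dvd D $$ (j, j)"
  using assms(3,4)
proof (induction j rule: dec_induct)
  case (step m)
  have "D $$ (m, m) dvd D $$ (Suc m, Suc m)"
    using assms(1,2) step.prems by (auto simp: smith_normal_form_def)
  thus ?case using step by (meson Suc_lessD dvd_trans)
qed simp

text \<open>The last diagonal entry d is the least multiplier, in the sense of divisibility, for
  which d M^(-1) is integral. This description does not involve \<open>U\<close> and
  \<open>V\<close>, so it also shows that d does not depend on them.\<close>

lemma smith_last_entry:
  fixes M :: "int mat"
  assumes M: "M \<in> carrier_mat n n" and det0: "det M \<noteq> 0" and n: "n > 0"
    and U: "unimodular n U" and V: "unimodular n V" and snf: "smith_normal_form (U * M * V)"
  defines "d \<equiv> (U * M * V) $$ (n - 1, n - 1)"
  shows "d > 0" "\<exists>Y\<in>carrier_mat n n. M * Y = d \<cdot>\<^sub>m 1\<^sub>m n"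
    "\<And>Y c. Y \<in> carrier_mat n n \<Longrightarrow> M * Y = c \<cdot>\<^sub>m 1\<^sub>m n \<Longrightarrow> d dvd c"
proof -
  note Uc = unimodular_carrier[OF U] and Vc = unimodular_carrier[OF V]
  define D where "D = U * M * V"
  have D: "D \<in> carrier_mat n n" unfolding D_def using Uc Vc M by auto
  have Ds: "smith_normal_form D" using snf unfolding D_def .
  obtain U' where U': "U' \<in> carrier_mat n n" "U * U' = 1\<^sub>m n" "U' * U = 1\<^sub>m n" using unimodular_inverse[OF U] .
  obtain V' where V': "V' \<in> carrier_mat n n" "V * V' = 1\<^sub>m n" "V' * V = 1\<^sub>m n" using unimodular_inverse[OF V] .
  have "det D = det U * det M * det V"
    unfolding D_def using det_mult[of "U * M" n V] det_mult[OF Uc M] Uc Vc M by simp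
  moreover have "det U \<noteq> 0" "det V \<noteq> 0" using U V unfolding unimodular_def by auto
  ultimately have "det D \<noteq> 0" using det0 by simp
  moreover have "upper_triangular D" using Ds D
    unfolding smith_normal_form_def diagonal_mat_def upper_triangular_def by auto
  ultimately have "D $$ (i, i) \<noteq> 0" if "i < n" for i
    using that D det_upper_triangular[OF _ D] by (auto simp: diag_mat_def prod_list_zero_iff)
  hence pos: "D $$ (i, i) > 0" if "i < n" for i
    using that Ds D unfolding smith_normal_form_def by (metis carrier_matD less_le min.idem)
  have d: "d = D $$ (n - 1, n - 1)" unfolding d_def D_def ..
  show "d > 0" unfolding d using pos n by simp
  \<comment> \<open>E = d D^(-1), which is integral because every diagonal entry of D divides the
    last one.\<close>
  define E where "E = mat n n (\<lambda>(i, j). if i = j then d div D $$ (i, i) else 0)"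
  have E: "E \<in> carrier_mat n n" unfolding E_def by auto
  have DE: "D * E = d \<cdot>\<^sub>m 1\<^sub>m n"
  proof (rule eq_matI)
    fix i j assume "i < dim_row (d \<cdot>\<^sub>m 1\<^sub>m n)" "j < dim_col (d \<cdot>\<^sub>m 1\<^sub>m n)"
    hence ij: "i < n" "j < n" by auto
    have "(D * E) $$ (i, j) = (\<Sum>l\<in>{0..<n}. D $$ (i, l) * (if l = j then d div D $$ (l, l) else 0))"
      using ij D by (simp add: scalar_prod_def E_def)
    also have "\<dots> = (\<Sum>l\<in>{0..<n}. if l = j then D $$ (i, j) * (d div D $$ (j, j)) else 0)"
      by (rule sum.cong) auto
    also have "\<dots> = D $$ (i, j) * (d div D $$ (j, j))" using ij by simp
    also have "\<dots> = (d \<cdot>\<^sub>m 1\<^sub>m n) $$ (i, j)"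
      using ij Ds D smith_normal_form_diag_dvd[OF Ds D, of j "n - 1"] unfolding d
      by (auto simp: smith_normal_form_def diagonal_mat_def)
    finally show "(D * E) $$ (i, j) = (d \<cdot>\<^sub>m 1\<^sub>m n) $$ (i, j)" .
  qed (use D E in auto)
  note assoc = assoc_mult_mat[of _ n n _ n _ n]
  show "\<exists>Y\<in>carrier_mat n n. M * Y = d \<cdot>\<^sub>m 1\<^sub>m n"
  proof
    have "M * (V * E * U) = (U' * U) * (M * (V * E * U))" unfolding U'(3) using M Uc Vc E by simp
    also have "\<dots> = U' * (D * E) * U" unfolding D_def using M Uc Vc E U'(1) by (simp add: assoc)
    also have "\<dots> = d \<cdot>\<^sub>m (U' * U)" unfolding DE
      using mult_smult_distrib[OF U'(1) one_carrier_mat, of d] mult_smult_assoc_mat[OF U'(1) Uc, of d] U'(1) by simp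
    finally show "M * (V * E * U) = d \<cdot>\<^sub>m 1\<^sub>m n" unfolding U'(3) .
    show "V * E * U \<in> carrier_mat n n" using Uc Vc E by auto
  qed
  fix Y c assume Y: "Y \<in> carrier_mat n n" and MY: "M * Y = c \<cdot>\<^sub>m 1\<^sub>m n"
  \<comment> \<open>Y transported to the diagonal form: D Z = c, and the last diagonal entry of D Z
    is a multiple of d.\<close>
  define Z where "Z = V' * Y * U'"
  have Z: "Z \<in> carrier_mat n n" unfolding Z_def using V' Y U' by auto
  have "D * Z = U * M * ((V * V') * (Y * U'))" unfolding D_def Z_def using M Uc Vc V'(1) Y U'(1) by (simp add: assoc)
  also have "\<dots> = U * (M * Y) * U'" unfolding V'(2) using M Uc Y U'(1) by (simp add: assoc)
  also have "\<dots> = c \<cdot>\<^sub>m (U * U')" unfolding MY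
    using mult_smult_distrib[OF Uc one_carrier_mat, of c] mult_smult_assoc_mat[OF Uc U'(1), of c] Uc by simp
  finally have DZ: "D * Z = c \<cdot>\<^sub>m 1\<^sub>m n" unfolding U'(2) .
  have "c = (D * Z) $$ (n - 1, n - 1)" unfolding DZ using n by simp
  also have "\<dots> = (\<Sum>l\<in>{0..<n}. D $$ (n - 1, l) * Z $$ (l, n - 1))"
    using D Z n by (auto simp: scalar_prod_def)
  also have "d dvd \<dots>"
  proof (rule dvd_sum)
    fix l assume "l \<in> {0..<n}"
    thus "d dvd D $$ (n - 1, l) * Z $$ (l, n - 1)"
      using Ds D n unfolding d by (cases "l = n - 1") (auto simp: smith_normal_form_def diagonal_mat_def)
  qed
  finally show "d dvd c" .
qed

text \<open>The definite description is justified by \<open>smith_normal_form_exists\<close> and by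
  the fact that two positive candidates divide each other. Later proofs work with these three
  properties alone.\<close>

lemma last_invariant_factor:
  assumes M: "M \<in> carrier_mat n n" and det0: "det M \<noteq> 0" and n: "n > 0"
  shows last_invariant_factor_pos: "last_invariant_factor M > 0"
    and last_invariant_factor_inverse: "\<exists>Y\<in>carrier_mat n n. M * Y = last_invariant_factor M \<cdot>\<^sub>m 1\<^sub>m n"
    and last_invariant_factor_dvd: "\<And>Y c. Y \<in> carrier_mat n n \<Longrightarrow> M * Y = c \<cdot>\<^sub>m 1\<^sub>m n \<Longrightarrow> last_invariant_factor M dvd c"
proof -
  define P where "P d \<longleftrightarrow> d > 0 \<and> (\<exists>Y\<in>carrier_mat n n. M * Y = d \<cdot>\<^sub>m 1\<^sub>m n) \<and>
     (\<forall>Y\<in>carrier_mat n n. \<forall>c. M * Y = c \<cdot>\<^sub>m 1\<^sub>m n \<longrightarrow> d dvd c)" for d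
  have uniq: "d = d'" if "P d" "P d'" for d d'
  proof -
    have "d dvd d'" "d' dvd d" using that unfolding P_def by blast+
    thus ?thesis using that zdvd_antisym_nonneg[of d d'] unfolding P_def by auto
  qed
  define Q where "Q d \<longleftrightarrow> (\<exists>U V. U \<in> carrier_mat (dim_row M) (dim_row M) \<and> invertible_mat U \<and>
                   V \<in> carrier_mat (dim_col M) (dim_col M) \<and> invertible_mat V \<and>
                   smith_normal_form (U * M * V) \<and>
                   (let k = min (dim_row M) (dim_col M) - 1 in d = (U * M * V) $$ (k, k)))" for d
  have QP: "P d" if "Q d" for d
  proof -
    obtain U V where "U \<in> carrier_mat n n" "invertible_mat U" "V \<in> carrier_mat n n" "invertible_mat V"
      and s: "smith_normal_form (U * M * V)" and d: "d = (U * M * V) $$ (n - 1, n - 1)"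
      using \<open>Q d\<close> M unfolding Q_def by (auto simp: Let_def)
    hence U: "unimodular n U" and V: "unimodular n V" by (auto simp: unimodular_iff_invertible)
    show ?thesis unfolding P_def d using smith_last_entry[OF M det0 n U V s] by blast
  qed
  have "\<exists>d. Q d"
  proof -
    obtain U V where U: "unimodular n U" and V: "unimodular n V" and s: "smith_normal_form (U * M * V)"
      using smith_normal_form_exists[OF M] by auto
    have "Q ((U * M * V) $$ (n - 1, n - 1))"
      unfolding Q_def
      by (rule exI[of _ U], rule exI[of _ V])
        (use M U V s unimodular_carrier[OF U] unimodular_carrier[OF V]
          unimodular_iff_invertible[of U n] unimodular_iff_invertible[of V n] in \<open>simp add: Let_def\<close>)
    thus ?thesis ..
  qed
  then obtain d where d: "Q d" ..
  have "last_invariant_factor M = d"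
    unfolding last_invariant_factor_def Q_def[symmetric]
    using d QP uniq by (intro the_equality) blast+
  hence "P (last_invariant_factor M)" using QP[OF d] by simp
  thus "last_invariant_factor M > 0" "\<exists>Y\<in>carrier_mat n n. M * Y = last_invariant_factor M \<cdot>\<^sub>m 1\<^sub>m n"
    "\<And>Y c. Y \<in> carrier_mat n n \<Longrightarrow> M * Y = c \<cdot>\<^sub>m 1\<^sub>m n \<Longrightarrow> last_invariant_factor M dvd c"
    unfolding P_def by auto
qed

text \<open>If W1 Y = d, then d N^T = l W2 Y, so l divides every d N(i,j). Hence l / gcd(l, d)
  divides every entry of N, and \<open>prim\<close> leaves it without prime divisors.\<close>

lemma level_dvd_last_invariant_factor:
  fixes N :: "int mat"
  assumes N: "N \<in> carrier_mat n n" and W1: "W1 \<in> carrier_mat n n" and W2: "W2 \<in> carrier_mat n n"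
    and eq: "N\<^sup>T * W1 = l \<cdot>\<^sub>m W2" and det0: "det W1 \<noteq> 0" and n: "n > 0" and l: "l > 0"
    and prim: "\<And>p. prime p \<Longrightarrow> p dvd l \<Longrightarrow> \<exists>i<n. \<exists>j<n. \<not> p dvd N $$ (i, j)"
  shows "l dvd last_invariant_factor W1"
proof -
  define d where "d = last_invariant_factor W1"
  obtain Y where Y: "Y \<in> carrier_mat n n" "W1 * Y = d \<cdot>\<^sub>m 1\<^sub>m n"
    using last_invariant_factor_inverse[OF W1 det0 n] unfolding d_def by blast
  have Nt: "N\<^sup>T \<in> carrier_mat n n" using N by simp
  have "N\<^sup>T * (W1 * Y) = l \<cdot>\<^sub>m (W2 * Y)"
    unfolding assoc_mult_mat[OF Nt W1 Y(1), symmetric] eq by (rule mult_smult_assoc_mat[OF W2 Y(1)])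
  moreover have "N\<^sup>T * (W1 * Y) = d \<cdot>\<^sub>m N\<^sup>T"
    unfolding Y(2) using mult_smult_distrib[OF Nt one_carrier_mat, of d] Nt by simp
  ultimately have e: "d \<cdot>\<^sub>m N\<^sup>T = l \<cdot>\<^sub>m (W2 * Y)" by simp
  have dN: "l dvd d * N $$ (i, j)" if "i < n" "j < n" for i j
  proof -
    have "(d \<cdot>\<^sub>m N\<^sup>T) $$ (j, i) = (l \<cdot>\<^sub>m (W2 * Y)) $$ (j, i)" using e by simp
    thus ?thesis using that N W2 Y(1) by (auto simp del: index_mult_mat(1) intro: dvdI)
  qed
  define g where "g = gcd l d"
  have g: "g > 0" unfolding g_def using l by simp
  obtain l' d' where ld: "l = g * l'" "d = g * d'" "algebraic_semidom_class.coprime l' d'"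
  proof -
    have "gcd l d \<noteq> 0" using l by simp
    from gcd_coprime_exists[OF this] obtain l' d' where "l = l' * g" "d = d' * g" "algebraic_semidom_class.coprime l' d'"
      unfolding g_def by blast
    thus ?thesis using that[of l' d'] by (simp add: mult.commute)
  qed
  have "l' dvd N $$ (i, j)" if "i < n" "j < n" for i j
  proof -
    have "g * l' dvd g * (d' * N $$ (i, j))" using dN[OF that] ld by (simp add: mult.assoc)
    hence "l' dvd d' * N $$ (i, j)" using g by simp
    thus ?thesis using ld(3) by (simp add: coprime_dvd_mult_right_iff)
  qed
  hence "\<not> (\<exists>p. prime p \<and> p dvd l')"
    using prim ld(1) by (meson dvd_mult dvd_trans)
  moreover have "l' \<noteq> 0" using l ld(1) by auto
  ultimately have "is_unit l'" using prime_divisor_exists[of l'] by blast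
  moreover have "l' > 0" using l g unfolding ld(1) by (simp add: zero_less_mult_iff)
  ultimately have "l' = 1" by simp
  hence "l dvd d" using ld(1,2) by simp
  thus ?thesis unfolding d_def .
qed

text \<open>The integral Y with W Y = d is nonzero mod p, since otherwise d / p would do as well. A
  column of Y that is nonzero mod p is a dependency between the columns of W mod p.\<close>

lemma rank_mod_less:
  assumes W: "W \<in> carrier_mat n n" and det0: "det W \<noteq> 0" and n: "n > 0"
    and p: "prime p" and dvd: "p dvd last_invariant_factor W"
  shows "rank_mod p W < n"
proof -
  define d where "d = last_invariant_factor W"
  have d: "d > 0" unfolding d_def by (rule last_invariant_factor_pos[OF W det0 n])
  obtain Y where Y: "Y \<in> carrier_mat n n" "W * Y = d \<cdot>\<^sub>m 1\<^sub>m n"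
    using last_invariant_factor_inverse[OF W det0 n] unfolding d_def by blast
  obtain d' where d': "d = p * d'" using dvd unfolding d_def by auto
  have p1: "p > 1" using p by (rule prime_gt_1_int)
  have "\<exists>i<n. \<exists>j<n. \<not> p dvd Y $$ (i, j)"
  proof (rule ccontr)
    assume "\<not> ?thesis"
    hence all: "p dvd Y $$ (i, j)" if "i < n" "j < n" for i j using that by blast
    define Z where "Z = mat n n (\<lambda>(i, j). Y $$ (i, j) div p)"
    have Z: "Z \<in> carrier_mat n n" unfolding Z_def by simp
    have "Y = p \<cdot>\<^sub>m Z" using Y(1) all by (intro eq_matI) (auto simp: Z_def)
    hence "p \<cdot>\<^sub>m (W * Z) = (p * d') \<cdot>\<^sub>m 1\<^sub>m n" using Y(2) mult_smult_distrib[OF W Z, of p] d' by simp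
    hence *: "(p \<cdot>\<^sub>m (W * Z)) $$ (i, j) = ((p * d') \<cdot>\<^sub>m 1\<^sub>m n) $$ (i, j)" for i j by simp
    have "p * (W * Z) $$ (i, j) = p * (d' \<cdot>\<^sub>m 1\<^sub>m n) $$ (i, j)" if "i < n" "j < n" for i j
      using *[of i j] that W Z by (simp del: index_mult_mat(1) add: mult.assoc)
    hence "W * Z = d' \<cdot>\<^sub>m 1\<^sub>m n" using p1 W Z by (intro eq_matI) (auto simp del: index_mult_mat(1))
    from last_invariant_factor_dvd[OF W det0 n Z this] have "d dvd d'" unfolding d_def .
    hence "d \<le> d'" using d d' p1 by (intro zdvd_imp_le) (auto simp: zero_less_mult_iff)
    moreover have "d' > 0" using d d' p1 by (simp add: zero_less_mult_iff)
    ultimately show False using d' p1 by (simp add: mult_le_cancel_right1)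
  qed
  then obtain i0 j0 where ij: "i0 < n" "j0 < n" "\<not> p dvd Y $$ (i0, j0)" by blast
  have not_indep: "\<not> lin_indep_cols_mod p W {..<n}"
  proof
    assume li: "lin_indep_cols_mod p W {..<n}"
    have *: "p dvd (\<Sum>j\<in>{..<n}. Y $$ (j, j0) * W $$ (i, j))" if i: "i < dim_row W" for i
    proof -
      have "(\<Sum>j\<in>{..<n}. Y $$ (j, j0) * W $$ (i, j)) = (W * Y) $$ (i, j0)"
        using i W Y(1) ij by (auto simp: scalar_prod_def lessThan_atLeast0 mult.commute intro!: sum.cong)
      also have "p dvd \<dots>" unfolding Y(2) d' using i W ij by simp
      finally show ?thesis .
    qed
    have "p dvd Y $$ (i0, j0)"
      by (rule li[unfolded lin_indep_cols_mod_def, rule_format, of "\<lambda>j. Y $$ (j, j0)"]) (use * ij in auto)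
    thus False using ij by blast
  qed
  define R where "R = {card C | C. C \<subseteq> {..<dim_col W} \<and> lin_indep_cols_mod p W C}"
  have "k < n" if k: "k \<in> R" for k
  proof -
    obtain C where C: "k = card C" "C \<subseteq> {..<n}" "lin_indep_cols_mod p W C" using k W unfolding R_def by auto
    have "C \<noteq> {..<n}" using C(3) not_indep by blast
    hence "card C < card {..<n}" using C(2) by (intro psubset_card_mono) auto
    thus ?thesis using C(1) by simp
  qed
  moreover have "0 \<in> R" unfolding R_def lin_indep_cols_mod_def by (auto intro!: exI[of _ "{}"])
  moreover have "finite R" using calculation(1) by (meson bounded_nat_set_is_finite)
  ultimately show ?thesis unfolding rank_mod_def R_def[symmetric] by (subst Max_less_iff) auto
qed

section \<open>Polynomials modulo a prime\<close>

context poly_mod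
begin

lemma Mp_eq_iff: "Mp f = Mp g \<longleftrightarrow> (\<forall>k. m dvd coeff f k - coeff g k)"
  by (auto simp: poly_eq_iff Mp_coeff M_def mod_eq_dvd_iff)

lemma Mp_eqE:
  assumes "Mp f = Mp g"
  obtains r where "f = g + Polynomial.smult m r"
proof
  show "f = g + Polynomial.smult m (map_poly (\<lambda>a. a div m) (f - g))"
    using assms unfolding Mp_eq_iff by (intro poly_eqI) (simp add: coeff_map_poly)
qed

lemma Mp_eq_ex: "Mp f = Mp g \<Longrightarrow> \<exists>r. f = g + Polynomial.smult m r"
  by (erule Mp_eqE) blast

lemma Mp_add_smult [simp]: "Mp (f + Polynomial.smult m r) = Mp f"
  by (simp add: Mp_eq_iff)

lemma dvdm_refl: "f dvdm f"
  unfolding dvdm_def by (rule exI[of _ 1]) simp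

lemma dvdm_add: "f dvdm a \<Longrightarrow> f dvdm b \<Longrightarrow> f dvdm a + b"
  unfolding dvdm_def by (metis (no_types, opaque_lifting) distrib_left plus_Mp(1) plus_Mp(2))

lemma dvdm_mult_right: "f dvdm a \<Longrightarrow> f dvdm a * b"
  unfolding dvdm_def by (metis (no_types, opaque_lifting) mult.assoc mult_Mp(1))

lemma dvdm_mult_left: "f dvdm a \<Longrightarrow> f dvdm b * a"
  using dvdm_mult_right[of f a b] by (simp add: mult.commute)

lemma dvdm_diff: "f dvdm a \<Longrightarrow> f dvdm b \<Longrightarrow> f dvdm a - b"
  using dvdm_add[of f a "- 1 * b"] dvdm_mult_left[of f b "- 1"] by simp

lemma dvdm_trans: "f dvdm g \<Longrightarrow> g dvdm h \<Longrightarrow> f dvdm h"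
  unfolding dvdm_def by (metis (no_types, opaque_lifting) mult.assoc mult_Mp(1))

lemma dvdm_cong: "Mp g = Mp h \<Longrightarrow> f dvdm g \<longleftrightarrow> f dvdm h"
  unfolding dvdm_def by simp

end

context poly_mod_2
begin

lemma Mp_mult_monic_0:
  assumes s: "monic s" and 0: "Mp (a * s) = 0"
  shows "Mp a = 0"
proof (rule ccontr)
  assume a: "Mp a \<noteq> 0"
  have "coeff (Mp a * s) (degree (Mp a) + degree s) = lead_coeff (Mp a)"
    using s by (simp add: coeff_mult_degree_sum)
  moreover have "Mp (Mp a * s) = 0" using 0 by simp
  ultimately have "M (lead_coeff (Mp a)) = 0" by (metis Mp_coeff coeff_0)
  hence "lead_coeff (Mp a) = 0" by (simp add: Mp_coeff)
  thus False using a by simp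
qed

lemma Mp_mult_monic_cancel:
  assumes s: "monic s" and eq: "Mp (a * s) = Mp (b * s)"
  shows "Mp a = Mp b"
proof -
  have "Mp ((a - b) * s) = Mp (a * s - b * s)" by (simp add: left_diff_distrib)
  also have "\<dots> = Mp (Mp (a * s) - Mp (b * s))" by simp
  finally have "Mp ((a - b) * s) = 0" using eq by simp
  from Mp_mult_monic_0[OF s this] have "Mp (Mp (a - b) + b) = Mp b" by simp
  thus ?thesis unfolding plus_Mp by simp
qed

lemma monic_Mp: "monic f \<Longrightarrow> monic (Mp f) \<and> degree (Mp f) = degree f"
  using degree_m_eq[of f] m1 by (auto simp: Mp_coeff M_def)

lemma dvdm_antisym:
  assumes f: "Mp f = f" "monic f" and g: "Mp g = g" "monic g" and fg: "f dvdm g" "g dvdm f"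
  shows "f = g"
proof -
  have le: "degree f \<le> degree g" if fg: "f dvdm g" and f: "monic f" and g: "Mp g = g" "monic g" for f g
  proof -
    obtain h where h: "Mp g = Mp (f * h)" "Mp h = h" using fg by (rule dvdmE)
    have h0: "h \<noteq> 0" using h(1) g by auto
    have "coeff (f * h) (degree f + degree h) = lead_coeff h" using f by (simp add: coeff_mult_degree_sum)
    moreover have "M (lead_coeff h) \<noteq> 0" using h(2) h0 by (metis Mp_coeff leading_coeff_0_iff)
    ultimately have "coeff g (degree f + degree h) \<noteq> 0" using h(1) g(1) by (metis Mp_coeff)
    thus ?thesis by (meson le_degree le_trans le_add1)
  qed
  have d: "degree f = degree g" using le[OF fg(1) f(2) g] le[OF fg(2) g(2) f] by simp
  obtain h where h: "Mp g = Mp (f * h)" "Mp h = h" using fg(1) by (rule dvdmE)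
  have h0: "h \<noteq> 0" using h(1) g by auto
  have "coeff (f * h) (degree f + degree h) = lead_coeff h" using f by (simp add: coeff_mult_degree_sum)
  moreover have "M (lead_coeff h) \<noteq> 0" using h(2) h0 by (metis Mp_coeff leading_coeff_0_iff)
  ultimately have c: "coeff g (degree f + degree h) = M (lead_coeff h)" "M (lead_coeff h) \<noteq> 0"
    using h(1) g(1) by (metis Mp_coeff)+
  hence "degree f + degree h \<le> degree g" by (metis le_degree)
  hence dh: "degree h = 0" using d by simp
  hence "M (lead_coeff h) = 1" using c d g(2) by simp
  hence "lead_coeff h = 1" using h(2) by (metis Mp_coeff)
  then have "h = 1" using dh by (metis degree_eq_zeroE lead_coeff_pCons(2) pCons_one)
  thus ?thesis using h(1) f g by simp
qed

end

section \<open>Greatest common divisors and factorization modulo a prime\<close>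

context poly_mod_prime
begin

text \<open>The leading coefficient of the reduction is a unit mod p, by Bezout for integers. The
  arguments by minimal degree rely on this normalisation.\<close>

lemma monic_multiple_exists:
  assumes "Mp r \<noteq> 0"
  obtains c where "monic (Mp (Polynomial.smult c r))" "degree (Mp (Polynomial.smult c r)) = degree (Mp r)"
proof -
  define k where "k = degree (Mp r)"
  have "coeff (Mp r) k \<noteq> 0" unfolding k_def using assms by simp
  hence "\<not> p dvd coeff r k" by (simp add: Mp_coeff M_def dvd_eq_mod_eq_0)
  hence "comm_monoid_mult_class.coprime (coeff r k) p"
    using prime_imp_coprime[OF prime, of "coeff r k"] by (simp add: ac_simps)
  hence "gcd (coeff r k) p = 1" by simp
  then obtain c v where "c * coeff r k + v * p = 1" using bezout_int[of "coeff r k" p] by auto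
  hence *: "c * coeff r k = 1 + (- v) * p" by simp
  hence c: "c * coeff r k mod p = 1" using m1 by (simp only: mod_mult_self1) simp
  have lc: "coeff (Mp (Polynomial.smult c r)) k = 1" using c by (simp add: Mp_coeff M_def)
  moreover have "degree (Mp (Polynomial.smult c r)) \<le> k" unfolding k_def by (rule degree_m_smult_le)
  ultimately have "degree (Mp (Polynomial.smult c r)) = k"
    by (metis le_degree le_antisym zero_neq_one)
  thus ?thesis using that[of c] lc unfolding k_def by simp
qed

text \<open>As in a principal ideal ring: h is a monic element of least degree in the ideal
  generated by f and g mod p, so division by h leaves remainder 0.\<close>

lemma gcd_bezout_exists:
  assumes f: "monic f"
  obtains h a b where "Mp h = h" "monic h" "h dvdm f" "h dvdm g" "Mp h = Mp (a * f + b * g)"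
proof -
  define G where "G d \<longleftrightarrow> (\<exists>h a b. Mp h = h \<and> monic h \<and> degree h = d \<and> Mp h = Mp (a * f + b * g))" for d
  have G0: "G (degree (Mp f))" unfolding G_def
  proof (intro exI conjI)
    show "Mp (Mp f) = Mp (1 * f + 0 * g)" by simp
    show "monic (Mp f)" using monic_Mp[OF f] by blast
  qed simp_all
  define d where "d = (LEAST d. G d)"
  have "G d" unfolding d_def by (rule LeastI[of G, OF G0])
  then obtain h a b where h: "Mp h = h" "monic h" "degree h = d" "Mp h = Mp (a * f + b * g)" unfolding G_def by blast
  have dvd: "h dvdm k" if k: "k = x * f + y * g" for k x y
  proof -
    \<comment> \<open>As \<open>h\<close> is monic, pseudo-division is ordinary division with
      remainder.\<close>
    obtain q r where qr: "pseudo_divmod k h = (q, r)" by force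
    have h0: "h \<noteq> 0" using h(2) by auto
    have kq: "k = h * q + r" and r: "r = 0 \<or> degree r < d" using pseudo_divmod[OF h0 qr] h by auto
    have "Mp r = 0"
    proof (rule ccontr)
      assume r0: "Mp r \<noteq> 0"
      then obtain c where c: "monic (Mp (Polynomial.smult c r))" "degree (Mp (Polynomial.smult c r)) = degree (Mp r)"
        using monic_multiple_exists by blast
      obtain s where s: "h = a * f + b * g + Polynomial.smult p s" using h(4) by (rule Mp_eqE)
      have "Polynomial.smult c r = [:c:] * (k - h * q)" unfolding kq by simp
      also have "\<dots> = ([:c:] * (x - a * q)) * f + ([:c:] * (y - b * q)) * g + Polynomial.smult p (- ([:c:] * s * q))"
        unfolding k s by (simp add: algebra_simps smult_add_right smult_diff_right)
      finally have "Mp (Polynomial.smult c r) = Mp (([:c:] * (x - a * q)) * f + ([:c:] * (y - b * q)) * g)"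
        by (simp only: Mp_add_smult)
      hence "G (degree (Mp r))" unfolding G_def using c
        by (intro exI[of _ "Mp (Polynomial.smult c r)"] exI[of _ "[:c:] * (x - a * q)"] exI[of _ "[:c:] * (y - b * q)"]) simp
      moreover have "degree (Mp r) < d" using r r0 degree_m_le[of r] by auto
      ultimately show False unfolding d_def using not_less_Least by blast
    qed
    hence "Mp (h * q + r) = Mp (h * q)" by (metis add.right_neutral plus_Mp(2))
    thus ?thesis unfolding kq dvdm_def by blast
  qed
  show ?thesis by (rule that[OF h(1,2) dvd[of f 1 0] dvd[of g 0 1] h(4)]) auto
qed

text \<open>Euclid's lemma: the gcd h of q and a is a unit or an associate of q, and in the first
  case the Bezout relation is multiplied by b.\<close>

lemma irreducible_m_dvdm_mult:
  assumes q: "irreducible_m q" "monic q" and dvd: "q dvdm a * b"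
  shows "q dvdm a \<or> q dvdm b"
proof -
  obtain h x y where h: "h dvdm q" "h dvdm a" "Mp h = Mp (x * q + y * a)"
    using gcd_bezout_exists[OF q(2), of a] by metis
  obtain c where c: "Mp q = Mp (h * c)" using h(1) unfolding dvdm_def by blast
  hence "h dvdm 1 \<or> c dvdm 1" using q(1) unfolding irreducible_m_def by blast
  thus ?thesis
  proof
    assume "c dvdm 1"
    then obtain c' where c': "Mp 1 = Mp (c * c')" unfolding dvdm_def by blast
    have "Mp (q * c') = Mp (Mp q * c')" by simp
    also have "\<dots> = Mp (h * Mp (c * c'))" unfolding c by (simp add: mult.assoc)
    also have "\<dots> = Mp h" unfolding c'[symmetric] by simp
    finally have "q dvdm h" unfolding dvdm_def by metis
    thus ?thesis using h(2) dvdm_trans by blast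
  next
    assume "h dvdm 1"
    then obtain h' where h': "Mp 1 = Mp (h * h')" unfolding dvdm_def by blast
    have "q dvdm (x * q + y * a) * (h' * b)"
    proof -
      have "q dvdm x * h' * b * q" by (rule dvdm_mult_left[OF dvdm_refl])
      moreover have "q dvdm y * h' * (a * b)" by (rule dvdm_mult_left[OF dvd])
      ultimately have "q dvdm x * h' * b * q + y * h' * (a * b)" by (rule dvdm_add)
      thus ?thesis by (simp add: algebra_simps)
    qed
    moreover have "Mp ((x * q + y * a) * (h' * b)) = Mp b"
    proof -
      have "Mp ((x * q + y * a) * (h' * b)) = Mp (Mp (x * q + y * a) * (h' * b))" by simp
      also have "\<dots> = Mp (Mp (h * h') * b)" unfolding h(3)[symmetric] by (simp add: mult.assoc)
      also have "\<dots> = Mp b" unfolding h'[symmetric] by simp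
      finally show ?thesis .
    qed
    ultimately have "q dvdm b" using dvdm_cong by blast
    thus ?thesis ..
  qed
qed

lemma irreducible_m_dvdm_prod:
  assumes q: "irreducible_m q" "monic q" and dvd: "q dvdm (\<Prod>x\<in>S. x)" and S: "finite S"
  shows "\<exists>x\<in>S. q dvdm x"
  using S dvd
proof (induction S)
  case empty
  thus ?case using q(1) unfolding irreducible_m_def by simp
next
  case (insert x F)
  thus ?case using irreducible_m_dvdm_mult[OF q, of x "\<Prod>x\<in>F. x"] by auto
qed

lemma irreducible_m_dvdm_irreducible_m:
  assumes q: "irreducible_m q" "monic q" "Mp q = q" and x: "irreducible_m x" "monic x" "Mp x = x" and dvd: "q dvdm x"
  shows "q = x"
proof -
  obtain b where b: "Mp x = Mp (q * b)" using dvd unfolding dvdm_def by blast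
  hence "q dvdm 1 \<or> b dvdm 1" using x(1) unfolding irreducible_m_def by blast
  hence "b dvdm 1" using q(1) unfolding irreducible_m_def by blast
  then obtain c where c: "Mp 1 = Mp (b * c)" unfolding dvdm_def by blast
  have "Mp (x * c) = Mp (Mp x * c)" by simp
  also have "\<dots> = Mp (q * Mp (b * c))" unfolding b by (simp add: mult.assoc)
  also have "\<dots> = Mp q" unfolding c[symmetric] by simp
  finally have "x dvdm q" unfolding dvdm_def by metis
  thus ?thesis using dvdm_antisym q x dvd by blast
qed

text \<open>Distinct monic irreducible polynomials do not divide one another, so by Euclid's lemma a
  new factor must divide the cofactor left by the previous ones.\<close>

lemma prod_irreducible_m_dvdm:
  assumes S: "\<And>q. q \<in> S \<Longrightarrow> Mp q = q \<and> monic q \<and> irreducible_m q \<and> q dvdm u"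
  shows "(\<Prod>q\<in>S. q) dvdm u"
proof (cases "finite S")
  \<comment> \<open>A product over an infinite set has the value 1, which divides
    everything.\<close>
  case False
  thus ?thesis unfolding dvdm_def by (intro exI[of _ u]) simp
next
  case True
  thus ?thesis using S
  proof (induction S)
    case empty
    thus ?case unfolding dvdm_def by (intro exI[of _ u]) simp
  next
    case (insert q F)
    then obtain a where a: "Mp u = Mp ((\<Prod>x\<in>F. x) * a)" unfolding dvdm_def by auto
    have q: "Mp q = q" "monic q" "irreducible_m q" "q dvdm u" using insert.prems by auto
    have "q dvdm (\<Prod>x\<in>F. x) * a" using q(4) dvdm_cong[OF a] by simp
    moreover have "\<not> q dvdm (\<Prod>x\<in>F. x)"
    proof
      assume "q dvdm (\<Prod>x\<in>F. x)"
      then obtain x where "x \<in> F" "q dvdm x" using irreducible_m_dvdm_prod q insert.hyps by blast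
      thus False using irreducible_m_dvdm_irreducible_m[of q x] q insert by auto
    qed
    ultimately have "q dvdm a" using irreducible_m_dvdm_mult q by blast
    then obtain b where b: "Mp a = Mp (q * b)" unfolding dvdm_def by blast
    have "Mp u = Mp ((\<Prod>x\<in>F. x) * Mp a)" using a by simp
    also have "\<dots> = Mp ((q * (\<Prod>x\<in>F. x)) * b)" unfolding b by (simp add: ac_simps)
    finally show ?case using insert.hyps unfolding dvdm_def by auto
  qed
qed

text \<open>Justifies the definite description: existence by Bezout, uniqueness by
  \<open>dvdm_antisym\<close>.\<close>

lemma gcd_mod:
  assumes f: "monic f"
  shows "Mp (gcd_mod p f g) = gcd_mod p f g \<and> monic (gcd_mod p f g) \<and> gcd_mod p f g dvdm f \<and> gcd_mod p f g dvdm g"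
proof -
  obtain h a b where h: "Mp h = h" "monic h" "h dvdm f" "h dvdm g" "Mp h = Mp (a * f + b * g)"
    using gcd_bezout_exists[OF f] .
  have max: "k dvdm h" if "k dvdm f" "k dvdm g" for k
  proof -
    have "k dvdm a * f + b * g" using that by (intro dvdm_add dvdm_mult_left)
    thus ?thesis using dvdm_cong[OF h(5)] by simp
  qed
  have "gcd_mod p f g = h" unfolding gcd_mod_def
  proof (rule the_equality)
    show "Mp h = h \<and> monic h \<and> h dvdm f \<and> h dvdm g \<and> (\<forall>k. k dvdm f \<longrightarrow> k dvdm g \<longrightarrow> k dvdm h)"
      using h max by blast
    fix h' assume "Mp h' = h' \<and> monic h' \<and> h' dvdm f \<and> h' dvdm g \<and> (\<forall>k. k dvdm f \<longrightarrow> k dvdm g \<longrightarrow> k dvdm h')"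
    thus "h' = h" using dvdm_antisym h max by blast
  qed
  thus ?thesis using h by simp
qed

lemma sfp_mod_dvdm:
  assumes "\<And>q. irreducible_m q \<Longrightarrow> monic q \<Longrightarrow> q dvdm f \<Longrightarrow> q dvdm u"
  shows "sfp_mod p f dvdm u"
  unfolding sfp_mod_def Mp_dvdm by (rule prod_irreducible_m_dvdm) (use assms in blast)

lemma monic_sfp_mod: "monic (sfp_mod p f)"
  unfolding sfp_mod_def by (rule monic_Mp[THEN conjunct1], rule monic_prod) auto

lemma quotient_mod:
  assumes s: "monic s" and dvd: "s dvdm f"
  shows "Mp (quotient_mod p f s) = quotient_mod p f s \<and> Mp (quotient_mod p f s * s) = Mp f"
proof -
  obtain h where h: "Mp f = Mp (s * h)" "Mp h = h" using dvd by (rule dvdmE)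
  show ?thesis unfolding quotient_mod_def
  proof (rule theI[of _ h])
    show "Mp h = h \<and> Mp (h * s) = Mp f" using h by (simp add: mult.commute)
    fix q assume "Mp q = q \<and> Mp (q * s) = Mp f"
    thus "q = h" using Mp_mult_monic_cancel[OF s, of q h] h by (simp add: mult.commute)
  qed
qed

end

section \<open>Isotropic invariant subspaces and the discriminant\<close>

lemma det_replace_col_smult:
  assumes A: "A \<in> carrier_mat n n" and z: "z \<in> carrier_vec n" and k: "k < n"
  shows "det (replace_col A (c \<cdot>\<^sub>v z) k) = c * det (replace_col A z k)"
proof -
  have *: "replace_col A y k \<in> carrier_mat n n" for y using A by (auto simp: replace_col_def)
  have "mat_delete (replace_col A y k) i k = mat_delete A i k" if "i < n" for i y
    using A that k by (intro eq_matI) (auto simp: replace_col_def mat_delete_def)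
  hence "det (replace_col A y k) = (\<Sum>i<n. y $ i * ((-1)^(i+k) * det (mat_delete A i k)))" for y
    unfolding laplace_expansion_column[OF * k, of y] using A k
    by (intro sum.cong) (auto simp: replace_col_def cofactor_def)
  thus ?thesis using z by (simp add: sum_distrib_left ac_simps)
qed

text \<open>Cramer's rule, twice. From M u = p z follows u_k det M = p det M2, where M2 is M with
  column k replaced by z. Again M2^T u = 0 mod p: outside position k by the symmetry of M, at k
  because p divides u . z by isotropy. Cramer's rule for M2^T gives the second factor p, and u_k is
  a unit mod p.\<close>

lemma square_dvd_det_of_isotropic_kernel_vector:
  fixes M :: "int mat"
  assumes M: "M \<in> carrier_mat n n" and sym: "M\<^sup>T = M" and p: "prime p"
    and u: "u \<in> carrier_vec n" and k: "k < n" "\<not> p dvd u $ k"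
    and Mu: "\<And>i. i < n \<Longrightarrow> p dvd (M *\<^sub>v u) $ i" and uMu: "p\<^sup>2 dvd u \<bullet> (M *\<^sub>v u)"
  shows "p\<^sup>2 dvd det M"
proof -
  have p0: "p \<noteq> 0" using p by auto
  define z where "z = vec n (\<lambda>i. (M *\<^sub>v u) $ i div p)"
  have z: "z \<in> carrier_vec n" unfolding z_def by simp
  have Mz: "M *\<^sub>v u = p \<cdot>\<^sub>v z" using Mu M by (intro eq_vecI) (auto simp: z_def)
  have "p * p dvd p * (u \<bullet> z)" using uMu u z unfolding Mz by (simp add: power2_eq_square)
  hence uz: "p dvd u \<bullet> z" using p0 by simp
  define M2 where "M2 = replace_col M z k"
  have M2: "M2 \<in> carrier_mat n n" using M by (auto simp: M2_def replace_col_def)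
  have 1: "u $ k * det M = p * det M2"
    using cramer_lemma_mat[OF M u k(1)] det_replace_col_smult[OF M z k(1), of p] by (simp add: Mz M2_def)
  have e: "M $$ (a, b) = M $$ (b, a)" if "a < n" "b < n" for a b
    by (rule symmetric_mat_index[OF M sym that])
  let ?T = "M2\<^sup>T"
  have T: "?T \<in> carrier_mat n n" using M2 by simp
  have Tu: "p dvd (?T *\<^sub>v u) $ j" if j: "j < n" for j
  proof (cases "j = k")
    case True
    have "(?T *\<^sub>v u) $ j = u \<bullet> z" using True j M u z
      by (auto simp: M2_def replace_col_def scalar_prod_def mult.commute intro!: sum.cong)
    thus ?thesis using uz by simp
  next
    case False
    have "(?T *\<^sub>v u) $ j = (M *\<^sub>v u) $ j" using False j M u e
      by (auto simp: M2_def replace_col_def scalar_prod_def intro!: sum.cong)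
    thus ?thesis using Mu j by simp
  qed
  define y where "y = vec n (\<lambda>i. (?T *\<^sub>v u) $ i div p)"
  have y: "y \<in> carrier_vec n" unfolding y_def by simp
  have "?T *\<^sub>v u = p \<cdot>\<^sub>v y" using Tu M2 by (intro eq_vecI) (auto simp: y_def)
  hence "u $ k * det M2 = p * det (replace_col ?T y k)"
    using cramer_lemma_mat[OF T u k(1)] det_replace_col_smult[OF T y k(1), of p] det_transpose[OF M2] by simp
  hence "u $ k * (u $ k * det M) = p\<^sup>2 * det (replace_col ?T y k)"
    unfolding 1 by (simp add: power2_eq_square algebra_simps)
  hence "p\<^sup>2 dvd u $ k * (u $ k * det M)" by simp
  moreover have "coprime (p\<^sup>2) (u $ k)" using p k(2) by (simp add: prime_imp_coprime)
  ultimately show ?thesis by (simp add: coprime_dvd_mult_right_iff)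
qed

text \<open>The vector \<open>w(x)\<close> below is the divided difference \<open>(f(x) - f(A)) / (x - A)\<close> applied to \<open>u\<close>.\<close>

lemma divided_difference_exists:
  fixes A :: "int mat"
  assumes A: "A \<in> carrier_mat n n" and B: "B \<in> carrier_mat n n" and N: "N \<in> carrier_mat n n"
    and AN: "A * N = N * B" and y: "y \<in> carrier_vec n"
  defines "u \<equiv> N *\<^sub>v y"
  shows "\<exists>w\<in>carrier_vec n.
    char_poly_matrix A *\<^sub>v w = f \<cdot>\<^sub>v const_vec u - const_vec (mat_poly A f *\<^sub>v u) \<and>
    (\<forall>k. \<exists>c\<in>carrier_vec n. \<forall>i<n. coeff (w $ i) k = (N *\<^sub>v c) $ i) \<and>
    (\<forall>i<n. \<forall>k\<ge>degree f. coeff (w $ i) k = 0) \<and>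
    (\<forall>i<n. degree f > 0 \<longrightarrow> coeff (w $ i) (degree f - 1) = lead_coeff f * u $ i)"
proof (induction f)
  case 0
  show ?case using A N y
    by (intro bexI[of _ "0\<^sub>v n"]) (auto simp: u_def intro!: eq_vecI bexI[of _ "0\<^sub>v n"])
next
  case (pCons a f)
  have u: "u \<in> carrier_vec n" unfolding u_def using N y by simp
  let ?c = "const_vec"
  obtain w where w: "w \<in> carrier_vec n"
    and Xw: "char_poly_matrix A *\<^sub>v w = f \<cdot>\<^sub>v ?c u - ?c (mat_poly A f *\<^sub>v u)"
    and Nw: "\<And>k. \<exists>c\<in>carrier_vec n. \<forall>i<n. coeff (w $ i) k = (N *\<^sub>v c) $ i"
    and w0: "\<And>i k. i < n \<Longrightarrow> k \<ge> degree f \<Longrightarrow> coeff (w $ i) k = 0"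
    and w1: "\<And>i. i < n \<Longrightarrow> degree f > 0 \<Longrightarrow> coeff (w $ i) (degree f - 1) = lead_coeff f * u $ i"
    using pCons.IH by blast
  define fu where "fu = mat_poly A f *\<^sub>v u"
  have fu: "fu \<in> carrier_vec n" unfolding fu_def using mat_poly_carrier[OF A, of f] by (metis mult_mat_vec_carrier u)
  have fuN: "fu = N *\<^sub>v (mat_poly B f *\<^sub>v y)"
    unfolding fu_def u_def by (rule mat_poly_intertwine_vec[OF A B N AN y])
  \<comment> \<open>If w belongs to f, then f(A) u + x w belongs to a + x f, since (x - A) (f(A) u +
    x w) = x f u - A f(A) u.\<close>
  define w' where "w' = vec n (\<lambda>i. pCons (fu $ i) (w $ i))"
  have w': "w' \<in> carrier_vec n" unfolding w'_def by simp
  have pfu: "mat_poly A (pCons a f) *\<^sub>v u = a \<cdot>\<^sub>v u + A *\<^sub>v fu"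
  proof -
    have "mat_poly A (pCons a f) *\<^sub>v u = (a \<cdot>\<^sub>m 1\<^sub>m n) *\<^sub>v u + (A * mat_poly A f) *\<^sub>v u"
      unfolding mat_poly_pCons[OF A] by (rule add_mult_distrib_mat_vec) (use A u in auto)
    thus ?thesis unfolding fu_def using assoc_mult_mat_vec[OF A mat_poly_carrier[OF A] u, of f]
      smult_one_mat_mult_vec[OF u, of a] by simp
  qed
  have 1: "char_poly_matrix A *\<^sub>v w' = pCons a f \<cdot>\<^sub>v ?c u - ?c (mat_poly A (pCons a f) *\<^sub>v u)"
  proof (rule eq_vecI)
    fix i assume "i < dim_vec (pCons a f \<cdot>\<^sub>v ?c u - ?c (mat_poly A (pCons a f) *\<^sub>v u))"
    hence i: "i < n" using A by simp
    have "(\<Sum>j\<in>{0..<n}. Polynomial.smult (A $$ (i, j)) (w' $ j)) =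
      (\<Sum>j\<in>{0..<n}. [:A $$ (i, j) * fu $ j:] + [:0, 1:] * Polynomial.smult (A $$ (i, j)) (w $ j))"
      by (rule sum.cong) (auto simp: w'_def)
    also have "\<dots> = [:(A *\<^sub>v fu) $ i:] + [:0, 1:] * (\<Sum>j\<in>{0..<n}. Polynomial.smult (A $$ (i, j)) (w $ j))"
      unfolding sum.distrib sum_distrib_left[symmetric] using A fu i
      by (simp add: scalar_prod_def sum_to_poly)
    finally have "(char_poly_matrix A *\<^sub>v w') $ i = [:0, 1:] * [:fu $ i:] - [:(A *\<^sub>v fu) $ i:] +
       [:0, 1:] * ([:0, 1:] * w $ i - (\<Sum>j\<in>{0..<n}. Polynomial.smult (A $$ (i, j)) (w $ j)))"
      unfolding char_poly_matrix_mult_vec[OF A w' i] using i by (simp add: w'_def)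
    also have "[:0, 1:] * w $ i - (\<Sum>j\<in>{0..<n}. Polynomial.smult (A $$ (i, j)) (w $ j)) = Polynomial.smult (u $ i) f - [:fu $ i:]"
      unfolding char_poly_matrix_mult_vec[OF A w i, symmetric] Xw fu_def[symmetric] using i u fu by simp
    finally show "(char_poly_matrix A *\<^sub>v w') $ i = (pCons a f \<cdot>\<^sub>v ?c u - ?c (mat_poly A (pCons a f) *\<^sub>v u)) $ i"
      unfolding pfu using i u A fu by (simp add: mult.commute)
  qed (use A in auto)
  have 2: "\<exists>c\<in>carrier_vec n. \<forall>i<n. coeff (w' $ i) k = (N *\<^sub>v c) $ i" for k
  proof (cases k)
    case 0
    show ?thesis unfolding 0 using fuN mat_poly_carrier[OF B, of f] y
      by (intro bexI[of _ "mat_poly B f *\<^sub>v y"]) (auto simp: w'_def)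
  next
    case (Suc m)
    show ?thesis using Nw[of m] unfolding Suc by (auto simp: w'_def)
  qed
  have 3: "coeff (w' $ i) k = 0" if "i < n" "k \<ge> degree (pCons a f)" for i k
  proof (cases "f = 0")
    case True
    hence "w $ i = 0" using w0[OF that(1)] by (auto intro: poly_eqI)
    moreover have "fu $ i = 0" unfolding fu_def True using that A u by (simp add: scalar_prod_def)
    ultimately show ?thesis using that by (simp add: w'_def)
  next
    case False
    thus ?thesis using that w0[OF that(1)] by (cases k) (auto simp: w'_def)
  qed
  have 4: "coeff (w' $ i) (degree (pCons a f) - 1) = lead_coeff (pCons a f) * u $ i"
    if "i < n" "degree (pCons a f) > 0" for i
  proof (cases "degree f = 0")
    case False
    then obtain m where "degree f = Suc m" by (cases "degree f") auto
    thus ?thesis using that w1[OF that(1)] by (auto simp: w'_def)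
  next
    case True
    then obtain b where b: "f = [:b:]" by (meson degree_eq_zeroE)
    have "f \<noteq> 0" using that by auto
    moreover have "fu = b \<cdot>\<^sub>v u"
    proof -
      have "mat_poly A [:b:] = b \<cdot>\<^sub>m 1\<^sub>m n" using A by (auto simp: mat_poly_pCons[OF A] intro!: eq_matI)
      thus ?thesis unfolding fu_def b using smult_one_mat_mult_vec[OF u] by simp
    qed
    ultimately show ?thesis using that u by (simp add: w'_def b)
  qed
  show ?case
    by (rule bexI[of _ w']) (use 1 2 3 4 w' in auto)
qed

text \<open>The polynomials killing u form an ideal of Z[x] that contains p. It stands in for the
  annihilator of u in F_p[x], and the lemmas below are its closure properties.\<close>

definition kills :: "int \<Rightarrow> int mat \<Rightarrow> int poly \<Rightarrow> int vec \<Rightarrow> bool" where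
  "kills p A f u \<longleftrightarrow> (\<forall>i < dim_row A. p dvd (mat_poly A f *\<^sub>v u) $ i)"

lemma mat_poly_mult_vec:
  assumes A: "A \<in> carrier_mat n n" and u: "u \<in> carrier_vec n"
  shows "mat_poly A (f * g) *\<^sub>v u = mat_poly A f *\<^sub>v (mat_poly A g *\<^sub>v u)"
  unfolding mat_poly_mult[OF A] by (rule assoc_mult_mat_vec[OF mat_poly_carrier[OF A] mat_poly_carrier[OF A] u])

context
  fixes A :: "int mat" and n :: nat and p :: int
  assumes A: "A \<in> carrier_mat n n"
begin

lemma kills_0: "kills p A 0 u" if "u \<in> carrier_vec n"
  using A that unfolding kills_def by (auto simp: scalar_prod_def)

lemma kills_add:
  assumes u: "u \<in> carrier_vec n" and "kills p A f u" "kills p A g u"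
  shows "kills p A (f + g) u"
proof -
  have "mat_poly A (f + g) *\<^sub>v u = mat_poly A f *\<^sub>v u + mat_poly A g *\<^sub>v u"
    unfolding mat_poly_add[OF A]
    by (rule add_mult_distrib_mat_vec[OF mat_poly_carrier[OF A] mat_poly_carrier[OF A] u])
  thus ?thesis using assms A unfolding kills_def by auto
qed

lemma kills_sum:
  assumes u: "u \<in> carrier_vec n" and "\<And>x. x \<in> S \<Longrightarrow> kills p A (f x) u"
  shows "kills p A (\<Sum>x\<in>S. f x) u"
  using assms(2)
  by (induction S rule: infinite_finite_induct) (auto intro: kills_0[OF u] kills_add[OF u])

lemma kills_mult_vec:
  assumes u: "u \<in> carrier_vec n" and "kills p A (f * g) u"
  shows "kills p A f (mat_poly A g *\<^sub>v u)"
  using assms unfolding kills_def mat_poly_mult_vec[OF A u] by simp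

lemma kills_mult_left:
  assumes u: "u \<in> carrier_vec n" and "kills p A g u"
  shows "kills p A (f * g) u"
  unfolding kills_def
proof (intro allI impI)
  fix i assume "i < dim_row A"
  hence i: "i < n" using A by simp
  show "p dvd (mat_poly A (f * g) *\<^sub>v u) $ i"
    unfolding mat_poly_mult_vec[OF A u]
    by (rule dvd_mult_mat_vec[OF mat_poly_carrier[OF A] _ _ i])
       (use assms A mat_poly_carrier[OF A, of g] in \<open>auto simp: kills_def simp del: index_mult_mat_vec
         intro!: mult_mat_vec_carrier\<close>)
qed

lemma kills_uminus: "u \<in> carrier_vec n \<Longrightarrow> kills p A f u \<Longrightarrow> kills p A (- f) u"
  using kills_mult_left[of u f "- 1"] by simp

lemma kills_diff: "u \<in> carrier_vec n \<Longrightarrow> kills p A f u \<Longrightarrow> kills p A g u \<Longrightarrow> kills p A (f - g) u"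
  using kills_add[of u f "- g"] kills_uminus[of u g] by simp

lemma kills_smult_p:
  assumes u: "u \<in> carrier_vec n"
  shows "kills p A (Polynomial.smult p f) u"
  unfolding kills_def mat_poly_smult[OF A] using A u
  by (auto simp: scalar_prod_def intro!: dvd_sum)

lemma kills_coeff_dvd:
  assumes u: "u \<in> carrier_vec n" and "\<And>k. p dvd coeff f k"
  shows "kills p A f u"
proof -
  have "f = Polynomial.smult p (map_poly (\<lambda>a. a div p) f)"
    using assms(2) by (intro poly_eqI) (simp add: coeff_map_poly)
  thus ?thesis using kills_smult_p[OF u] by metis
qed

end

text \<open>Among all vectors \<open>u = N y\<close> that are nonzero mod \<open>p\<close>, choose one that is annihilated mod \<open>p\<close> by a
  monic polynomial of minimal degree. Then \<open>I = {g. g(A) u = 0 mod p}\<close> is a prime ideal, and the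
  divided difference \<open>w\<close> is an eigenvector of \<open>A\<close> over \<open>\<int>[x]/I\<close>, which satisfies \<open>w\<^sup>T w = 0\<close> because
  \<open>N\<^sup>T N = 0\<close> mod \<open>p\<close>. As \<open>adj(x - A)\<close> is proportional to \<open>w w\<^sup>T\<close> over \<open>\<int>[x]/I\<close>, its trace, the
  derivative of \<open>\<chi>\<close>, lies in \<open>I\<close>.\<close>

lemma square_dvd_det_pderiv_char_poly:
  fixes A :: "int mat"
  assumes A: "A \<in> carrier_mat n n" and sym: "A\<^sup>T = A"
    and B: "B \<in> carrier_mat n n" and N: "N \<in> carrier_mat n n" and AN: "A * N = N * B"
    and NN: "N\<^sup>T * N = (l * l) \<cdot>\<^sub>m 1\<^sub>m n"
    and p: "prime p" and pl: "p dvd l"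
    and ij0: "i0 < n" "j0 < n" "\<not> p dvd N $$ (i0, j0)"
  shows "p\<^sup>2 dvd det (mat_poly A (pderiv (char_poly A)))"
proof -
  let ?\<chi> = "char_poly A" and ?X = "char_poly_matrix A"
  interpret poly_mod_prime p using p by unfold_locales
  note CA = mat_poly_carrier[OF A]
  define nz where "nz u \<longleftrightarrow> (\<exists>i<n. \<not> p dvd u $ i)" for u :: "int vec"
  have Nin: "(N *\<^sub>v y) \<bullet> (N *\<^sub>v y') = l * l * (y \<bullet> y')" if y: "y \<in> carrier_vec n" "y' \<in> carrier_vec n" for y y'
  proof -
    have "(N *\<^sub>v y) \<bullet> (N *\<^sub>v y') = (N\<^sup>T *\<^sub>v (N *\<^sub>v y')) \<bullet> y"
      using transpose_vec_mult_scalar[OF N y(1), of "N *\<^sub>v y'"] N y comm_scalar_prod[of "N *\<^sub>v y" n "N *\<^sub>v y'"] by simp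
    also have "N\<^sup>T *\<^sub>v (N *\<^sub>v y') = (N\<^sup>T * N) *\<^sub>v y'"
      by (rule assoc_mult_mat_vec[symmetric]) (use N y in auto)
    also have "\<dots> = (l * l) \<cdot>\<^sub>v y'" unfolding NN by (rule smult_one_mat_mult_vec[OF y(2)])
    finally show ?thesis using y comm_scalar_prod[of y n y'] by simp
  qed
  \<comment> \<open>All vectors N y compete, not a single fixed one: g(A) N y has this form again,
    and the primality of the ideal rests on minimality for that vector too.\<close>
  define G where "G d \<longleftrightarrow> (\<exists>f. \<exists>y\<in>carrier_vec n. monic f \<and> degree f = d \<and> nz (N *\<^sub>v y) \<and> kills p A f (N *\<^sub>v y))" for d
  have "G n"
  proof -
    have "N *\<^sub>v unit_vec n j0 = col N j0" using N ij0 by (intro eq_vecI) auto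
    hence "nz (N *\<^sub>v unit_vec n j0)" unfolding nz_def using N ij0 by auto
    moreover have "kills p A ?\<chi> (N *\<^sub>v unit_vec n j0)"
      unfolding kills_def cayley_hamilton_mat[OF A] using N A by (auto simp: scalar_prod_def)
    ultimately show ?thesis unfolding G_def using degree_monic_char_poly[OF A]
      by (metis unit_vec_carrier)
  qed
  define d where "d = (LEAST d. G d)"
  have Gd: "G d" unfolding d_def by (rule LeastI[of G, OF \<open>G n\<close>])
  have dmin: "\<not> G k" if "k < d" for k using that unfolding d_def by (rule not_less_Least)
  have min: "p dvd coeff g k" if g: "degree g < d" and y: "y \<in> carrier_vec n" "nz (N *\<^sub>v y)" and kg: "kills p A g (N *\<^sub>v y)" for g y k
  proof (rule ccontr)
    assume "\<not> p dvd coeff g k"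
    hence g0: "Mp g \<noteq> 0" by (metis M_def Mp_coeff coeff_0 dvd_eq_mod_eq_0)
    then obtain c where c: "monic (Mp (Polynomial.smult c g))"
      and dc: "degree (Mp (Polynomial.smult c g)) = degree (Mp g)"
      by (rule monic_multiple_exists)
    define h where "h = Mp (Polynomial.smult c g)"
    have Ny: "N *\<^sub>v y \<in> carrier_vec n" using N y by simp
    have "kills p A ([:c:] * g - h) (N *\<^sub>v y)"
      by (rule kills_coeff_dvd[OF A Ny]) (simp add: h_def Mp_coeff M_def dvd_minus_mod)
    from kills_diff[OF A Ny kills_mult_left[OF A Ny kg, of "[:c:]"] this]
    have "kills p A h (N *\<^sub>v y)" by simp
    hence "G (degree (Mp g))" unfolding G_def using c dc y
      unfolding h_def[symmetric] by (intro exI[of _ h] bexI[of _ y]) auto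
    moreover have "degree (Mp g) < d" using g degree_m_le[of g] by linarith
    ultimately show False using dmin by blast
  qed
  obtain \<phi> y where \<phi>: "monic \<phi>" "degree \<phi> = d" and y: "y \<in> carrier_vec n" "nz (N *\<^sub>v y)"
    and k\<phi>: "kills p A \<phi> (N *\<^sub>v y)" using Gd unfolding G_def by blast
  define u where "u = N *\<^sub>v y"
  have u: "u \<in> carrier_vec n" unfolding u_def using N y by simp
  have d0: "d > 0"
  proof (rule ccontr)
    assume "\<not> d > 0"
    hence "degree \<phi> = 0" using \<phi>(2) by simp
    then obtain a where "\<phi> = [:a:]" by (rule degree_eq_zeroE)
    hence "\<phi> = 1" using \<phi>(1) by simp
    hence "kills p A 1 u" using k\<phi> u_def by simp
    thus False using y(2) u A unfolding kills_def mat_poly_1[OF A] nz_def u_def by auto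
  qed
  \<comment> \<open>If g does not kill u, then g(A) u is another vector N y' that is nonzero mod p.
    It is killed by f and by \<phi>, hence by the remainder of f modulo \<phi>; by minimality this
    remainder is 0 mod p, so f kills u.\<close>
  have prime: "kills p A f u \<or> kills p A g u" if fg: "kills p A (f * g) u" for f g
  proof (rule disjCI)
    assume ng: "\<not> kills p A g u"
    define u' where "u' = mat_poly A g *\<^sub>v u"
    have u': "u' \<in> carrier_vec n" unfolding u'_def using CA[of g] u by (metis mult_mat_vec_carrier)
    have By: "mat_poly B g *\<^sub>v y \<in> carrier_vec n" using mat_poly_carrier[OF B, of g] y(1) by (metis mult_mat_vec_carrier)
    have u'N: "u' = N *\<^sub>v (mat_poly B g *\<^sub>v y)"
      unfolding u'_def u_def by (rule mat_poly_intertwine_vec[OF A B N AN y(1)])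
    have nz': "nz u'" using ng A unfolding kills_def nz_def u'_def by auto
    have "kills p A (g * \<phi>) u" using kills_mult_left[OF A u] k\<phi> u_def by simp
    hence k1: "kills p A \<phi> u'" unfolding u'_def by (intro kills_mult_vec[OF A u]) (simp add: mult.commute)
    have k2: "kills p A f u'" unfolding u'_def by (rule kills_mult_vec[OF A u fg])
    obtain q r where qr: "pseudo_divmod f \<phi> = (q, r)" by force
    have \<phi>0: "\<phi> \<noteq> 0" using d0 \<phi> by auto
    have f: "f = \<phi> * q + r" and r: "r = 0 \<or> degree r < d"
      using pseudo_divmod[OF \<phi>0 qr] \<phi> by auto
    have "kills p A (f - q * \<phi>) u'" by (intro kills_diff[OF A u'] k2 kills_mult_left[OF A u' k1])
    hence k3: "kills p A r u'" unfolding f by (simp add: mult.commute)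
    have "degree r < d" using r d0 by auto
    hence "p dvd coeff r k" for k using min[OF _ By] nz' k3 unfolding u'N by blast
    hence "kills p A r u" by (intro kills_coeff_dvd[OF A u])
    hence "kills p A (q * \<phi> + r) u" using k\<phi> u_def by (intro kills_add[OF A u] kills_mult_left[OF A u]) auto
    thus "kills p A f u" unfolding f by (simp add: mult.commute)
  qed
  let ?c = "const_vec"
  obtain w where w: "w \<in> carrier_vec n"
    and Xw: "?X *\<^sub>v w = \<phi> \<cdot>\<^sub>v ?c u - ?c (mat_poly A \<phi> *\<^sub>v u)"
    and Nw: "\<And>k. \<exists>c\<in>carrier_vec n. \<forall>i<n. coeff (w $ i) k = (N *\<^sub>v c) $ i"
    and w0: "\<And>i k. i < n \<Longrightarrow> k \<ge> d \<Longrightarrow> coeff (w $ i) k = 0"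
    and w1: "\<And>i. i < n \<Longrightarrow> coeff (w $ i) (d - 1) = u $ i"
    using divided_difference_exists[OF A B N AN y(1), of \<phi>] \<phi> d0 unfolding u_def[symmetric] by auto
  have k\<chi>: "kills p A ?\<chi> u"
    unfolding kills_def cayley_hamilton_mat[OF A] using u A by (auto simp: scalar_prod_def)
  define R where "R = adj_mat ?X"
  have R: "R \<in> carrier_mat n n" unfolding R_def using adj_mat(1)[of ?X n] A by simp
  have Rsym: "R $$ (i, j) = R $$ (j, i)" if "i < n" "j < n" for i j
    unfolding R_def
    by (rule adj_mat_symmetric[OF char_poly_matrix_closed[OF A] char_poly_matrix_symmetric[OF A sym] that])
  have kb: "kills p A ((?X *\<^sub>v w) $ i) u" if i: "i < n" for i
  proof -
    have "p dvd (mat_poly A \<phi> *\<^sub>v u) $ i" using k\<phi> A i unfolding kills_def u_def by auto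
    hence "kills p A [:(mat_poly A \<phi> *\<^sub>v u) $ i:] u"
      by (intro kills_coeff_dvd[OF A u]) (simp add: coeff_pCons split: nat.split)
    moreover have "kills p A ([:u $ i:] * \<phi>) u" using kills_mult_left[OF A u] k\<phi> u_def by blast
    ultimately have "kills p A ([:u $ i:] * \<phi> - [:(mat_poly A \<phi> *\<^sub>v u) $ i:]) u" by (rule kills_diff[OF A u, rotated])
    thus ?thesis unfolding Xw using i u A by (simp add: mult.commute)
  qed
  \<comment> \<open>The rank-one update is by e_j e_k^T. As chi and the entries of (x - A) w lie in
    the ideal, R(k,j) w_i = w_k R(i,j) remains modulo it.\<close>
  have E: "kills p A (R $$ (k, j) * w $ i - w $ k * R $$ (i, j)) u" if ijk: "i < n" "j < n" "k < n" for i j k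
  proof -
    have un: "?c (unit_vec n m) = unit_vec n m" for m by (intro eq_vecI) (auto simp: unit_vec_def)
    have Ru: "R *\<^sub>v unit_vec n j = col R j" using R ijk by (intro eq_vecI) auto
    define R2 where "R2 = adj_mat (char_poly_matrix (A + outer (unit_vec n j) (unit_vec n k)))"
    have R2: "R2 \<in> carrier_mat n n" unfolding R2_def
      by (rule adj_mat(1), rule char_poly_matrix_closed, rule add_carrier_mat, rule outer_carrier) auto
    have "R $$ (k, j) * w $ i - w $ k * R $$ (i, j) = ?\<chi> * w $ i - (R2 *\<^sub>v (?X *\<^sub>v w)) $ i"
      using adj_char_poly_matrix_identity[OF A unit_vec_carrier unit_vec_carrier w ijk(1), of k j]
      unfolding un R_def[symmetric] R2_def[symmetric] Ru using ijk R w by simp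
    moreover have "(R2 *\<^sub>v (?X *\<^sub>v w)) $ i = (\<Sum>m\<in>{0..<n}. R2 $$ (i, m) * (?X *\<^sub>v w) $ m)"
      using R2 ijk A char_poly_matrix_closed[OF A] by (auto simp: scalar_prod_def)
    moreover have "kills p A (\<Sum>m\<in>{0..<n}. R2 $$ (i, m) * (?X *\<^sub>v w) $ m) u"
      by (rule kills_sum[OF A u], rule kills_mult_left[OF A u]) (use kb in auto)
    moreover have "kills p A (?\<chi> * w $ i) u" using kills_mult_left[OF A u k\<chi>, of "w $ i"] by (simp add: mult.commute)
    ultimately show ?thesis using kills_diff[OF A u] by simp
  qed
  \<comment> \<open>Two uses of \<open>E\<close> and the symmetry of R give w_k^2 R(i,i) = w_i^2
    R(k,k), a form that can be summed over i to a trace.\<close>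
  have E2: "kills p A (w $ k * w $ k * R $$ (i, i) - w $ i * w $ i * R $$ (k, k)) u" if ik: "i < n" "k < n" for i k
  proof -
    have "kills p A (w $ i * (R $$ (i, k) * w $ k - w $ i * R $$ (k, k)) - w $ k * (R $$ (k, i) * w $ i - w $ k * R $$ (i, i))) u"
      by (intro kills_diff[OF A u] kills_mult_left[OF A u] E ik)
    thus ?thesis unfolding Rsym[OF ik] by (simp add: algebra_simps)
  qed
  \<comment> \<open>Every coefficient vector of w lies in the image of N, where all inner products
    are multiples of l^2.\<close>
  have ww: "kills p A (\<Sum>i<n. w $ i * w $ i) u"
  proof (rule kills_coeff_dvd[OF A u])
    fix k
    have "\<exists>c. \<forall>a. c a \<in> carrier_vec n \<and> (\<forall>i<n. coeff (w $ i) a = (N *\<^sub>v c a) $ i)" using Nw by (metis (no_types, lifting))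
    then obtain c where c: "\<And>a. c a \<in> carrier_vec n" "\<And>a i. i < n \<Longrightarrow> coeff (w $ i) a = (N *\<^sub>v c a) $ i" by blast
    have "coeff (\<Sum>i<n. w $ i * w $ i) k = (\<Sum>i<n. \<Sum>a\<le>k. (N *\<^sub>v c a) $ i * (N *\<^sub>v c (k - a)) $ i)"
      by (simp add: coeff_sum coeff_mult c(2) del: index_mult_mat_vec)
    also have "\<dots> = (\<Sum>a\<le>k. (N *\<^sub>v c a) \<bullet> (N *\<^sub>v c (k - a)))"
      by (subst sum.swap) (use N in \<open>auto simp: scalar_prod_def lessThan_atLeast0\<close>)
    also have "\<dots> = (\<Sum>a\<le>k. l * l * (c a \<bullet> c (k - a)))" by (simp only: Nin[OF c(1) c(1)])
    also have "p dvd \<dots>" using pl by (intro dvd_sum) auto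
    finally show "p dvd coeff (\<Sum>i<n. w $ i * w $ i) k" .
  qed
  obtain k where k: "k < n" "\<not> p dvd u $ k" using y(2) unfolding nz_def u_def by blast
  have S1: "kills p A (\<Sum>i<n. w $ k * w $ k * R $$ (i, i) - w $ i * w $ i * R $$ (k, k)) u"
    by (rule kills_sum[OF A u]) (use E2 k in auto)
  have S2: "(\<Sum>i<n. w $ k * w $ k * R $$ (i, i) - w $ i * w $ i * R $$ (k, k)) =
     w $ k * (w $ k * pderiv ?\<chi>) - R $$ (k, k) * (\<Sum>i<n. w $ i * w $ i)"
    unfolding sum_subtractf pderiv_char_poly_trace[OF A] R_def[symmetric] sum_distrib_left by (simp add: ac_simps)
  have "kills p A (w $ k * (w $ k * pderiv ?\<chi>)) u"
    using kills_add[OF A u S1[unfolded S2] kills_mult_left[OF A u ww, of "R $$ (k, k)"]] by simp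
  \<comment> \<open>\<open>w $ k\<close> has degree below d, and its coefficient u_k at d - 1 is
    nonzero mod p. So it lies outside the ideal, and primality removes both factors
    \<open>w $ k\<close>.\<close>
  moreover have "\<not> kills p A (w $ k) u"
  proof
    assume *: "kills p A (w $ k) u"
    have "degree (w $ k) < d" using w0[OF k(1)] d0 by (metis degree_lessI leading_coeff_0_iff linorder_not_less)
    from min[OF this y(1,2), of "d - 1"] * k w1[OF k(1)] show False unfolding u_def by simp
  qed
  ultimately have k\<chi>': "kills p A (pderiv ?\<chi>) u" using prime by blast
  let ?M = "mat_poly A (pderiv ?\<chi>)"
  have Mu: "p dvd (?M *\<^sub>v u) $ i" if "i < n" for i using k\<chi>' A that unfolding kills_def by auto
  \<comment> \<open>M u stays in the image of N, so u . M u is a multiple of l^2; this supplies the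
    congruence mod p^2.\<close>
  have "?M *\<^sub>v u = N *\<^sub>v (mat_poly B (pderiv ?\<chi>) *\<^sub>v y)"
    unfolding u_def by (rule mat_poly_intertwine_vec[OF A B N AN y(1)])
  moreover have "mat_poly B (pderiv ?\<chi>) *\<^sub>v y \<in> carrier_vec n" using mat_poly_carrier[OF B, of "pderiv ?\<chi>"] y(1)
    by (metis mult_mat_vec_carrier)
  ultimately have "u \<bullet> (?M *\<^sub>v u) = l * l * (y \<bullet> (mat_poly B (pderiv ?\<chi>) *\<^sub>v y))" using Nin y(1) unfolding u_def by simp
  hence "p\<^sup>2 dvd u \<bullet> (?M *\<^sub>v u)" using mult_dvd_mono[OF pl pl] by (simp add: power2_eq_square)
  thus ?thesis using square_dvd_det_of_isotropic_kernel_vector[OF CA mat_poly_transpose[OF A sym] p u k Mu] by blast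
qed

text \<open>Multiplying the Sylvester matrix by the rows \<open>(A\<^sup>k w)\<^sup>T\<close> evaluates the polynomials in its rows
  at \<open>A\<close>, which kills the rows that belong to the characteristic polynomial.\<close>

lemma det_mat_poly_eq_resultant:
  fixes A :: "'a :: idom mat"
  assumes A: "A \<in> carrier_mat n n" and w: "w \<in> carrier_vec n"
    and cyclic: "det (mat n n (\<lambda>(i, j). ((A ^\<^sub>m j) *\<^sub>v w) $ i)) \<noteq> 0"
  shows "det (mat_poly A g) = resultant (char_poly A) g"
proof -
  let ?f = "char_poly A"
  define m where "m = degree g"
  define N where "N = m + n"
  have df: "degree ?f = n" "coeff ?f n = 1" using degree_monic_char_poly[OF A] by auto
  note C = mat_poly_carrier[OF A]
  define S where "S = sylvester_mat ?f g"
  have S: "S \<in> carrier_mat N N" unfolding S_def N_def m_def using sylvester_carrier_mat[of ?f g] df by (simp add: add.commute)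
  \<comment> \<open>The polynomial whose coefficients, highest first, form row i of the Sylvester
    matrix: m multiples of chi followed by n multiples of g.\<close>
  define h where "h i = (if i < m then monom 1 (m - 1 - i) * ?f else monom 1 (N - 1 - i) * g)" for i
  have mon: "coeff (monom 1 a * q) b = coeff (monom 1 (a - 1) * q) (b - 1)" if "a > 0" "b > 0" for a b :: nat and q :: "'a poly"
    using that by (cases a; cases b) (auto simp: monom_Suc)
  have Sh: "S $$ (i, j) = coeff (h i) (N - 1 - j)" if ij: "i < N" "j < N" for i j
  proof -
    have "S $$ (i, j) = (if i < m then coeff (monom 1 (m - i) * ?f) (N - j) else coeff (monom 1 (N - i) * g) (N - j))"
      unfolding S_def using ij sylvester_index_mat2[of i ?f g j] df by (simp add: m_def[symmetric] N_def add.commute)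
    thus ?thesis using ij mon[of "m - i" "N - j" ?f] mon[of "N - i" "N - j" g] unfolding h_def by auto
  qed
  have degh: "degree (h i) < N" if "i < N" for i
  proof (cases "i < m")
    case True
    have "degree (h i) \<le> (m - 1 - i) + n" unfolding h_def using True df degree_mult_le[of "monom 1 (m - 1 - i)" ?f] degree_monom_le[of "1::'a" "m - 1 - i"]
      by (auto intro: order.trans)
    thus ?thesis using True unfolding N_def by linarith
  next
    case False
    have "degree (h i) \<le> (N - 1 - i) + m" unfolding h_def m_def using False degree_mult_le[of "monom 1 (N - 1 - i)" g] degree_monom_le[of "1::'a" "N - 1 - i"]
      by (auto simp: m_def intro: order.trans)
    thus ?thesis using False that unfolding N_def by linarith
  qed
  have eval: "(\<Sum>k\<in>{0..<N}. S $$ (i, k) * ((A ^\<^sub>m (N - 1 - k)) *\<^sub>v w) $ c) = (mat_poly A (h i) *\<^sub>v w) $ c"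
    if i: "i < N" and c: "c < n" for i c
  proof -
    have "(mat_poly A (h i) *\<^sub>v w) $ c = (\<Sum>l\<le>degree (h i). coeff (h i) l * ((A ^\<^sub>m l) *\<^sub>v w) $ c)"
      by (rule mat_poly_mult_vec_index[OF A w c])
    also have "\<dots> = (\<Sum>l\<in>{0..<N}. coeff (h i) l * ((A ^\<^sub>m l) *\<^sub>v w) $ c)"
      by (rule sum.mono_neutral_left) (use degh[OF i] in \<open>auto simp: coeff_eq_0\<close>)
    also have "\<dots> = (\<Sum>k\<in>{0..<N}. coeff (h i) (N - 1 - k) * ((A ^\<^sub>m (N - 1 - k)) *\<^sub>v w) $ c)"
      by (rule sum.reindex_bij_witness[of _ "\<lambda>k. N - 1 - k" "\<lambda>k. N - 1 - k"]) auto
    also have "\<dots> = (\<Sum>k\<in>{0..<N}. S $$ (i, k) * ((A ^\<^sub>m (N - 1 - k)) *\<^sub>v w) $ c)"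
      using i by (intro sum.cong) (auto simp: Sh)
    finally show ?thesis ..
  qed
  have hA: "mat_poly A (h i) *\<^sub>v w = 0\<^sub>v n" if "i < m" for i
    using that w mat_poly_carrier[OF A, of "monom 1 (m - 1 - i)"]
    by (auto simp: h_def mat_poly_mult[OF A] cayley_hamilton_mat[OF A] right_mult_zero_mat[of _ n n]
        scalar_prod_def intro!: eq_vecI)
  \<comment> \<open>The transposed cyclic matrix with its rows reversed, to match the decreasing
    powers of x along the rows of the Sylvester matrix.\<close>
  define V where "V = mat n n (\<lambda>(r, c). ((A ^\<^sub>m (n - 1 - r)) *\<^sub>v w) $ c)"
  have V: "V \<in> carrier_mat n n" unfolding V_def by simp
  have pw: "(A ^\<^sub>m k) *\<^sub>v w \<in> carrier_vec n" for k using A w by (meson mult_mat_vec_carrier pow_carrier_mat)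
  have hA2: "(mat_poly A (h (m + r)) *\<^sub>v w) $ c = (V * (mat_poly A g)\<^sup>T) $$ (r, c)" if rc: "r < n" "c < n" for r c
  proof -
    have "mat_poly A (h (m + r)) *\<^sub>v w = mat_poly A (g * monom 1 (n - 1 - r)) *\<^sub>v w"
      using rc by (simp add: h_def N_def mult.commute)
    also have "\<dots> = mat_poly A g *\<^sub>v ((A ^\<^sub>m (n - 1 - r)) *\<^sub>v w)"
      unfolding mat_poly_mult[OF A] mat_poly_monom[OF A]
      by (rule assoc_mult_mat_vec[OF C _ w]) (use A in simp)
    finally have "(mat_poly A (h (m + r)) *\<^sub>v w) $ c = (mat_poly A g *\<^sub>v ((A ^\<^sub>m (n - 1 - r)) *\<^sub>v w)) $ c" by simp
    also have "\<dots> = (\<Sum>k\<in>{0..<n}. mat_poly A g $$ (c, k) * ((A ^\<^sub>m (n - 1 - r)) *\<^sub>v w) $ k)"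
      using rc A pw[of "n - 1 - r"] by (simp add: scalar_prod_def del: index_mult_mat_vec, subst index_mult_mat_vec) (auto simp: scalar_prod_def)
    also have "\<dots> = (V * (mat_poly A g)\<^sup>T) $$ (r, c)"
      using rc A V by (auto simp: scalar_prod_def V_def mult.commute intro!: sum.cong)
    finally show ?thesis .
  qed
  define Z where "Z = mat m n (\<lambda>(r, c). ((A ^\<^sub>m (N - 1 - r)) *\<^sub>v w) $ c)"
  \<comment> \<open>The last n columns hold the rows (A^k w)^T, so S E becomes block lower
    triangular with the unit triangular \<open>S11\<close> and V g(A)^T on the diagonal.\<close>
  define E where "E = four_block_mat (1\<^sub>m m) Z (0\<^sub>m n m) V"
  have E: "E \<in> carrier_mat N N" unfolding E_def N_def Z_def V_def by simp
  have dE: "det E = det V" unfolding E_def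
    by (subst det_four_block_mat_lower_left_zero[OF one_carrier_mat _ refl V]) (auto simp: Z_def)
  have Eent: "E $$ (r, c) = (if c < m then (if r = c then 1 else 0) else ((A ^\<^sub>m (N - 1 - r)) *\<^sub>v w) $ (c - m))"
    if "r < N" "c < N" for r c
    using that unfolding E_def Z_def V_def N_def by (auto simp: Suc_diff_le add.commute)
  define S11 where "S11 = mat m m (\<lambda>(i, j). S $$ (i, j))"
  define S21 where "S21 = mat n m (\<lambda>(i, j). S $$ (m + i, j))"
  have d11: "det S11 = 1"
  proof -
    have c: "S11 \<in> carrier_mat m m" unfolding S11_def by simp
    have ent: "S11 $$ (i, j) = (if i \<le> j \<and> j - i \<le> n then coeff ?f (n + i - j) else 0)" if "i < m" "j < m" for i j
      using that sylvester_index_mat[of i ?f g j] df unfolding S11_def S_def by (auto simp: m_def)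
    have "upper_triangular S11" unfolding upper_triangular_def using c by (auto simp: ent)
    hence "det S11 = prod_list (diag_mat S11)" by (rule det_upper_triangular[OF _ c])
    also have "diag_mat S11 = map (\<lambda>_. 1) [0..<m]" unfolding diag_mat_def using c by (auto simp: ent df)
    finally show ?thesis by (simp add: map_replicate_const)
  qed
  have "S * E = four_block_mat S11 (0\<^sub>m m n) S21 (V * (mat_poly A g)\<^sup>T)"
  proof (rule eq_matI)
    fix i j assume "i < dim_row (four_block_mat S11 (0\<^sub>m m n) S21 (V * (mat_poly A g)\<^sup>T))"
      "j < dim_col (four_block_mat S11 (0\<^sub>m m n) S21 (V * (mat_poly A g)\<^sup>T))"
    hence ij: "i < N" "j < N" using V A unfolding S11_def N_def by auto
    have SE: "(S * E) $$ (i, j) = (\<Sum>k\<in>{0..<N}. S $$ (i, k) * E $$ (k, j))"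
      using ij S E by (auto simp: scalar_prod_def)
    show "(S * E) $$ (i, j) = four_block_mat S11 (0\<^sub>m m n) S21 (V * (mat_poly A g)\<^sup>T) $$ (i, j)"
    proof (cases "j < m")
      case True
      have "(S * E) $$ (i, j) = (\<Sum>k\<in>{0..<N}. if k = j then S $$ (i, j) else 0)"
        unfolding SE by (rule sum.cong) (use True ij in \<open>auto simp: Eent\<close>)
      also have "\<dots> = S $$ (i, j)" using ij by simp
      finally show ?thesis using True ij V A by (auto simp: S11_def S21_def N_def)
    next
      case False
      have "(S * E) $$ (i, j) = (\<Sum>k\<in>{0..<N}. S $$ (i, k) * ((A ^\<^sub>m (N - 1 - k)) *\<^sub>v w) $ (j - m))"
        unfolding SE by (rule sum.cong) (use False ij in \<open>auto simp: Eent\<close>)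
      also have "\<dots> = (mat_poly A (h i) *\<^sub>v w) $ (j - m)" by (rule eval) (use False ij in \<open>auto simp: N_def\<close>)
      also have "\<dots> = (if i < m then 0 else (V * (mat_poly A g)\<^sup>T) $$ (i - m, j - m))"
        using hA[of i] hA2[of "i - m" "j - m"] False ij by (auto simp: N_def)
      finally show ?thesis using False ij V A by (auto simp: S11_def N_def simp del: index_mult_mat(1))
    qed
  qed (use S E V A in \<open>auto simp: N_def S11_def\<close>)
  hence "det (S * E) = det S11 * det (V * (mat_poly A g)\<^sup>T)"
    by (simp only:, intro det_four_block_mat_upper_right_zero[OF _ refl])
      (use V C[of g] in \<open>auto simp: S11_def S21_def\<close>)
  hence "det S * det V = det V * det (mat_poly A g)"
    using det_mult[OF S E] dE d11 det_mult[OF V, of "(mat_poly A g)\<^sup>T"] det_transpose[OF C[of g]] C[of g] by simp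
  \<comment> \<open>det V occurs on both sides and cancels, so the sign of the row reversal never
    has to be computed.\<close>
  moreover have "det V \<noteq> 0"
  proof
    let ?W = "mat n n (\<lambda>(i, j). ((A ^\<^sub>m j) *\<^sub>v w) $ i)"
    assume "det V = 0"
    then obtain x where x: "x \<in> carrier_vec n" "x \<noteq> 0\<^sub>v n" "V *\<^sub>v x = 0\<^sub>v n"
      using det_0_iff_vec_prod_zero[OF V] by auto
    have "?W\<^sup>T *\<^sub>v x = 0\<^sub>v n"
    proof (rule eq_vecI)
      fix r assume "r < dim_vec (0\<^sub>v n :: 'a vec)"
      hence r: "r < n" by simp
      have "(?W\<^sup>T *\<^sub>v x) $ r = (V *\<^sub>v x) $ (n - 1 - r)"
        using r x(1) by (auto simp: scalar_prod_def V_def intro!: sum.cong)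
      thus "(?W\<^sup>T *\<^sub>v x) $ r = 0\<^sub>v n $ r" using r x(3) by simp
    qed simp
    hence "det (?W\<^sup>T) = 0" using x by (subst det_0_iff_vec_prod_zero[of _ n]) auto
    thus False using cyclic det_transpose[of ?W n] by simp
  qed
  ultimately show ?thesis unfolding resultant_def S_def by (simp add: mult.commute)
qed

section \<open>The polynomials annihilating the all-ones vector modulo a prime\<close>

lemma ones_carrier [simp]: "ones n \<in> carrier_vec n"
  by (simp add: ones_def)

lemma all_ones_mat_outer: "all_ones_mat n = outer (ones n) (ones n)"
  by (auto simp: all_ones_mat_def outer_def ones_def intro!: eq_matI)

text \<open>If \<open>q\<close> is irreducible mod \<open>p\<close> and divides both \<open>\<chi>(A)\<close> and \<open>\<chi>(A + J)\<close>, then it divides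
  \<open>e\<^sup>T adj(x - A) e\<close>. As \<open>adj(x - A)\<close> has rank at most one mod \<open>\<chi>(A)\<close>, it follows that \<open>q\<close> divides
  the squares of the entries of \<open>adj(x - A) e\<close>.\<close>

lemma common_factor_dvdm_adj_mult_ones:
  fixes A :: "int mat"
  assumes A: "A \<in> carrier_mat n n" and sym: "A\<^sup>T = A" and p: "prime p"
    and q: "poly_mod.irreducible_m p q" "monic q"
    and q1: "poly_mod.dvdm p q (char_poly A)" and q2: "poly_mod.dvdm p q (char_poly (A + all_ones_mat n))"
    and j: "j < n"
  shows "poly_mod.dvdm p q ((adj_mat (char_poly_matrix A) *\<^sub>v const_vec (ones n)) $ j)"
proof -
  interpret poly_mod_prime p using p by unfold_locales
  let ?X = "char_poly_matrix A" and ?\<chi> = "char_poly A"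
  define e' where "e' = const_vec (ones n)"
  define R where "R = adj_mat ?X"
  define v where "v = R *\<^sub>v e'"
  define f where "f = e' \<bullet> v"
  note X = char_poly_matrix_closed[OF A]
  have R: "R \<in> carrier_mat n n" unfolding R_def by (rule adj_mat(1)[OF X])
  have e': "e' \<in> carrier_vec n" unfolding e'_def by simp
  have e'1: "e' $ i = 1" if "i < n" for i using that by (simp add: e'_def ones_def)
  have Rsym: "R $$ (i, k) = R $$ (k, i)" if "i < n" "k < n" for i k
    unfolding R_def by (rule adj_mat_symmetric[OF X char_poly_matrix_symmetric[OF A sym] that])
  have "char_poly (A + all_ones_mat n) = ?\<chi> - f"
    unfolding all_ones_mat_outer f_def v_def e'_def R_def
    by (rule char_poly_rank_one_update[OF A ones_carrier ones_carrier])
  hence "f = ?\<chi> - char_poly (A + all_ones_mat n)" by simp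
  hence qf: "q dvdm f" using dvdm_diff[OF q1 q2] by simp
  \<comment> \<open>Column j of R is the test vector for the adjugate identity with s = t = e: (x -
    A) maps it to a multiple of chi, and its product with e is v_j by the symmetry of R. This is
    what produces the square of v_j.\<close>
  have Xw: "?X *\<^sub>v col R j = ?\<chi> \<cdot>\<^sub>v unit_vec n j"
  proof -
    have "?X *\<^sub>v (R *\<^sub>v unit_vec n j) = ?\<chi> \<cdot>\<^sub>v unit_vec n j"
      unfolding R_def char_poly_def by (rule adj_mat_mult_vec(1)[OF X]) simp
    moreover have "R *\<^sub>v unit_vec n j = col R j" using R j by (intro eq_vecI) auto
    ultimately show ?thesis by simp
  qed
  have col: "col R j \<in> carrier_vec n" using R by (auto intro: carrier_vecI)
  define R2 where "R2 = adj_mat (char_poly_matrix (A + outer (ones n) (ones n)))"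
  have R2: "R2 \<in> carrier_mat n n" unfolding R2_def
    by (rule adj_mat(1), rule char_poly_matrix_closed, rule add_carrier_mat, rule outer_carrier) auto
  have "e' \<bullet> col R j = v $ j"
    using R e' j by (auto simp: v_def scalar_prod_def e'1 intro!: sum.cong Rsym)
  moreover have "(R2 *\<^sub>v (?\<chi> \<cdot>\<^sub>v unit_vec n j)) $ j = ?\<chi> * R2 $$ (j, j)"
  proof -
    have "R2 *\<^sub>v (?\<chi> \<cdot>\<^sub>v unit_vec n j) = ?\<chi> \<cdot>\<^sub>v (R2 *\<^sub>v unit_vec n j)"
      by (rule mult_mat_vec_smult[OF R2]) simp
    thus ?thesis using R2 j by simp
  qed
  ultimately have "f * R $$ (j, j) - v $ j * v $ j = ?\<chi> * R $$ (j, j) - ?\<chi> * R2 $$ (j, j)"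
    using adj_char_poly_matrix_identity[OF A ones_carrier[of n] ones_carrier[of n] col j]
    unfolding R_def[symmetric] e'_def[symmetric] v_def[symmetric] f_def[symmetric] Xw R2_def[symmetric]
    using R j by simp
  hence "v $ j * v $ j = f * R $$ (j, j) - (?\<chi> * R $$ (j, j) - ?\<chi> * R2 $$ (j, j))" by (simp add: algebra_simps)
  moreover have "q dvdm \<dots>" by (intro dvdm_diff dvdm_mult_right qf q1)
  ultimately have "q dvdm v $ j * v $ j" by simp
  thus ?thesis using irreducible_m_dvdm_mult[OF q] unfolding v_def R_def e'_def by blast
qed

text \<open>The entries of v = adj(x - A) e are divisible by s mod p, and (x - A) v = chi e with chi
  = Q s mod p. Cancelling the monic s leaves (x - A) w = Q e mod p, and substituting A gives Q(A) e
  = 0 mod p.\<close>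

lemma quotient_by_sfp:
  fixes A :: "int mat"
  assumes A: "A \<in> carrier_mat n n" and sym: "A\<^sup>T = A" and p: "prime p"
  defines "Q \<equiv> quotient_mod p (char_poly A) (sfp_mod p (gcd_mod p (char_poly A) (char_poly (A + all_ones_mat n))))"
  shows quotient_by_sfp_nonzero: "Q \<noteq> 0"
    and quotient_by_sfp_annihilates: "\<And>i. i < n \<Longrightarrow> p dvd (mat_poly A Q *\<^sub>v ones n) $ i"
proof -
  interpret poly_mod_prime p using p by unfold_locales
  let ?X = "char_poly_matrix A" and ?\<chi> = "char_poly A"
  define g where "g = gcd_mod p ?\<chi> (char_poly (A + all_ones_mat n))"
  define s where "s = sfp_mod p g"
  define e' where "e' = const_vec (ones n)"
  define v where "v = adj_mat ?X *\<^sub>v e'"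
  note X = char_poly_matrix_closed[OF A]
  have e': "e' \<in> carrier_vec n" unfolding e'_def by simp
  have v: "v \<in> carrier_vec n" unfolding v_def using adj_mat(1)[OF X] e' by simp
  have mon: "monic ?\<chi>" using degree_monic_char_poly[OF A] by simp
  have g: "g dvdm ?\<chi>" "g dvdm char_poly (A + all_ones_mat n)" using gcd_mod[OF mon] unfolding g_def by auto
  have s: "monic s" unfolding s_def by (rule monic_sfp_mod)
  have s\<chi>: "s dvdm ?\<chi>" unfolding s_def by (rule sfp_mod_dvdm) (use g dvdm_trans in blast)
  have Q: "Mp (Q * s) = Mp ?\<chi>" using quotient_mod[OF s s\<chi>] unfolding Q_def s_def g_def by simp
  show "Q \<noteq> 0"
  proof
    assume "Q = 0"
    hence "Mp ?\<chi> = 0" using Q by simp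
    thus False using monic_Mp[OF mon] by auto
  qed
  have "s dvdm v $ j" if "j < n" for j unfolding s_def
    by (rule sfp_mod_dvdm, unfold v_def e'_def, rule common_factor_dvdm_adj_mult_ones[OF A sym p])
      (use g dvdm_trans that in blast)+
  hence "\<forall>j. \<exists>a. j < n \<longrightarrow> Mp (v $ j) = Mp (s * a)" unfolding dvdm_def by blast
  from choice[OF this] obtain a where a: "\<And>j. j < n \<Longrightarrow> Mp (v $ j) = Mp (s * a j)" by blast
  define w where "w = vec n a"
  have w: "w \<in> carrier_vec n" unfolding w_def by simp
  have Xv: "(?X *\<^sub>v v) $ i = ?\<chi>" if "i < n" for i
    using adj_mat_mult_vec(1)[OF X e'] that e' unfolding v_def char_poly_def[symmetric] by (simp add: e'_def ones_def)
  have Xw: "Mp ((?X *\<^sub>v w) $ i) = Mp Q" if i: "i < n" for i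
  proof (rule Mp_mult_monic_cancel[OF s])
    have "\<forall>j. \<exists>r. j < n \<longrightarrow> v $ j = s * a j + Polynomial.smult p r" using a Mp_eq_ex by blast
    from choice[OF this] obtain r where r: "\<And>j. j < n \<Longrightarrow> v $ j = s * a j + Polynomial.smult p (r j)" by blast
    have "?\<chi> = (\<Sum>j\<in>{0..<n}. ?X $$ (i, j) * v $ j)"
      using Xv[OF i] i A v by (simp add: scalar_prod_def)
    also have "\<dots> = (\<Sum>j\<in>{0..<n}. ?X $$ (i, j) * a j * s + Polynomial.smult p (?X $$ (i, j) * r j))"
      by (rule sum.cong) (auto simp: r algebra_simps)
    also have "\<dots> = (?X *\<^sub>v w) $ i * s + Polynomial.smult p (\<Sum>j\<in>{0..<n}. ?X $$ (i, j) * r j)"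
      unfolding sum.distrib sum_distrib_right[symmetric] using i A
      by (simp add: scalar_prod_def w_def smult_sum2)
    finally show "Mp ((?X *\<^sub>v w) $ i * s) = Mp (Q * s)" unfolding Q by simp
  qed
  have "\<forall>i. \<exists>z. i < n \<longrightarrow> (?X *\<^sub>v w) $ i = Q + Polynomial.smult p z" using Xw Mp_eq_ex by blast
  from choice[OF this] obtain z where z: "\<And>i. i < n \<Longrightarrow> (?X *\<^sub>v w) $ i = Q + Polynomial.smult p (z i)" by blast
  have "?X *\<^sub>v w = Q \<cdot>\<^sub>v const_vec (ones n) + [:p:] \<cdot>\<^sub>v vec n z"
    by (intro eq_vecI) (use z A in \<open>auto simp: ones_def simp del: index_mult_mat_vec\<close>)
  from mat_poly_mult_vec_eq[OF A w _ ones_carrier this]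
  have "mat_poly A Q *\<^sub>v ones n = - p \<cdot>\<^sub>v vec_poly_eval A n (vec n z)" by simp
  thus "p dvd (mat_poly A Q *\<^sub>v ones n) $ i" if "i < n" for i
    using that by (simp add: vec_poly_eval_def[OF A] del: index_mult_mat_vec)
qed

text \<open>Replacing \<open>A\<close> by a skew-symmetric lift of its reduction mod 2 makes \<open>\<chi>(x)\<close> an even or odd
  polynomial.\<close>

lemma even_coeff_char_poly:
  fixes A :: "int mat"
  assumes A: "A \<in> carrier_mat n n" and sym: "A\<^sup>T = A"
    and diag: "\<And>i. i < n \<Longrightarrow> A $$ (i, i) = 0" and odd: "odd (n + k)"
  shows "even (coeff (char_poly A) k)"
proof -
  have e: "A $$ (a, b) = A $$ (b, a)" if "a < n" "b < n" for a b
    by (rule symmetric_mat_index[OF A sym that])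
  \<comment> \<open>The lower triangle of A is negated: K = A mod 2, and K^T = -K because the
    diagonal is 0.\<close>
  define K where "K = mat n n (\<lambda>(i, j). if i < j then A $$ (i, j) else - A $$ (i, j))"
  have K: "K \<in> carrier_mat n n" unfolding K_def by simp
  have "char_poly (- K) = char_poly (K\<^sup>T)"
    by (rule arg_cong[of _ _ char_poly]) (auto simp: K_def e diag intro!: eq_matI)
  also have "\<dots> = char_poly K" by (rule char_poly_transpose_mat[OF K])
  finally have mKK: "char_poly (- K) = char_poly K" .
  \<comment> \<open>Substituting -x gives chi_K(-x) = (-1)^n chi_{-K}(x) = (-1)^n chi_K(x), so the
    coefficients of the wrong parity vanish.\<close>
  let ?r = "monom (-1) 1 :: int poly"
  have "char_poly K \<circ>\<^sub>p ?r = det (map_mat (\<lambda>q. q \<circ>\<^sub>p ?r) (char_poly_matrix K))"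
    unfolding char_poly_def by (rule comm_ring_hom.hom_det[OF pcompose_hom.comm_ring_hom_axioms, symmetric])
  also have "map_mat (\<lambda>q. q \<circ>\<^sub>p ?r) (char_poly_matrix K) = (-1) \<cdot>\<^sub>m char_poly_matrix (- K)"
    using K by (intro eq_matI) (auto simp: char_poly_matrix_def monom_altdef)
  also have "det \<dots> = (-1) ^ n * char_poly K"
    unfolding det_smult using K mKK by (simp add: char_poly_def)
  finally have "coeff (char_poly K \<circ>\<^sub>p ?r) k = coeff ((-1) ^ n * char_poly K) k" by simp
  also have "coeff ((-1) ^ n * char_poly K) k = (-1) ^ n * coeff (char_poly K) k"
    by (cases "even n") auto
  finally have "coeff (char_poly K) k = 0"
    using odd by (cases "even n"; cases "even k") (auto simp del: coeff_pcompose_monom_linear simp: coeff_pcompose_monom_linear)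
  moreover have "of_int (coeff (char_poly A) k) = (of_int (coeff (char_poly K) k) :: bit)"
  proof -
    have neg: "- (b :: bit) = b" for b by (cases b) auto
    have "map_mat of_int A = (map_mat of_int K :: bit mat)"
      using A by (intro eq_matI) (auto simp: K_def neg)
    hence "char_poly (map_mat of_int A :: bit mat) = char_poly (map_mat of_int K)" by simp
    hence "map_poly of_int (char_poly A) = (map_poly of_int (char_poly K) :: bit poly)"
      unfolding of_int_hom.char_poly_hom[OF A] of_int_hom.char_poly_hom[OF K] .
    thus ?thesis by (metis coeff_map_poly of_int_0)
  qed
  ultimately have *: "of_int (coeff (char_poly A) k) = (0 :: bit)" by simp
  show ?thesis
  proof (rule ccontr)
    assume "odd (coeff (char_poly A) k)"
    then obtain l where l: "coeff (char_poly A) k = 2 * l + 1" by (rule oddE)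
    have "b + b = 0" for b :: bit by (cases b) auto
    hence "of_int (2 * l + 1) = (1 :: bit)" unfolding mult_2 of_int_add by simp
    thus False using * unfolding l by (metis zero_neq_one)
  qed
qed

lemma square_sum_mod_2:
  fixes f :: "'a \<Rightarrow> int poly"
  assumes "finite S"
  shows "\<exists>r. (\<Sum>x\<in>S. f x) * (\<Sum>x\<in>S. f x) = (\<Sum>x\<in>S. f x * f x) + Polynomial.smult 2 r"
  using assms
proof (induction S)
  case empty
  show ?case by (rule exI[of _ 0]) simp
next
  case (insert x F)
  then obtain r where r: "(\<Sum>x\<in>F. f x) * (\<Sum>x\<in>F. f x) = (\<Sum>x\<in>F. f x * f x) + Polynomial.smult 2 r" by blast
  have *: "(a + b) * (a + b) = a * a + b * b + Polynomial.smult 2 (a * b)" for a b :: "int poly"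
    using smult_add_left[of 1 1 "a * b"] by (simp add: algebra_simps)
  show ?case
    using insert.hyps r *[of "f x" "\<Sum>x\<in>F. f x"]
    by (intro exI[of _ "r + f x * (\<Sum>x\<in>F. f x)"]) (simp add: smult_add_right algebra_simps)
qed

text \<open>Over the field with two elements \<open>v\<^sup>T e = v\<^sup>T v\<close>, so a symmetric \<open>N = f(A)\<close> with \<open>N\<^sup>2 = 0\<close>
  satisfies \<open>N e = 0\<close>.\<close>

lemma even_mat_poly_ones:
  fixes A :: "int mat"
  assumes A: "A \<in> carrier_mat n n" and sym: "A\<^sup>T = A"
    and sq: "f * f = h * char_poly A + Polynomial.smult 2 r" and i: "i < n"
  shows "even ((mat_poly A f *\<^sub>v ones n) $ i)"
proof -
  let ?N = "mat_poly A f"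
  have N: "?N \<in> carrier_mat n n" using A by simp
  have e: "?N $$ (a, b) = ?N $$ (b, a)" if "a < n" "b < n" for a b
    by (rule symmetric_mat_index[OF N mat_poly_transpose[OF A sym] that])
  have "?N * ?N = mat_poly A h * mat_poly A (char_poly A) + 2 \<cdot>\<^sub>m mat_poly A r"
    unfolding mat_poly_mult[OF A, symmetric] sq mat_poly_add[OF A] mat_poly_smult[OF A] ..
  hence "(?N * ?N) $$ (i, i) = (mat_poly A h * 0\<^sub>m n n + 2 \<cdot>\<^sub>m mat_poly A r) $$ (i, i)"
    unfolding cayley_hamilton_mat[OF A] by simp
  also have "mat_poly A h * 0\<^sub>m n n = 0\<^sub>m n n" by (rule right_mult_zero_mat) (use A in simp)
  finally have "even ((?N * ?N) $$ (i, i))" using i A by simp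
  moreover have "(?N * ?N) $$ (i, i) = (\<Sum>j\<in>{0..<n}. ?N $$ (i, j) * ?N $$ (i, j))"
    using i A e by (auto simp: scalar_prod_def intro!: sum.cong)
  moreover have "(?N *\<^sub>v ones n) $ i = (\<Sum>j\<in>{0..<n}. ?N $$ (i, j))"
    using i A by (auto simp: scalar_prod_def ones_def)
  moreover have "even ((\<Sum>j\<in>{0..<n}. ?N $$ (i, j) * ?N $$ (i, j)) - (\<Sum>j\<in>{0..<n}. ?N $$ (i, j)))"
    unfolding sum_subtractf[symmetric] by (rule dvd_sum) simp
  ultimately show ?thesis by simp
qed

section \<open>Walk matrices\<close>

lemma adj_carrier [simp]: "adj n E \<in> carrier_mat n n"
  by (simp add: adj_def)

lemma dim_adj [simp]: "dim_row (adj n E) = n" "dim_col (adj n E) = n"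
  by (simp_all add: adj_def)

lemma adj_symmetric: "(adj n E)\<^sup>T = adj n E"
  by (intro eq_matI) (auto simp: adj_def insert_commute)

lemma adj_diag: "simple_graph n E \<Longrightarrow> i < n \<Longrightarrow> adj n E $$ (i, i) = 0"
  by (auto simp: adj_def simple_graph_def complete_edges_def doubleton_eq_iff)

lemma walk_matrix_carrier [simp]: "walk_matrix n E \<in> carrier_mat n n"
  by (simp add: walk_matrix_def)

lemma walk_matrix_mod_carrier [simp]: "walk_matrix_mod p n E \<in> carrier_mat n n"
  by (simp add: walk_matrix_mod_def Let_def)

lemma dim_walk_matrix [simp]: "dim_row (walk_matrix n E) = n" "dim_col (walk_matrix n E) = n"
  by (simp_all add: walk_matrix_def)

lemma dim_walk_matrix_mod [simp]: "dim_row (walk_matrix_mod p n E) = n" "dim_col (walk_matrix_mod p n E) = n"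
  by (simp_all add: walk_matrix_mod_def Let_def)

lemma controllable_det_nonzero:
  assumes "controllable n E"
  shows "det (walk_matrix n E) \<noteq> 0"
proof -
  have "det (map_mat of_int (walk_matrix n E) :: rat mat) \<noteq> 0"
    using assms vec_space.det_rank_iff[of "map_mat of_int (walk_matrix n E) :: rat mat" n]
    unfolding controllable_def by simp
  thus ?thesis by (simp add: of_int_hom.hom_det)
qed

text \<open>Squaring mod 2 doubles the exponents and fixes the coefficients, and the coefficients of
  chi that are skipped are even by \<open>even_coeff_char_poly\<close>. So the square is x^u chi mod
  2 with u the parity of n, and \<open>even_mat_poly_ones\<close> applies.\<close>

lemma M_two_annihilates:
  assumes G: "simple_graph n E" and i: "i < n"
  shows "even ((mat_poly (adj n E) (M_two n E) *\<^sub>v ones n) $ i)"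
proof -
  interpret poly_mod 2 .
  let ?A = "adj n E"
  let ?\<chi> = "char_poly ?A"
  define k where "k = n div 2"
  define u where "u = (if even n then 0 else 1 :: nat)"
  define c where "c j = coeff ?\<chi> (n - 2 * j)" for j
  define f where "f = (\<Sum>j\<le>k. monom (c j) (k - j + u))"
  have n: "n = 2 * k + u" unfolding k_def u_def by simp
  have M: "M_two n E = Mp f"
  proof -
    have "monom 1 1 * (\<Sum>j\<le>k. monom (c j) (k - j)) = (\<Sum>j\<le>k. monom (c j) (k - j + 1))"
      unfolding sum_distrib_left by (simp add: mult_monom)
    thus ?thesis unfolding M_two_def Let_def k_def[symmetric] c_def[symmetric] f_def u_def
      by (auto simp: Suc_diff_le)
  qed
  obtain r where r: "f * f = (\<Sum>j\<le>k. monom (c j) (k - j + u) * monom (c j) (k - j + u)) + Polynomial.smult 2 r"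
    using square_sum_mod_2[of "{..k}" "\<lambda>j. monom (c j) (k - j + u)"] unfolding f_def by auto
  have "Mp (\<Sum>j\<le>k. monom (c j) (k - j + u) * monom (c j) (k - j + u)) = Mp (monom 1 u * ?\<chi>)"
    unfolding Mp_eq_iff
  proof
    fix t
    \<comment> \<open>As n = 2 k + u, the exponent 2 (k - j + u) equals n - 2 j + u, the exponent
      belonging to \<open>c j\<close> in x^u chi.\<close>
    have lhs: "coeff (\<Sum>j\<le>k. monom (c j) (k - j + u) * monom (c j) (k - j + u)) t
      = (\<Sum>j\<le>k. if n - 2 * j + u = t then c j * c j else 0)"
      unfolding coeff_sum by (rule sum.cong) (auto simp: mult_monom n)
    show "2 dvd coeff (\<Sum>j\<le>k. monom (c j) (k - j + u) * monom (c j) (k - j + u)) t - coeff (monom 1 u * ?\<chi>) t"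
    proof (cases "\<exists>j\<le>k. n - 2 * j + u = t")
      case True
      then obtain j where j: "j \<le> k" "n - 2 * j + u = t" by blast
      have "(\<Sum>j\<le>k. if n - 2 * j + u = t then c j * c j else 0) = (\<Sum>j'\<in>{..k}. if j' = j then c j * c j else 0)"
        by (rule sum.cong) (use j n in auto)
      also have "\<dots> = c j * c j" using j by simp
      finally have "coeff (\<Sum>j\<le>k. monom (c j) (k - j + u) * monom (c j) (k - j + u)) t = c j * c j" unfolding lhs .
      moreover have "coeff (monom 1 u * ?\<chi>) t = c j"
        unfolding j(2)[symmetric] by (simp add: coeff_monom_mult c_def)
      ultimately show ?thesis by simp
    next
      case False
      hence "coeff (\<Sum>j\<le>k. monom (c j) (k - j + u) * monom (c j) (k - j + u)) t = 0"
        unfolding lhs by (intro sum.neutral) auto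
      moreover have "even (coeff (monom 1 u * ?\<chi>) t)"
      proof (cases "u \<le> t")
        case True
        have "even (coeff ?\<chi> (t - u))"
        proof (cases "t - u \<le> n")
          case le: True
          have "odd (n + (t - u))"
          proof
            assume "even (n + (t - u))"
            hence "even (n - (t - u))" using le by auto
            then obtain j where j: "n - (t - u) = 2 * j" by (rule evenE)
            moreover have "u \<le> 1" by (simp add: u_def)
            ultimately have "n - 2 * j + u = t" "j \<le> k" using le True n by arith+
            thus False using False by blast
          qed
          with adj_diag[OF G] show ?thesis by (intro even_coeff_char_poly[OF adj_carrier adj_symmetric]) auto
        next
          case False
          hence "coeff ?\<chi> (t - u) = 0" using degree_monic_char_poly[OF adj_carrier, of n E] by (intro coeff_eq_0) simp
          thus ?thesis by simp
        qed
        thus ?thesis using True by (simp add: coeff_monom_mult)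
      qed (simp add: coeff_monom_mult)
      ultimately show ?thesis by simp
    qed
  qed
  hence "Mp (Mp f * Mp f) = Mp (monom 1 u * ?\<chi>)" unfolding mult_Mp r Mp_add_smult .
  from Mp_eq_ex[OF this] obtain s where "M_two n E * M_two n E = monom 1 u * ?\<chi> + Polynomial.smult 2 s"
    unfolding M by blast
  from even_mat_poly_ones[OF adj_carrier adj_symmetric this i] show ?thesis .
qed

lemma M_two_nonzero: "M_two n E \<noteq> 0"
proof -
  interpret poly_mod_2 2 by unfold_locales simp
  define k where "k = n div 2"
  let ?\<chi> = "char_poly (adj n E)"
  define h where "h = (\<Sum>j\<le>k. monom (coeff ?\<chi> (n - 2 * j)) (k - j))"
  have "coeff h k = (\<Sum>j\<le>k. if j = 0 then coeff ?\<chi> n else 0)"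
    unfolding h_def coeff_sum by (rule sum.cong) auto
  hence hk: "coeff h k = 1" using degree_monic_char_poly[OF adj_carrier, of n E] by simp
  have "coeff (M_two n E) (if even n then k else k + 1) = 1"
    using hk coeff_monom_mult[of 1 1 h "k + 1"] by (simp add: M_two_def Let_def k_def[symmetric] h_def[symmetric] Mp_coeff M_def)
  thus ?thesis by auto
qed

lemma M_pol_nonzero:
  assumes "prime p"
  shows "M_pol p n E \<noteq> 0"
  using M_two_nonzero quotient_by_sfp_nonzero[OF adj_carrier adj_symmetric assms]
  by (simp add: M_pol_def M_odd_def)

lemma M_pol_annihilates:
  assumes "simple_graph n E" "prime p" "i < n"
  shows "p dvd (mat_poly (adj n E) (M_pol p n E) *\<^sub>v ones n) $ i"
  using assms M_two_annihilates quotient_by_sfp_annihilates[OF adj_carrier adj_symmetric assms(2)]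
  by (simp add: M_pol_def M_odd_def)

lemma M_pol_cong:
  assumes "char_poly (adj n E) = char_poly (adj n F)"
    and "char_poly (adj n E + all_ones_mat n) = char_poly (adj n F + all_ones_mat n)"
  shows "M_pol p n E = M_pol p n F"
  using assms by (simp add: M_pol_def M_two_def M_odd_def)

section \<open>Walk polynomials and the matrices W^(p)\<close>

abbreviation walk_vec :: "nat \<Rightarrow> nat set set \<Rightarrow> nat \<Rightarrow> int vec" where
  "walk_vec n E k \<equiv> (adj n E ^\<^sub>m k) *\<^sub>v ones n"

lemma pow_mult_ones_carrier [simp]: "walk_vec n E k \<in> carrier_vec n"
  by (meson adj_carrier mult_mat_vec_carrier ones_carrier pow_carrier_mat)

lemma poly_walk_eq:
  assumes r: "r < n"
  shows "poly_walk q n E i $ r = (mat_poly (adj n E) (monom 1 i * q) *\<^sub>v ones n) $ r"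
proof -
  let ?A = "adj n E"
  note A = adj_carrier[of n E]
  have "mat_poly ?A (q * monom 1 i) *\<^sub>v ones n = mat_poly ?A q *\<^sub>v ((?A ^\<^sub>m i) *\<^sub>v ones n)"
    unfolding mat_poly_mult_vec[OF A ones_carrier] mat_poly_monom[OF A] ..
  hence "(mat_poly ?A (q * monom 1 i) *\<^sub>v ones n) $ r =
      (\<Sum>l\<le>degree q. coeff q l * ((?A ^\<^sub>m l) *\<^sub>v ((?A ^\<^sub>m i) *\<^sub>v ones n)) $ r)"
    using mat_poly_mult_vec_index[OF A pow_mult_ones_carrier r, of q E i] by simp
  also have "\<dots> = (\<Sum>l\<le>degree q. coeff q l * ((?A ^\<^sub>m (i + l)) *\<^sub>v ones n) $ r)"
  proof (rule sum.cong, rule refl)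
    fix l
    have "(?A ^\<^sub>m l) *\<^sub>v ((?A ^\<^sub>m i) *\<^sub>v ones n) = mat_poly ?A (monom 1 l * monom 1 i) *\<^sub>v ones n"
      unfolding mat_poly_mult_vec[OF A ones_carrier] mat_poly_monom[OF A] ..
    also have "\<dots> = (?A ^\<^sub>m (i + l)) *\<^sub>v ones n"
      unfolding mult_monom by (simp add: mat_poly_monom[OF A] add.commute)
    finally show "coeff q l * ((?A ^\<^sub>m l) *\<^sub>v ((?A ^\<^sub>m i) *\<^sub>v ones n)) $ r =
      coeff q l * ((?A ^\<^sub>m (i + l)) *\<^sub>v ones n) $ r" by simp
  qed
  finally show ?thesis using r by (simp add: poly_walk_def mult.commute)
qed

lemma mat_poly_ones_eq_walk_matrix:
  assumes deg: "degree f < n" and r: "r < n"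
  shows "(mat_poly (adj n E) f *\<^sub>v ones n) $ r = (\<Sum>k\<in>{0..<n}. walk_matrix n E $$ (r, k) * coeff f k)"
proof -
  have "(mat_poly (adj n E) f *\<^sub>v ones n) $ r = (\<Sum>l\<le>degree f. coeff f l * walk_vec n E l $ r)"
    by (rule mat_poly_mult_vec_index[OF adj_carrier ones_carrier r])
  also have "\<dots> = (\<Sum>l\<in>{0..<n}. coeff f l * walk_vec n E l $ r)"
    by (rule sum.mono_neutral_left) (use deg in \<open>auto simp: coeff_eq_0\<close>)
  also have "\<dots> = (\<Sum>k\<in>{0..<n}. walk_matrix n E $$ (r, k) * coeff f k)"
    using r by (intro sum.cong) (auto simp: walk_matrix_def mult.commute)
  finally show ?thesis .
qed

text \<open>Applied to A and e, this gives p times column j of W^(p). The factor p removes the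
  division and lets both kinds of columns be treated alike.\<close>

definition walk_pol :: "int \<Rightarrow> nat \<Rightarrow> nat set set \<Rightarrow> nat \<Rightarrow> int poly" where
  "walk_pol p n E j = (let q = M_pol p n E in
     if j < degree q then monom p j else monom 1 (j - degree q) * q)"

lemma walk_matrix_mod_eq:
  assumes G: "simple_graph n E" and p: "prime p" and r: "r < n" and j: "j < n"
  shows "p * walk_matrix_mod p n E $$ (r, j) = (mat_poly (adj n E) (walk_pol p n E j) *\<^sub>v ones n) $ r"
proof -
  let ?A = "adj n E" and ?q = "M_pol p n E"
  note A = adj_carrier[of n E]
  show ?thesis
  proof (cases "j < degree ?q")
    case True
    have "monom p j = Polynomial.smult p (monom 1 j)" by (simp add: smult_monom)
    hence "mat_poly ?A (monom p j) = p \<cdot>\<^sub>m (?A ^\<^sub>m j)" by (simp only: mat_poly_smult[OF A] mat_poly_monom[OF A])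
    moreover have "((p \<cdot>\<^sub>m (?A ^\<^sub>m j)) *\<^sub>v ones n) $ r = p * ((?A ^\<^sub>m j) *\<^sub>v ones n) $ r"
      using r A by (simp add: mult_mat_vec_index_sum[of _ n n] sum_distrib_left mult.assoc del: index_mult_mat_vec)
    ultimately show ?thesis using True r j by (simp add: walk_matrix_mod_def walk_pol_def Let_def del: index_mult_mat_vec)
  next
    case False
    have "p dvd (mat_poly ?A (monom 1 (j - degree ?q) * ?q) *\<^sub>v ones n) $ r"
      unfolding mat_poly_mult_vec[OF A ones_carrier]
      by (rule dvd_mult_mat_vec[OF mat_poly_carrier[OF A] _ M_pol_annihilates[OF G p] r])
        (auto intro!: mult_mat_vec_carrier[OF mat_poly_carrier[OF A]])
    thus ?thesis using False r j by (simp add: walk_matrix_mod_def walk_pol_def Let_def poly_walk_eq)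
  qed
qed

lemma walk_pol_degree: "degree (walk_pol p n E j) \<le> j"
proof -
  let ?q = "M_pol p n E"
  have "degree (monom 1 (j - degree ?q) * ?q) \<le> (j - degree ?q) + degree ?q"
    using degree_mult_le[of "monom 1 (j - degree ?q)" ?q] degree_monom_le[of "1::int" "j - degree ?q"] by linarith
  thus ?thesis by (auto simp: walk_pol_def Let_def degree_monom_le)
qed

lemma walk_pol_lead:
  assumes "prime p"
  shows "coeff (walk_pol p n E j) j \<noteq> 0"
  using M_pol_nonzero[OF assms, of n E] assms
  by (auto simp: walk_pol_def Let_def coeff_monom_mult)

text \<open>p W^(p) = W T, where T holds the coefficients of the walk polynomials. The j-th one has
  degree j, so T is triangular with nonzero diagonal.\<close>

lemma det_walk_matrix_mod_nonzero:
  assumes G: "simple_graph n E" and p: "prime p" and det0: "det (walk_matrix n E) \<noteq> 0"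
  shows "det (walk_matrix_mod p n E) \<noteq> 0"
proof -
  define T where "T = mat n n (\<lambda>(i, j). coeff (walk_pol p n E j) i)"
  have T: "T \<in> carrier_mat n n" unfolding T_def by simp
  have "p \<cdot>\<^sub>m walk_matrix_mod p n E = walk_matrix n E * T"
  proof (rule eq_matI)
    fix r j assume "r < dim_row (walk_matrix n E * T)" "j < dim_col (walk_matrix n E * T)"
    hence rj: "r < n" "j < n" unfolding T_def by (auto simp: walk_matrix_def)
    have deg: "degree (walk_pol p n E j) < n" using walk_pol_degree[of p n E j] rj by linarith
    have "(p \<cdot>\<^sub>m walk_matrix_mod p n E) $$ (r, j) = p * walk_matrix_mod p n E $$ (r, j)"
      using rj walk_matrix_mod_carrier[of p n E] by (metis carrier_matD index_smult_mat(1))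
    also have "\<dots> = (\<Sum>k\<in>{0..<n}. walk_matrix n E $$ (r, k) * coeff (walk_pol p n E j) k)"
      unfolding walk_matrix_mod_eq[OF G p rj] by (rule mat_poly_ones_eq_walk_matrix[OF deg rj(1)])
    also have "\<dots> = (walk_matrix n E * T) $$ (r, j)"
      using rj T by (auto simp: scalar_prod_def T_def)
    finally show "(p \<cdot>\<^sub>m walk_matrix_mod p n E) $$ (r, j) = (walk_matrix n E * T) $$ (r, j)" .
  qed (use T in auto)
  hence "det (p \<cdot>\<^sub>m walk_matrix_mod p n E) = det (walk_matrix n E) * det T"
    using det_mult[OF walk_matrix_carrier T] by simp
  moreover have "det T \<noteq> 0"
  proof -
    have "upper_triangular T" unfolding upper_triangular_def T_def
      by (auto intro!: coeff_eq_0 le_less_trans[OF walk_pol_degree])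
    hence "det T = prod_list (diag_mat T)" by (rule det_upper_triangular[OF _ T])
    also have "\<dots> \<noteq> 0" using walk_pol_lead[OF p] by (auto simp: prod_list_zero_iff diag_mat_def T_def)
    finally show ?thesis .
  qed
  ultimately show ?thesis using det0 by (auto simp: det_smult)
qed

text \<open>Transposing A N = N B gives B N^T = N^T A, as A and B are symmetric. The relations
  between the walk matrices of two mates are columnwise instances of this one.\<close>

lemma intertwine_mat_poly_ones:
  assumes N: "N \<in> carrier_mat n n" and AN: "adj n E * N = N * adj n F"
    and Ne: "N\<^sup>T *\<^sub>v ones n = l \<cdot>\<^sub>v ones n"
  shows "N\<^sup>T *\<^sub>v (mat_poly (adj n E) f *\<^sub>v ones n) = l \<cdot>\<^sub>v (mat_poly (adj n F) f *\<^sub>v ones n)"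
proof -
  let ?A = "adj n E" and ?B = "adj n F"
  have Nt: "N\<^sup>T \<in> carrier_mat n n" using N by simp
  have BN: "?B * N\<^sup>T = N\<^sup>T * ?A"
    using arg_cong[OF AN, of transpose_mat] transpose_mult[OF adj_carrier N, of E] transpose_mult[OF N adj_carrier, of F]
    by (simp add: adj_symmetric)
  have "N\<^sup>T *\<^sub>v (mat_poly ?A f *\<^sub>v ones n) = mat_poly ?B f *\<^sub>v (N\<^sup>T *\<^sub>v ones n)"
    by (rule mat_poly_intertwine_vec[OF adj_carrier adj_carrier Nt BN ones_carrier, symmetric])
  also have "\<dots> = l \<cdot>\<^sub>v (mat_poly ?B f *\<^sub>v ones n)"
    unfolding Ne by (rule mult_mat_vec_smult[OF mat_poly_carrier[OF adj_carrier] ones_carrier])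
  finally show ?thesis .
qed

lemma transpose_mult_walk_matrix:
  assumes N: "N \<in> carrier_mat n n" and AN: "adj n E * N = N * adj n F"
    and Ne: "N\<^sup>T *\<^sub>v ones n = l \<cdot>\<^sub>v ones n"
  shows "N\<^sup>T * walk_matrix n E = l \<cdot>\<^sub>m walk_matrix n F"
proof (rule eq_matI)
  fix i j assume "i < dim_row (l \<cdot>\<^sub>m walk_matrix n F)" "j < dim_col (l \<cdot>\<^sub>m walk_matrix n F)"
  hence ij: "i < n" "j < n" by (auto simp: walk_matrix_def)
  have "(N\<^sup>T * walk_matrix n E) $$ (i, j) = (N\<^sup>T *\<^sub>v (walk_vec n E j)) $ i"
    using ij N by (auto simp: scalar_prod_def walk_matrix_def simp del: index_mult_mat_vec, subst index_mult_mat_vec) (auto simp: scalar_prod_def)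
  also have "\<dots> = (l \<cdot>\<^sub>v (walk_vec n F j)) $ i"
    using intertwine_mat_poly_ones[OF assms, of "monom 1 j"] by (simp add: mat_poly_monom[OF adj_carrier])
  also have "\<dots> = (l \<cdot>\<^sub>m walk_matrix n F) $$ (i, j)" using ij by (simp add: walk_matrix_def)
  finally show "(N\<^sup>T * walk_matrix n E) $$ (i, j) = (l \<cdot>\<^sub>m walk_matrix n F) $$ (i, j)" .
qed (use N in \<open>auto simp: walk_matrix_def\<close>)

text \<open>Computed for p times both sides, where no division occurs; by \<open>M_pol_cong\<close>
  one walk polynomial serves for both graphs.\<close>

lemma transpose_mult_walk_matrix_mod:
  assumes N: "N \<in> carrier_mat n n" and AN: "adj n E * N = N * adj n F"
    and Ne: "N\<^sup>T *\<^sub>v ones n = l \<cdot>\<^sub>v ones n"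
    and G: "simple_graph n E" and H: "simple_graph n F" and p: "prime p"
    and c1: "char_poly (adj n E) = char_poly (adj n F)"
    and c2: "char_poly (adj n E + all_ones_mat n) = char_poly (adj n F + all_ones_mat n)"
  shows "N\<^sup>T * walk_matrix_mod p n E = l \<cdot>\<^sub>m walk_matrix_mod p n F"
proof (rule eq_matI)
  let ?W = "walk_matrix_mod p n E" and ?V = "walk_matrix_mod p n F"
  have d: "dim_row ?W = n" "dim_col ?W = n" "dim_row ?V = n" "dim_col ?V = n"
    by auto
  fix i j assume "i < dim_row (l \<cdot>\<^sub>m ?V)" "j < dim_col (l \<cdot>\<^sub>m ?V)"
  hence ij: "i < n" "j < n" using d by auto
  have wp: "walk_pol p n E j = walk_pol p n F j" unfolding walk_pol_def M_pol_cong[OF c1 c2] ..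
  let ?x = "mat_poly (adj n E) (walk_pol p n E j) *\<^sub>v ones n"
  have "p * (N\<^sup>T * ?W) $$ (i, j) = (\<Sum>k\<in>{0..<n}. N $$ (k, i) * (p * ?W $$ (k, j)))"
    using ij N d by (auto simp: scalar_prod_def sum_distrib_left ac_simps intro!: sum.cong)
  also have "\<dots> = (\<Sum>k\<in>{0..<n}. N $$ (k, i) * ?x $ k)"
    using ij walk_matrix_mod_eq[OF G p] by (intro sum.cong) auto
  also have "\<dots> = (N\<^sup>T *\<^sub>v ?x) $ i"
    using ij N mult_mat_vec_index_sum[of "N\<^sup>T" n n ?x i]
      mult_mat_vec_carrier[OF mat_poly_carrier[OF adj_carrier] ones_carrier] by simp
  also have "\<dots> = l * (mat_poly (adj n F) (walk_pol p n F j) *\<^sub>v ones n) $ i"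
    unfolding intertwine_mat_poly_ones[OF N AN Ne] wp using ij by simp
  also have "\<dots> = p * (l \<cdot>\<^sub>m ?V) $$ (i, j)"
    unfolding walk_matrix_mod_eq[OF H p ij, symmetric] using ij d by simp
  finally show "(N\<^sup>T * ?W) $$ (i, j) = (l \<cdot>\<^sub>m ?V) $$ (i, j)" using p by auto
qed (use N in auto)

section \<open>The level of Q divides L\<close>

lemma finite_potential_primes:
  assumes n: "n > 0" and det0: "det (walk_matrix n E) \<noteq> 0"
  shows "finite (potential_primes n E)"
proof (rule finite_subset)
  let ?d = "last_invariant_factor (walk_matrix n E)"
  show "potential_primes n E \<subseteq> {2} \<union> {0..?d}"
    using last_invariant_factor_pos[OF walk_matrix_carrier det0 n]
    by (auto simp: potential_primes_def candidate_primes_def Let_def prime_ge_0_int dest: zdvd_imp_le)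
qed simp

lemma system_level_nonzero: "system_level n E \<noteq> 0"
proof (cases "finite (potential_primes n E)")
  case True
  thus ?thesis unfolding system_level_def by (auto simp: potential_primes_def candidate_primes_def Let_def)
qed (simp add: system_level_def)

text \<open>Compared prime by prime. For p dividing l, the divisibility of the last invariant
  factors of W and W^(p) by l yields the rank condition and ord_p(l) \<le> t_p; for odd p the
  discriminant makes p a candidate.\<close>

lemma level_dvd_system_level:
  assumes G: "simple_graph n E" and H: "simple_graph n F" and n: "n > 0"
    and det0: "det (walk_matrix n E) \<noteq> 0"
    and c1: "char_poly (adj n E) = char_poly (adj n F)"
    and c2: "char_poly (adj n E + all_ones_mat n) = char_poly (adj n F + all_ones_mat n)"
    and N: "N \<in> carrier_mat n n" and AN: "adj n E * N = N * adj n F"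
    and NN: "N\<^sup>T * N = (l * l) \<cdot>\<^sub>m 1\<^sub>m n"
    and Ne: "N\<^sup>T *\<^sub>v ones n = l \<cdot>\<^sub>v ones n" and l: "l > 0"
    and prim: "\<And>p. prime p \<Longrightarrow> p dvd l \<Longrightarrow> \<exists>i<n. \<exists>j<n. \<not> p dvd N $$ (i, j)"
  shows "l dvd system_level n E"
proof -
  define d where "d = last_invariant_factor (walk_matrix n E)"
  have d: "d > 0" unfolding d_def by (rule last_invariant_factor_pos[OF walk_matrix_carrier det0 n])
  have ld: "l dvd d" unfolding d_def
    by (rule level_dvd_last_invariant_factor[OF N walk_matrix_carrier walk_matrix_carrier
        transpose_mult_walk_matrix[OF N AN Ne] det0 n l prim])
  note fin = finite_potential_primes[OF n det0]
  note L0 = system_level_nonzero[of n E]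
  have pot: "p \<in> potential_primes n E \<and> multiplicity p l \<le> potential_exponent p n E"
    if p: "prime p" and pl: "p dvd l" for p
  proof -
    define dp where "dp = last_invariant_factor (walk_matrix_mod p n E)"
    have detp: "det (walk_matrix_mod p n E) \<noteq> 0" by (rule det_walk_matrix_mod_nonzero[OF G p det0])
    have dp: "dp > 0" unfolding dp_def by (rule last_invariant_factor_pos[OF walk_matrix_mod_carrier detp n])
    have "l dvd dp" unfolding dp_def
      by (rule level_dvd_last_invariant_factor[OF N walk_matrix_mod_carrier walk_matrix_mod_carrier
        transpose_mult_walk_matrix_mod[OF N AN Ne G H p c1 c2] detp n l prim])
    hence mult: "multiplicity p l \<le> potential_exponent p n E"
      unfolding potential_exponent_def dp_def[symmetric] using dp by (intro dvd_imp_multiplicity_le) auto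
    have "multiplicity p l \<ge> 1"
      using pl l prime_gt_1_int[OF p] by (intro multiplicity_geI) auto
    hence t: "potential_exponent p n E \<ge> 1" using mult by simp
    have rank: "rank_mod p (walk_matrix n E) < n"
      by (rule rank_mod_less[OF walk_matrix_carrier det0 n p]) (use pl ld dvd_trans d_def in blast)
    have "p \<in> candidate_primes n E"
    proof (cases "p = 2")
      case True thus ?thesis by (simp add: candidate_primes_def Let_def)
    next
      case False
      let ?\<Delta> = "discriminant (char_poly (adj n E))"
      obtain i j where ij: "i < n" "j < n" "\<not> p dvd N $$ (i, j)" using prim[OF p pl] by blast
      have "p\<^sup>2 dvd det (mat_poly (adj n E) (pderiv (char_poly (adj n E))))"
        by (rule square_dvd_det_pderiv_char_poly[OF adj_carrier adj_symmetric adj_carrier N AN NN p pl ij])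
      \<comment> \<open>The all-ones vector is cyclic for A because W is nonsingular.\<close>
      also have "\<dots> = resultant (char_poly (adj n E)) (pderiv (char_poly (adj n E)))"
        by (rule det_mat_poly_eq_resultant[OF adj_carrier ones_carrier])
          (use det0 in \<open>simp add: walk_matrix_def\<close>)
      finally have D: "p\<^sup>2 dvd ?\<Delta>" unfolding discriminant_def by simp
      moreover have "p dvd p\<^sup>2" by (simp add: power2_eq_square)
      hence "p dvd ?\<Delta>" using D by (rule dvd_trans)
      moreover have "p dvd d" using pl ld by (rule dvd_trans)
      moreover have "odd p" using prime_odd_int[OF p] prime_gt_1_int[OF p] False by simp
      ultimately show ?thesis using p by (auto simp: candidate_primes_def Let_def d_def)
    qed
    thus ?thesis using rank t mult by (auto simp: potential_primes_def)
  qed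
  show ?thesis
  proof (rule multiplicity_le_imp_dvd)
    show "l \<noteq> 0" using l by simp
    fix p :: int assume p: "prime p"
    show "multiplicity p l \<le> multiplicity p (system_level n E)"
    proof (cases "p dvd l")
      case False
      thus ?thesis by (simp add: not_dvd_imp_multiplicity_0)
    next
      case True
      note P = pot[OF p True]
      have "p ^ potential_exponent p n E dvd system_level n E"
        unfolding system_level_def by (rule dvd_prodI[OF fin]) (use P in blast)
      hence "potential_exponent p n E \<le> multiplicity p (system_level n E)"
        using L0 prime_gt_1_int[OF p] by (intro multiplicity_geI) auto
      thus ?thesis using P by simp
    qed
  qed
qed

section \<open>Walk counts are determined by the two characteristic polynomials\<close>

definition walk_count :: "nat \<Rightarrow> nat set set \<Rightarrow> nat \<Rightarrow> int" where
  "walk_count n E k = ones n \<bullet> (walk_vec n E k)"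

lemma pow_adj_symmetric: "(adj n E ^\<^sub>m k)\<^sup>T = adj n E ^\<^sub>m k"
  using mat_poly_transpose[OF adj_carrier adj_symmetric, of n E "monom 1 k"]
  by (simp add: mat_poly_monom[OF adj_carrier])

lemma pow_adj_scalar_prod:
  "(walk_vec n E i) \<bullet> (walk_vec n E j) = walk_count n E (i + j)"
proof -
  let ?A = "adj n E"
  have P: "?A ^\<^sub>m k \<in> carrier_mat n n" for k by simp
  have "((?A ^\<^sub>m i) *\<^sub>v ones n) \<bullet> ((?A ^\<^sub>m j) *\<^sub>v ones n) = ones n \<bullet> (?A ^\<^sub>m i *\<^sub>v ((?A ^\<^sub>m j) *\<^sub>v ones n))"
    using transpose_vec_mult_scalar[OF P pow_mult_ones_carrier[of n E j] ones_carrier, of i] by (simp add: pow_adj_symmetric)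
  also have "?A ^\<^sub>m i *\<^sub>v ((?A ^\<^sub>m j) *\<^sub>v ones n) = mat_poly ?A (monom 1 i * monom 1 j) *\<^sub>v ones n"
    unfolding mat_poly_mult_vec[OF adj_carrier ones_carrier] mat_poly_monom[OF adj_carrier] ..
  also have "\<dots> = ?A ^\<^sub>m (i + j) *\<^sub>v ones n" by (simp add: mult_monom mat_poly_monom[OF adj_carrier])
  finally show ?thesis unfolding walk_count_def .
qed

text \<open>The polynomials \<open>g\<^sub>k = e\<^sup>T A\<^sup>k adj(x - A) e\<close> satisfy \<open>x g\<^sub>k - g\<^sub>k\<^sub>+\<^sub>1 = \<sigma>\<^sub>k \<chi>\<close> with \<open>\<sigma>\<^sub>k = e\<^sup>T A\<^sup>k e\<close>, so
  all walk counts are determined by \<open>\<chi>\<close> and \<open>g\<^sub>0\<close>.\<close>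

lemma walk_count_cong:
  assumes n: "n > 0" and c1: "char_poly (adj n E) = char_poly (adj n F)"
    and c2: "char_poly (adj n E + all_ones_mat n) = char_poly (adj n F + all_ones_mat n)"
  shows "walk_count n E k = walk_count n F k"
proof -
  let ?c = "\<lambda>a. [:a:] :: int poly"
  let ?\<chi> = "char_poly (adj n E)"
  define v where "v E = adj_mat (char_poly_matrix (adj n E)) *\<^sub>v map_vec ?c (ones n)" for E
  define g where "g E k = (\<Sum>i\<in>{0..<n}. Polynomial.smult (walk_vec n E k $ i) (v E $ i))" for E k
  have X: "char_poly_matrix (adj n E) \<in> carrier_mat n n" for E by simp
  have e: "map_vec ?c (ones n) \<in> carrier_vec n" by simp
  have v: "v E \<in> carrier_vec n" for E
    unfolding v_def using adj_mat(1)[OF X] e by (metis mult_mat_vec_carrier)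
  \<comment> \<open>The cofactors of x - A have degree below n, so no g_k has a term in x^n.
    Comparing the coefficients of x^n in the recurrence therefore gives the walk count as the
    coefficient of x^(n-1) in g_k.\<close>
  have deg: "coeff (v E $ i) n = 0" if "i < n" for E i
  proof -
    have "degree (adj_mat (char_poly_matrix (adj n E)) $$ (i, j)) < n" if "j < n" for j
    proof -
      let ?D = "mat_delete (char_poly_matrix (adj n E)) j i"
      have "?D \<in> carrier_mat (n - 1) (n - 1)" using X by (auto simp: mat_delete_def)
      moreover have "degree (?D $$ (a, b)) \<le> 1" if "a < n - 1" "b < n - 1" for a b
        using that by (auto simp: mat_delete_def char_poly_matrix_def adj_def)
      ultimately have "degree (det ?D) \<le> 1 * (n - 1)" by (rule degree_det_le[rotated])
      moreover have "degree ((-1) ^ (j + i) * det ?D) = degree (det ?D)"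
        by (cases "even (j + i)") auto
      ultimately show ?thesis using \<open>i < n\<close> \<open>j < n\<close> X[of E] n by (simp add: adj_mat_def cofactor_def)
    qed
    hence "coeff (adj_mat (char_poly_matrix (adj n E)) $$ (i, j)) n = 0" if "j < n" for j
      using that by (simp add: coeff_eq_0)
    moreover have "v E $ i = (\<Sum>j\<in>{0..<n}. adj_mat (char_poly_matrix (adj n E)) $$ (i, j))"
      unfolding v_def mult_mat_vec_index_sum[OF adj_mat(1)[OF X] e that] by (simp add: ones_def)
    ultimately show ?thesis by (simp add: coeff_sum)
  qed
  have rec: "[:0, 1:] * g E k - g E (Suc k) = Polynomial.smult (walk_count n E k) (char_poly (adj n E))" for E k
  proof -
    let ?A = "adj n E" and ?a = "\<lambda>i. walk_vec n E k $ i"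
    have Xv: "[:0, 1:] * v E $ i - (\<Sum>j\<in>{0..<n}. Polynomial.smult (?A $$ (i, j)) (v E $ j)) = char_poly ?A" if "i < n" for i
      unfolding char_poly_matrix_mult_vec[OF adj_carrier v that, symmetric]
      using adj_mat_mult_vec(1)[OF X e] that unfolding v_def char_poly_def[symmetric] by (simp add: ones_def)
    have Aa: "(\<Sum>i\<in>{0..<n}. ?A $$ (i, j) * ?a i) = walk_vec n E (Suc k) $ j" if "j < n" for j
    proof -
      have "walk_vec n E (Suc k) = ?A *\<^sub>v (walk_vec n E k)"
        unfolding pow_mat_Suc_left[OF adj_carrier]
        by (rule assoc_mult_mat_vec[OF adj_carrier _ ones_carrier]) simp
      hence "walk_vec n E (Suc k) $ j = (\<Sum>i\<in>{0..<n}. ?A $$ (j, i) * ?a i)"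
        using mult_mat_vec_index_sum[OF adj_carrier pow_mult_ones_carrier that] by metis
      moreover have "?A $$ (j, i) = ?A $$ (i, j)" if "i < n" for i
        using that \<open>j < n\<close> by (simp add: adj_def insert_commute)
      ultimately show ?thesis by simp
    qed
    have "Polynomial.smult (walk_count n E k) (char_poly ?A) = (\<Sum>i\<in>{0..<n}. Polynomial.smult (?a i) (char_poly ?A))"
      unfolding walk_count_def scalar_prod_def smult_sum[symmetric] by (simp add: ones_def smult_sum del: index_mult_mat_vec)
    also have "\<dots> = (\<Sum>i\<in>{0..<n}. Polynomial.smult (?a i) ([:0, 1:] * v E $ i - (\<Sum>j\<in>{0..<n}. Polynomial.smult (?A $$ (i, j)) (v E $ j))))"
      by (rule sum.cong) (simp_all only: Xv atLeastLessThan_iff)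
    also have "\<dots> = [:0, 1:] * g E k - (\<Sum>i\<in>{0..<n}. \<Sum>j\<in>{0..<n}. Polynomial.smult (?A $$ (i, j) * ?a i) (v E $ j))"
      unfolding smult_diff_right sum_subtractf g_def sum_distrib_left smult_sum2
      by (simp add: mult.commute del: index_mult_mat_vec)
    also have "(\<Sum>i\<in>{0..<n}. \<Sum>j\<in>{0..<n}. Polynomial.smult (?A $$ (i, j) * ?a i) (v E $ j)) = g E (Suc k)"
      unfolding g_def
    proof (subst sum.swap, rule sum.cong)
      fix j assume "j \<in> {0..<n}"
      thus "(\<Sum>i\<in>{0..<n}. Polynomial.smult (?A $$ (i, j) * ?a i) (v E $ j)) = Polynomial.smult (walk_vec n E (Suc k) $ j) (v E $ j)"
        using Aa[of j] by (simp only: smult_sum[symmetric] atLeastLessThan_iff)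
    qed simp
    finally show ?thesis by simp
  qed
  have wc: "walk_count n E k = coeff (g E k) (n - 1)" for E k
  proof -
    have "coeff ([:0, 1:] * g E k - g E (Suc k)) n = walk_count n E k"
      unfolding rec using degree_monic_char_poly[OF adj_carrier, of n E] by simp
    moreover have "coeff (g E (Suc k)) n = 0" unfolding g_def coeff_sum by (auto intro!: sum.neutral simp: deg)
    moreover obtain m where "n = Suc m" using n by (cases n) auto
    ultimately show ?thesis by simp
  qed
  have f: "map_vec ?c (ones n) \<bullet> v E = char_poly (adj n E) - char_poly (adj n E + all_ones_mat n)" for E
    using char_poly_rank_one_update[OF adj_carrier ones_carrier ones_carrier, of n E]
    unfolding v_def all_ones_mat_outer by simp
  have g0: "g E 0 = map_vec ?c (ones n) \<bullet> v E" for E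
    unfolding g_def scalar_prod_def using v[of E] by (auto simp: ones_def intro!: sum.cong)
  \<comment> \<open>With the walk count eliminated, the recurrence involves only chi, so equal g_0
    force equal g_k.\<close>
  have step: "g E (Suc k) = [:0, 1:] * g E k - Polynomial.smult (coeff (g E k) (n - 1)) (char_poly (adj n E))" for E k
    unfolding wc[symmetric] rec[symmetric] by simp
  have "g E k = g F k" for k
    by (induction k) (simp_all only: g0 f c1 c2 step)
  thus ?thesis unfolding wc by simp
qed

section \<open>Generalized cospectral mates\<close>

lemma graph_spectrum_hom:
  "graph_spectrum n E = proots (map_poly of_int (char_poly (adj n E)) :: complex poly)"
  unfolding graph_spectrum_def of_int_hom.char_poly_hom[OF adj_carrier] ..

text \<open>A monic complex polynomial is the product over its multiset of roots, whose size is the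
  order of the graph.\<close>

lemma graph_spectrum_eqD:
  assumes "graph_spectrum m F = graph_spectrum n E"
  shows "m = n" "char_poly (adj m F) = char_poly (adj n E)"
proof -
  let ?p = "\<lambda>n E. map_poly of_int (char_poly (adj n E)) :: complex poly"
  have monic: "lead_coeff (?p n E) = 1" for n E
    using degree_monic_char_poly[OF adj_carrier, of n E] by simp
  have eq: "proots (?p m F) = proots (?p n E)" using assms unfolding graph_spectrum_hom .
  show "m = n" using arg_cong[OF eq, of size] degree_monic_char_poly[OF adj_carrier, of m F] degree_monic_char_poly[OF adj_carrier, of n E]
    by (simp add: size_proots_complex)
  have "?p m F = ?p n E"
    using complex_poly_decompose_multiset[of "?p m F"] complex_poly_decompose_multiset[of "?p n E"] monic eq by simp
  thus "char_poly (adj m F) = char_poly (adj n E)" by (metis of_int_poly_hom.injectivity)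
qed

lemma adj_complement_edges:
  assumes "simple_graph n E"
  shows "adj n (complement_edges n E) = all_ones_mat n - 1\<^sub>m n - adj n E"
proof (rule eq_matI)
  fix i j assume "i < dim_row (all_ones_mat n - 1\<^sub>m n - adj n E)" "j < dim_col (all_ones_mat n - 1\<^sub>m n - adj n E)"
  hence ij: "i < n" "j < n" by auto
  have "{i, j} \<in> complete_edges n \<longleftrightarrow> i \<noteq> j"
    using ij by (auto simp: complete_edges_def doubleton_eq_iff)
  thus "adj n (complement_edges n E) $$ (i, j) = (all_ones_mat n - 1\<^sub>m n - adj n E) $$ (i, j)"
    using ij assms by (auto simp: adj_def complement_edges_def all_ones_mat_def simple_graph_def)
qed auto

lemma all_ones_mat_carrier [simp]: "all_ones_mat n \<in> carrier_mat n n"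
  by (simp add: all_ones_mat_def)

text \<open>det(x - A - t J) is affine in t, so chi(A - J) = 2 chi(A) - chi(A + J). Replacing x by
  -1 - x turns x - (J - I - A) into -(x - (A - J)).\<close>

lemma char_poly_complement:
  assumes A: "A \<in> carrier_mat n n"
  shows "char_poly (all_ones_mat n - 1\<^sub>m n - A) \<circ>\<^sub>p [:-1, -1:] = (-1) ^ n * (2 * char_poly A - char_poly (A + all_ones_mat n))"
proof -
  let ?e = "const_vec (ones n)" and ?e' = "const_vec (- ones n)"
  let ?R = "adj_mat (char_poly_matrix A)"
  have R: "?R \<in> carrier_mat n n" by (rule adj_mat(1)) (use A in simp)
  have me: "?e' = - ?e" by (intro eq_vecI) (auto simp: ones_def)
  have "A - all_ones_mat n = A + outer (- ones n) (ones n)"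
    using A by (intro eq_matI) (auto simp: all_ones_mat_def outer_def ones_def)
  hence 1: "char_poly (A - all_ones_mat n) = char_poly A - ?e \<bullet> (?R *\<^sub>v ?e')"
    using char_poly_rank_one_update[OF A uminus_carrier_vec[THEN iffD2, OF ones_carrier] ones_carrier] by simp
  have "?R *\<^sub>v ?e' = - (?R *\<^sub>v ?e)" unfolding me using R by (intro eq_vecI) (auto simp: scalar_prod_def sum_negf)
  hence "?e \<bullet> (?R *\<^sub>v ?e') = - (?e \<bullet> (?R *\<^sub>v ?e))" using R by (auto simp: scalar_prod_def sum_negf)
  moreover have "char_poly (A + all_ones_mat n) = char_poly A - ?e \<bullet> (?R *\<^sub>v ?e)"
    unfolding all_ones_mat_outer by (rule char_poly_rank_one_update[OF A ones_carrier ones_carrier])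
  ultimately have 2: "char_poly (A - all_ones_mat n) = 2 * char_poly A - char_poly (A + all_ones_mat n)"
    using 1 by simp
  let ?C = "all_ones_mat n - 1\<^sub>m n - A"
  have "char_poly ?C \<circ>\<^sub>p [:-1, -1:] = det (map_mat (\<lambda>q. q \<circ>\<^sub>p [:-1, -1:]) (char_poly_matrix ?C))"
    unfolding char_poly_def by (rule comm_ring_hom.hom_det[OF pcompose_hom.comm_ring_hom_axioms, symmetric])
  also have "map_mat (\<lambda>q. q \<circ>\<^sub>p [:-1, -1:]) (char_poly_matrix ?C) = (-1) \<cdot>\<^sub>m char_poly_matrix (A - all_ones_mat n)"
    using A by (intro eq_matI) (auto simp: char_poly_matrix_def all_ones_mat_def)
  also have "det \<dots> = (-1) ^ n * char_poly (A - all_ones_mat n)"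
    unfolding det_smult using A by (simp add: char_poly_def all_ones_mat_def)
  finally show ?thesis unfolding 2 .
qed

lemma char_poly_intertwine:
  fixes A :: "'a :: idom mat"
  assumes A: "A \<in> carrier_mat n n" and B: "B \<in> carrier_mat n n" and N: "N \<in> carrier_mat n n"
    and AN: "A * N = N * B" and det0: "det N \<noteq> 0"
  shows "char_poly A = char_poly B"
proof -
  let ?h = "map_mat (\<lambda>a. [:a:] :: 'a poly)"
  have N': "?h N \<in> carrier_mat n n" using N by simp
  have X: "char_poly_matrix A \<in> carrier_mat n n" "char_poly_matrix B \<in> carrier_mat n n" using A B by auto
  have c: "char_poly_matrix C = [:0, 1:] \<cdot>\<^sub>m 1\<^sub>m n - ?h C" if "C \<in> carrier_mat n n" for C
    using that by (intro eq_matI) (auto simp: char_poly_matrix_def)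
  have "char_poly_matrix A * ?h N = [:0, 1:] \<cdot>\<^sub>m ?h N - ?h (A * N)"
    unfolding c[OF A] using A N
    by (subst minus_mult_distrib_mat[of _ n n])
      (auto simp: map_poly_mult(1)[OF A N] mult_smult_assoc_mat[OF one_carrier_mat N'])
  also have "\<dots> = ?h N * char_poly_matrix B"
    unfolding c[OF B] AN using B N
    by (subst mult_minus_distrib_mat[of _ n n])
      (auto simp: map_poly_mult(1)[OF N B] mult_smult_distrib[OF N' one_carrier_mat])
  finally have "det (?h N) * det (char_poly_matrix A) = det (?h N) * det (char_poly_matrix B)"
    using det_mult[OF X(1) N'] det_mult[OF N' X(2)] by (metis mult.commute)
  moreover have "det (?h N) \<noteq> 0" using det0 coeff_lift_hom.hom_det[of N] by simp
  ultimately show ?thesis unfolding char_poly_def using mult_left_cancel by blast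
qed

text \<open>For nonzero l this encodes N = l Q with Q orthogonal, Q^T e = e and A Q = Q B. The
  conditions are homogeneous in (N, l), so common factors can be cancelled and the sign of l
  changed.\<close>

definition mate_matrix :: "nat \<Rightarrow> nat set set \<Rightarrow> nat set set \<Rightarrow> int mat \<Rightarrow> int \<Rightarrow> bool" where
  "mate_matrix n E F N l \<longleftrightarrow> N \<in> carrier_mat n n \<and> adj n E * N = N * adj n F \<and>
     N\<^sup>T * N = (l * l) \<cdot>\<^sub>m 1\<^sub>m n \<and> N\<^sup>T *\<^sub>v ones n = l \<cdot>\<^sub>v ones n"

lemma mate_matrix_smult:
  assumes c: "c \<noteq> 0" and N: "N \<in> carrier_mat n n"
  shows "mate_matrix n E F (c \<cdot>\<^sub>m N) (c * l) \<longleftrightarrow> mate_matrix n E F N l"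
proof -
  have Nt: "N\<^sup>T \<in> carrier_mat n n" using N by simp
  have t: "(c \<cdot>\<^sub>m N)\<^sup>T = c \<cdot>\<^sub>m N\<^sup>T" using N by (intro eq_matI) auto
  have 1: "adj n E * (c \<cdot>\<^sub>m N) = (c \<cdot>\<^sub>m N) * adj n F \<longleftrightarrow> adj n E * N = N * adj n F"
    using mult_smult_distrib[OF adj_carrier N, of E c] mult_smult_assoc_mat[OF N adj_carrier, of c F]
      smult_mat_cancel[OF c mult_carrier_mat[OF adj_carrier N] mult_carrier_mat[OF N adj_carrier], of E F] by simp
  have "(c \<cdot>\<^sub>m N\<^sup>T) * (c \<cdot>\<^sub>m N) = (c * c) \<cdot>\<^sub>m (N\<^sup>T * N)"
    using mult_smult_distrib[of "c \<cdot>\<^sub>m N\<^sup>T" n n N n c] mult_smult_assoc_mat[OF Nt N, of c] N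
    by (simp add: smult_smult_mat)
  moreover have "(c * l * (c * l)) \<cdot>\<^sub>m 1\<^sub>m n = (c * c) \<cdot>\<^sub>m ((l * l) \<cdot>\<^sub>m 1\<^sub>m n)"
    by (intro eq_matI) (auto simp: ac_simps)
  ultimately have 2: "(c \<cdot>\<^sub>m N)\<^sup>T * (c \<cdot>\<^sub>m N) = (c * l * (c * l)) \<cdot>\<^sub>m 1\<^sub>m n \<longleftrightarrow> N\<^sup>T * N = (l * l) \<cdot>\<^sub>m 1\<^sub>m n"
    unfolding t using smult_mat_cancel[of "c * c" "N\<^sup>T * N" n n "(l * l) \<cdot>\<^sub>m 1\<^sub>m n"] c N by simp
  have "(c \<cdot>\<^sub>m N\<^sup>T) *\<^sub>v ones n = c \<cdot>\<^sub>v (N\<^sup>T *\<^sub>v ones n)"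
    using Nt ones_carrier[of n]
    by (intro eq_vecI) (simp_all add: mult_mat_vec_index_sum[of _ n n] sum_distrib_left mult.assoc del: index_mult_mat_vec)
  moreover have "c \<cdot>\<^sub>v (N\<^sup>T *\<^sub>v ones n) = (c * l) \<cdot>\<^sub>v ones n \<longleftrightarrow> N\<^sup>T *\<^sub>v ones n = l \<cdot>\<^sub>v ones n"
  proof
    assume "c \<cdot>\<^sub>v (N\<^sup>T *\<^sub>v ones n) = (c * l) \<cdot>\<^sub>v ones n"
    hence e: "(c \<cdot>\<^sub>v (N\<^sup>T *\<^sub>v ones n)) $ i = ((c * l) \<cdot>\<^sub>v ones n) $ i" for i by simp
    have "(N\<^sup>T *\<^sub>v ones n) $ i = l" if "i < n" for i using e[of i] that N c by (simp add: ones_def)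
    thus "N\<^sup>T *\<^sub>v ones n = l \<cdot>\<^sub>v ones n" using N by (intro eq_vecI) (auto simp: ones_def)
  qed (simp add: smult_smult_assoc)
  ultimately have 3: "(c \<cdot>\<^sub>m N)\<^sup>T *\<^sub>v ones n = (c * l) \<cdot>\<^sub>v ones n \<longleftrightarrow> N\<^sup>T *\<^sub>v ones n = l \<cdot>\<^sub>v ones n"
    unfolding t by simp
  show ?thesis unfolding mate_matrix_def 1 2 3 using N by simp
qed

text \<open>N^T = W(H) adj(W(G)) is det W(G) times W(H) W(G)^(-1). Equal walk counts mean equal
  matrices W^T W and W^T A W, which give orthogonality and the intertwining relation. Choosing l > 0
  minimal then makes N nonzero modulo every prime divisor of l.\<close>

lemma mate_matrix_exists:
  assumes n: "n > 0" and det0: "det (walk_matrix n E) \<noteq> 0"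
    and wc: "\<And>k. walk_count n E k = walk_count n F k"
  obtains N l where "mate_matrix n E F N l" "l > 0"
    "\<And>p. prime p \<Longrightarrow> p dvd l \<Longrightarrow> \<exists>i<n. \<exists>j<n. \<not> p dvd N $$ (i, j)"
proof -
  let ?W = "walk_matrix n E" and ?V = "walk_matrix n F" and ?A = "adj n E" and ?B = "adj n F"
  define D where "D = det ?W"
  have D: "D \<noteq> 0" unfolding D_def by (rule det0)
  note W = walk_matrix_carrier[of n E] and V = walk_matrix_carrier[of n F]
  have Wt: "?W\<^sup>T \<in> carrier_mat n n" and Vt: "?V\<^sup>T \<in> carrier_mat n n"
    using W V by auto
  have colW: "col (walk_matrix n E) j = walk_vec n E j" if "j < n" for E j
    using that by (intro eq_vecI) (simp_all add: walk_matrix_def)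
  have colAW: "col (adj n E * walk_matrix n E) j = walk_vec n E (Suc j)" if "j < n" for E j
  proof -
    have "col (adj n E * walk_matrix n E) j = adj n E *\<^sub>v col (walk_matrix n E) j"
      by (rule col_mult2[OF adj_carrier walk_matrix_carrier that])
    also have "\<dots> = walk_vec n E (Suc j)"
      unfolding colW[OF that] pow_mat_Suc_left[OF adj_carrier]
      by (rule assoc_mult_mat_vec[symmetric, OF adj_carrier _ ones_carrier]) simp
    finally show ?thesis .
  qed
  have gram: "((walk_matrix n E)\<^sup>T * walk_matrix n E) $$ (i, j) = walk_count n E (i + j)"
    and gramA: "((walk_matrix n E)\<^sup>T * (adj n E * walk_matrix n E)) $$ (i, j) = walk_count n E (i + Suc j)"
    if "i < n" "j < n" for E i j
    using that
    by (simp_all add: colW colAW pow_adj_scalar_prod del: col_mult2 pow_mat.simps)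
  have G: "?W\<^sup>T * ?W = ?V\<^sup>T * ?V"
    by (intro eq_matI) (use gram wc carrier_matD[OF W] carrier_matD[OF V] in \<open>auto simp del: index_mult_mat(1)\<close>)
  have GA: "?W\<^sup>T * (?A * ?W) = ?V\<^sup>T * (?B * ?V)"
    by (intro eq_matI) (use gramA wc carrier_matD[OF W] carrier_matD[OF V] in \<open>auto simp del: index_mult_mat(1)\<close>)
  define R where "R = adj_mat ?W"
  note R = adj_mat[OF W, folded R_def D_def]
  have Rt: "R\<^sup>T \<in> carrier_mat n n" using R(1) by simp
  note AB = adj_carrier[of n E] adj_carrier[of n F]
  define N where "N = (?V * R)\<^sup>T"
  have N: "N \<in> carrier_mat n n" unfolding N_def using mult_carrier_mat[OF V R(1)] by simp
  have Nt: "N\<^sup>T = ?V * R" unfolding N_def by simp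
  have Ntc: "N\<^sup>T \<in> carrier_mat n n" using N by simp
  note assoc = assoc_mult_mat[of _ n n _ n _ n]
  have NtW: "N\<^sup>T * ?W = D \<cdot>\<^sub>m ?V"
  proof -
    have "N\<^sup>T * ?W = ?V * (R * ?W)" unfolding Nt by (rule assoc_mult_mat[OF V R(1) W])
    thus ?thesis unfolding R(3) using mult_smult_distrib[OF V one_carrier_mat] V by simp
  qed
  have WtN: "?W\<^sup>T * N = D \<cdot>\<^sub>m ?V\<^sup>T"
  proof -
    have "?W\<^sup>T * N = (N\<^sup>T * ?W)\<^sup>T"
      using transpose_mult[OF Ntc W] by simp
    also have "\<dots> = D \<cdot>\<^sub>m ?V\<^sup>T" unfolding NtW using V by (intro eq_matI) auto
    finally show ?thesis .
  qed
  have "N * N\<^sup>T = R\<^sup>T * (?V\<^sup>T * ?V) * R"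
    unfolding Nt unfolding N_def transpose_mult[OF V R(1)] using R(1) V Rt Vt by (simp add: assoc del: walk_matrix_carrier adj_carrier)
  also have "\<dots> = R\<^sup>T * ?W\<^sup>T * (?W * R)"
    unfolding G[symmetric] using R(1) W Rt Wt by (simp add: assoc del: walk_matrix_carrier adj_carrier)
  also have "R\<^sup>T * ?W\<^sup>T = (?W * R)\<^sup>T"
    by (rule transpose_mult[OF W R(1), symmetric])
  also have "(?W * R)\<^sup>T * (?W * R) = (D \<cdot>\<^sub>m 1\<^sub>m n) * (D \<cdot>\<^sub>m 1\<^sub>m n)"
    unfolding R(2) by (rule arg_cong2[of _ _ _ _ "(*)"]) (auto intro!: eq_matI)
  finally have NNt: "N * N\<^sup>T = (D * D) \<cdot>\<^sub>m 1\<^sub>m n"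
    using mult_smult_distrib[of "D \<cdot>\<^sub>m 1\<^sub>m n" n n "1\<^sub>m n" n D] by (simp add: smult_smult_mat)
  note NtN = scaled_orthogonal_transpose[OF N NNt]
  have NN: "N\<^sup>T * N = (D * D) \<cdot>\<^sub>m 1\<^sub>m n" using NtN(1) D by simp
  \<comment> \<open>Verified after multiplying by the nonsingular W^T on the left and W on the
    right, where both sides become D^2 times the same matrix of walk counts.\<close>
  have DA: "(D * D) \<cdot>\<^sub>m ?A = N * ?B * N\<^sup>T"
  proof (rule mat_mult_cancel_left[OF _ _ Wt], goal_cases)
    case 4
    show ?case
    proof (rule mat_mult_cancel_right[OF _ _ W det0], goal_cases)
      case 3
      have "?W\<^sup>T * ((D * D) \<cdot>\<^sub>m ?A) * ?W = (D * D) \<cdot>\<^sub>m (?W\<^sup>T * (?A * ?W))"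
        using mult_smult_distrib[OF Wt adj_carrier, of "D * D" E] mult_smult_assoc_mat[of "?W\<^sup>T * ?A" n n ?W n "D * D"]
          assoc_mult_mat[OF Wt adj_carrier W, of E] W Wt AB by (simp del: walk_matrix_carrier adj_carrier)
      also have "\<dots> = (D \<cdot>\<^sub>m ?V\<^sup>T) * ?B * (D \<cdot>\<^sub>m ?V)"
        unfolding GA using mult_smult_assoc_mat[OF Vt adj_carrier, of D F]
          mult_smult_assoc_mat[of "?V\<^sup>T * ?B" n n "D \<cdot>\<^sub>m ?V" n D]
          mult_smult_distrib[of "?V\<^sup>T * ?B" n n ?V n D] assoc_mult_mat[OF Vt adj_carrier V, of F] V Vt AB
        by (simp add: smult_smult_mat del: walk_matrix_carrier adj_carrier)
      also have "\<dots> = ?W\<^sup>T * (N * ?B * N\<^sup>T) * ?W"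
        unfolding NtW[symmetric] WtN[symmetric] using N Ntc W Wt AB by (simp add: assoc del: walk_matrix_carrier adj_carrier)
      finally show ?case .
    qed (use N Wt in auto)
  qed (use N det0 det_transpose[OF W] in auto)
  have "(D * D) \<cdot>\<^sub>m (?A * N) = (D * D) \<cdot>\<^sub>m ?A * N" by (rule mult_smult_assoc_mat[OF adj_carrier N, symmetric])
  also have "\<dots> = N * ?B * (N\<^sup>T * N)" unfolding DA using N Ntc AB by (simp add: assoc del: walk_matrix_carrier adj_carrier)
  also have "\<dots> = (D * D) \<cdot>\<^sub>m (N * ?B)" unfolding NN
    using mult_smult_distrib[of "N * ?B" n n "1\<^sub>m n" n "D * D"] mult_carrier_mat[OF N AB(2)] by simp
  finally have AN: "?A * N = N * ?B"
    using smult_mat_cancel[OF _ mult_carrier_mat[OF AB(1) N] mult_carrier_mat[OF N AB(2)], of "D * D"] D by simp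
  have Ne: "N\<^sup>T *\<^sub>v ones n = D \<cdot>\<^sub>v ones n"
  proof -
    \<comment> \<open>The first column of a walk matrix is e, so N^T e = D e is the first column of
      N^T W = D V.\<close>
    have o: "col (walk_matrix n E) 0 = ones n" for E using colW[OF n, of E] by simp
    have "N\<^sup>T *\<^sub>v col ?W 0 = col (N\<^sup>T * ?W) 0"
      by (rule col_mult2[symmetric, OF Ntc W n])
    also have "\<dots> = D \<cdot>\<^sub>v col ?V 0" unfolding NtW using n by (intro eq_vecI) auto
    finally show ?thesis unfolding o .
  qed
  have mD: "mate_matrix n E F N D" unfolding mate_matrix_def using N AN NN Ne by blast
  define P where "P k \<longleftrightarrow> k > 0 \<and> (\<exists>N. mate_matrix n E F N (int k))" for k
  have "P (nat \<bar>D\<bar>)"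
  proof -
    \<comment> \<open>D may be negative; scaling by its sign makes the level positive.\<close>
    have "mate_matrix n E F (sgn D \<cdot>\<^sub>m N) (sgn D * D)" using mate_matrix_smult[of "sgn D" N] N D mD by (simp add: sgn_eq_0_iff)
    thus ?thesis unfolding P_def using D by (auto simp: sgn_if split: if_splits)
  qed
  define k where "k = (LEAST k. P k)"
  have Pk: "P k" unfolding k_def by (rule LeastI[of P, OF \<open>P (nat \<bar>D\<bar>)\<close>])
  then obtain N' where N': "mate_matrix n E F N' (int k)" and k: "k > 0" unfolding P_def by blast
  show ?thesis
  proof (rule that[OF N'])
    show "int k > 0" using k by simp
    fix p :: int assume p: "prime p" "p dvd int k"
    show "\<exists>i<n. \<exists>j<n. \<not> p dvd N' $$ (i, j)"
    proof (rule ccontr)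
      assume "\<not> ?thesis"
      hence all: "p dvd N' $$ (i, j)" if "i < n" "j < n" for i j using that by blast
      obtain k' where k': "int k = p * k'" using p(2) by (rule dvdE)
      have p1: "p > 1" using p(1) by (rule prime_gt_1_int)
      have "0 < p * k'" unfolding k'[symmetric] using k by simp
      hence k'0: "k' > 0" using p1 by (simp add: zero_less_mult_iff)
      define M where "M = mat n n (\<lambda>(i, j). N' $$ (i, j) div p)"
      have M: "M \<in> carrier_mat n n" unfolding M_def by simp
      have "N' = p \<cdot>\<^sub>m M" using N' all unfolding mate_matrix_def by (intro eq_matI) (auto simp: M_def)
      hence "mate_matrix n E F M k'" using N' mate_matrix_smult[of p M n E F k'] M p1 k' by simp
      hence "P (nat k')" unfolding P_def using k'0 by auto
      moreover have "nat k' < k"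
      proof -
        have "k' < int k" unfolding k' using mult_strict_right_mono[OF p1 k'0] by simp
        thus ?thesis using k'0 by (simp add: nat_less_iff)
      qed
      ultimately show False unfolding k_def using not_less_Least by blast
    qed
  qed
qed

lemma mate_obtains:
  assumes "gen_cospectral_mate n E m F" and G: "simple_graph n E"
  shows "m = n" "simple_graph n F" "char_poly (adj n E) = char_poly (adj n F)"
    "char_poly (adj n E + all_ones_mat n) = char_poly (adj n F + all_ones_mat n)"
proof -
  have s: "graph_spectrum m F = graph_spectrum n E"
    and s': "graph_spectrum m (complement_edges m F) = graph_spectrum n (complement_edges n E)"
    and H: "simple_graph m F" using assms unfolding gen_cospectral_mate_def by auto
  show m: "m = n" by (rule graph_spectrum_eqD(1)[OF s])
  show H': "simple_graph n F" using H m by simp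
  show c: "char_poly (adj n E) = char_poly (adj n F)" using graph_spectrum_eqD(2)[OF s] m by simp
  have "char_poly (all_ones_mat n - 1\<^sub>m n - adj n F) = char_poly (all_ones_mat n - 1\<^sub>m n - adj n E)"
    using graph_spectrum_eqD(2)[OF s'] unfolding m adj_complement_edges[OF G] adj_complement_edges[OF H'] .
  from arg_cong[OF this, of "\<lambda>q. q \<circ>\<^sub>p [:-1, -1:]"]
  have "(-1) ^ n * (2 * char_poly (adj n F) - char_poly (adj n F + all_ones_mat n)) =
    (-1) ^ n * (2 * char_poly (adj n E) - char_poly (adj n E + all_ones_mat n))"
    unfolding char_poly_complement[OF adj_carrier] .
  thus "char_poly (adj n E + all_ones_mat n) = char_poly (adj n F + all_ones_mat n)" using c by simp
qed

text \<open>The solutions are the columns of L Q = q N, where L = l q. Their products are the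
  entries of L^2 I and, with A in between, of L^2 B.\<close>

lemma solutions_of_mate:
  assumes G: "simple_graph n E" and n: "n > 0" and det0: "det (walk_matrix n E) \<noteq> 0"
    and mate: "gen_cospectral_mate n E m F"
  shows "\<exists>\<xi> :: nat \<Rightarrow> int vec.
       (\<forall>i<n. system_solution n E (\<xi> i)) \<and>
       \<not> (\<forall>i<n. trivial_solution n E (\<xi> i)) \<and>
       (\<forall>i<n. \<forall>j<n. i \<noteq> j \<longrightarrow>
          \<xi> i \<bullet> \<xi> j = 0 \<and>
          \<xi> i \<bullet> (adj n E *\<^sub>v \<xi> j) \<in> {0, (system_level n E)\<^sup>2})"
proof -
  note m = mate_obtains(1)[OF mate G] and H = mate_obtains(2)[OF mate G]
    and c1 = mate_obtains(3)[OF mate G] and c2 = mate_obtains(4)[OF mate G]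
  have noniso: "\<not> graph_iso n E n F" using mate unfolding gen_cospectral_mate_def m by simp
  let ?A = "adj n E" and ?B = "adj n F"
  define L where "L = system_level n E"
  have L0: "L \<noteq> 0" unfolding L_def by (rule system_level_nonzero)
  obtain N l where mm: "mate_matrix n E F N l" and l: "l > 0"
    and prim: "\<And>p. prime p \<Longrightarrow> p dvd l \<Longrightarrow> \<exists>i<n. \<exists>j<n. \<not> p dvd N $$ (i, j)"
    by (rule mate_matrix_exists[OF n det0 walk_count_cong[OF n c1 c2]]) blast
  have N: "N \<in> carrier_mat n n" and AN: "?A * N = N * ?B" and NN: "N\<^sup>T * N = (l * l) \<cdot>\<^sub>m 1\<^sub>m n"
    and Ne: "N\<^sup>T *\<^sub>v ones n = l \<cdot>\<^sub>v ones n" using mm unfolding mate_matrix_def by auto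
  have "l dvd L" unfolding L_def by (rule level_dvd_system_level[OF G H n det0 c1 c2 N AN NN Ne l prim])
  then obtain q where q: "L = l * q" by (rule dvdE)
  define \<xi> where "\<xi> i = q \<cdot>\<^sub>v col N i" for i
  have colN: "col N i \<in> carrier_vec n" for i using N by (auto intro: carrier_vecI)
  have \<xi>c: "\<xi> i \<in> carrier_vec n" for i unfolding \<xi>_def using colN by simp
  have dot: "col N i \<bullet> col N j = (if i = j then l * l else 0)" if "i < n" "j < n" for i j
  proof -
    have "(N\<^sup>T * N) $$ (i, j) = ((l * l) \<cdot>\<^sub>m 1\<^sub>m n) $$ (i, j)" unfolding NN ..
    thus ?thesis using that N by simp
  qed
  have dotA: "col N i \<bullet> (?A *\<^sub>v col N j) = l * l * ?B $$ (i, j)" if ij: "i < n" "j < n" for i j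
  proof -
    have Nt: "N\<^sup>T \<in> carrier_mat n n" using N by simp
    have "col N i \<bullet> (?A *\<^sub>v col N j) = (N\<^sup>T * (?A * N)) $$ (i, j)"
      using ij N by (simp add: col_mult2[OF adj_carrier N])
    also have "N\<^sup>T * (?A * N) = (l * l) \<cdot>\<^sub>m ?B"
      unfolding AN assoc_mult_mat[OF Nt N adj_carrier, symmetric] NN
      using mult_smult_assoc_mat[OF one_carrier_mat[of n] adj_carrier[of n F], of "l * l"] by simp
    finally show ?thesis using ij by simp
  qed
  have D: "\<xi> i \<bullet> \<xi> j = (if i = j then L\<^sup>2 else 0)" if "i < n" "j < n" for i j
    unfolding \<xi>_def using dot[OF that] colN[of i] colN[of j] by (simp add: q power2_eq_square)
  have DA: "\<xi> i \<bullet> (?A *\<^sub>v \<xi> j) = L\<^sup>2 * ?B $$ (i, j)" if "i < n" "j < n" for i j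
  proof -
    have "?A *\<^sub>v col N j \<in> carrier_vec n" by (rule mult_mat_vec_carrier[OF adj_carrier colN])
    thus ?thesis unfolding \<xi>_def using mult_mat_vec_smult[OF adj_carrier colN, of E q j] dotA[OF that] colN[of i]
      by (simp add: q power2_eq_square)
  qed
  have sol: "system_solution n E (\<xi> i)" if i: "i < n" for i
    unfolding system_solution_def L_def[symmetric]
  proof (intro conjI ballI allI impI)
    show "\<xi> i \<in> carrier_vec n" by (rule \<xi>c)
    show "\<xi> i \<bullet> \<xi> i = L\<^sup>2" using D[OF i i] by simp
    show "\<xi> i \<bullet> (?A *\<^sub>v \<xi> i) = 0" using DA[OF i i] adj_diag[OF H i] by simp
    have "(N\<^sup>T *\<^sub>v ones n) $ i = (l \<cdot>\<^sub>v ones n) $ i" unfolding Ne ..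
    hence "col N i \<bullet> ones n = l" using i N by (simp add: ones_def)
    hence "ones n \<bullet> col N i = l" using comm_scalar_prod[OF colN ones_carrier] by simp
    thus "ones n \<bullet> \<xi> i = L" unfolding \<xi>_def scalar_prod_smult_distrib[OF ones_carrier colN] by (simp add: q mult.commute)
  next
    fix p k assume p: "p \<in> potential_primes n E" and k: "k < n"
    let ?W = "walk_matrix_mod p n E" and ?V = "walk_matrix_mod p n F"
    have pp: "prime p" using p by (auto simp: potential_primes_def candidate_primes_def Let_def)
    have W: "?W \<in> carrier_mat n n" and V: "?V \<in> carrier_mat n n" by simp_all
    have "(?W\<^sup>T *\<^sub>v col N i) $ k = col ?W k \<bullet> col N i"
      using k carrier_matD[OF W] by simp
    also have "\<dots> = col N i \<bullet> col ?W k" by (rule comm_scalar_prod[of _ n]) (use colN W in \<open>auto intro: carrier_vecI\<close>)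
    also have "\<dots> = (N\<^sup>T * ?W) $$ (i, k)" using i k N carrier_matD[OF W] by simp
    also have "\<dots> = l * ?V $$ (i, k)"
      unfolding transpose_mult_walk_matrix_mod[OF N AN Ne G H pp c1 c2] using i k carrier_matD[OF V] by simp
    finally have "(?W\<^sup>T *\<^sub>v \<xi> i) $ k = L * ?V $$ (i, k)"
      unfolding \<xi>_def using mult_mat_vec_smult[OF transpose_carrier_mat[THEN iffD2, OF W] colN, of q i] k carrier_matD[OF W]
      by (simp add: q)
    moreover have "p ^ potential_exponent p n E dvd L"
      unfolding L_def system_level_def by (rule dvd_prodI[OF finite_potential_primes[OF n det0] p])
    ultimately show "p ^ potential_exponent p n E dvd (?W\<^sup>T *\<^sub>v \<xi> i) $ k" by simp
  qed
  \<comment> \<open>If all columns were trivial, L Q would be L times a permutation matrix, and the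
    permutation an isomorphism.\<close>
  have nontriv: "\<not> (\<forall>i<n. trivial_solution n E (\<xi> i))"
  proof
    assume "\<forall>i<n. trivial_solution n E (\<xi> i)"
    hence "\<forall>i. \<exists>k. i < n \<longrightarrow> k < n \<and> \<xi> i = L \<cdot>\<^sub>v unit_vec n k" unfolding trivial_solution_def L_def by blast
    from choice[OF this] obtain f where f: "\<And>i. i < n \<Longrightarrow> f i < n" "\<And>i. i < n \<Longrightarrow> \<xi> i = L \<cdot>\<^sub>v unit_vec n (f i)" by blast
    have "inj_on f {..<n}"
    proof (rule inj_onI)
      fix i j assume ij: "i \<in> {..<n}" "j \<in> {..<n}" "f i = f j"
      hence "\<xi> i \<bullet> \<xi> j = \<xi> i \<bullet> \<xi> i" using f(2) by simp
      thus "i = j" using D[of i j] D[of i i] ij L0 by (auto split: if_splits)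
    qed
    moreover have "f ` {..<n} \<subseteq> {..<n}" using f(1) by auto
    ultimately have bij: "bij_betw f {..<n} {..<n}"
      by (simp add: bij_betw_def endo_inj_surj)
    have edge: "{i, j} \<in> F \<longleftrightarrow> {f i, f j} \<in> E" if "i < n" "j < n" for i j
    proof -
      have "?A *\<^sub>v \<xi> j = L \<cdot>\<^sub>v col ?A (f j)"
        unfolding f(2)[OF that(2)] using mult_mat_vec_smult[OF adj_carrier unit_vec_carrier, of n E L "f j"] f(1)[OF that(2)]
        by (auto intro!: eq_vecI)
      hence "\<xi> i \<bullet> (?A *\<^sub>v \<xi> j) = L * (L * ?A $$ (f i, f j))"
        unfolding f(2)[OF that(1)] using f(1)[OF that(1)] f(1)[OF that(2)]
        by (simp add: scalar_prod_left_unit[of _ n])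
      hence "L\<^sup>2 * ?B $$ (i, j) = L\<^sup>2 * ?A $$ (f i, f j)" using DA[OF that] by (simp add: power2_eq_square)
      hence "?B $$ (i, j) = ?A $$ (f i, f j)" using L0 by simp
      thus ?thesis using that f(1) by (auto simp: adj_def split: if_splits)
    qed
    \<comment> \<open>\<open>f\<close> carries the edges of F to those of E, while
      \<open>graph_iso n E n F\<close> asks for the opposite direction.\<close>
    define g where "g = inv_into {..<n} f"
    have g: "bij_betw g {..<n} {..<n}" unfolding g_def by (rule bij_betw_inv_into[OF bij])
    have "{u, v} \<in> E \<longleftrightarrow> {g u, g v} \<in> F" if "u < n" "v < n" for u v
    proof -
      have "g u < n" "g v < n" using g that unfolding bij_betw_def by auto
      moreover have "f (g u) = u" "f (g v) = v" unfolding g_def using bij that by (auto simp: bij_betw_inv_into_right)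
      ultimately show ?thesis using edge[of "g u" "g v"] by simp
    qed
    hence "graph_iso n E n F" unfolding graph_iso_def using g by blast
    thus False using noniso by blast
  qed
  have "\<xi> i \<bullet> (?A *\<^sub>v \<xi> j) \<in> {0, L\<^sup>2}" if "i < n" "j < n" for i j
    using DA[OF that] that by (auto simp: adj_def)
  thus ?thesis using sol nontriv D unfolding L_def by (intro exI[of _ \<xi>]) auto
qed

text \<open>The solutions become the columns of N = L Q, and F is read off from N^T A N = L^2 B. The
  values 0 on the diagonal and 0 or L^2 off it are what make B an adjacency matrix.\<close>

lemma mate_of_solutions:
  fixes \<xi> :: "nat \<Rightarrow> int vec"
  assumes G: "simple_graph n E" and n: "n > 0" and det0: "det (walk_matrix n E) \<noteq> 0"
    and sol: "\<And>i. i < n \<Longrightarrow> system_solution n E (\<xi> i)"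
    and nontriv: "\<not> (\<forall>i<n. trivial_solution n E (\<xi> i))"
    and orth: "\<And>i j. i < n \<Longrightarrow> j < n \<Longrightarrow> i \<noteq> j \<Longrightarrow> \<xi> i \<bullet> \<xi> j = 0"
    and edges: "\<And>i j. i < n \<Longrightarrow> j < n \<Longrightarrow> i \<noteq> j \<Longrightarrow> \<xi> i \<bullet> (adj n E *\<^sub>v \<xi> j) \<in> {0, (system_level n E)\<^sup>2}"
  shows "\<exists>F. gen_cospectral_mate n E n F"
proof -
  let ?A = "adj n E"
  define L where "L = system_level n E"
  have L0: "L \<noteq> 0" unfolding L_def by (rule system_level_nonzero)
  have \<xi>: "\<xi> i \<in> carrier_vec n" "\<xi> i \<bullet> \<xi> i = L\<^sup>2" "ones n \<bullet> \<xi> i = L" "\<xi> i \<bullet> (?A *\<^sub>v \<xi> i) = 0" if "i < n" for i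
    using sol[OF that] unfolding system_solution_def L_def by auto
  define F where "F = {{i, j} | i j. i < n \<and> j < n \<and> i \<noteq> j \<and> \<xi> i \<bullet> (?A *\<^sub>v \<xi> j) = L\<^sup>2}"
  let ?B = "adj n F"
  have H: "simple_graph n F" unfolding simple_graph_def complete_edges_def F_def by blast
  have A\<xi>: "?A *\<^sub>v \<xi> i \<in> carrier_vec n" if "i < n" for i by (rule mult_mat_vec_carrier[OF adj_carrier \<xi>(1)[OF that]])
  have symA: "\<xi> i \<bullet> (?A *\<^sub>v \<xi> j) = \<xi> j \<bullet> (?A *\<^sub>v \<xi> i)" if "i < n" "j < n" for i j
  proof -
    have "(?A\<^sup>T *\<^sub>v \<xi> i) \<bullet> \<xi> j = \<xi> i \<bullet> (?A *\<^sub>v \<xi> j)"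
      by (rule transpose_vec_mult_scalar[OF adj_carrier \<xi>(1)[OF that(2)] \<xi>(1)[OF that(1)]])
    thus ?thesis using comm_scalar_prod[OF \<xi>(1)[OF that(2)] A\<xi>[OF that(1)]] by (simp add: adj_symmetric)
  qed
  have B: "\<xi> i \<bullet> (?A *\<^sub>v \<xi> j) = L\<^sup>2 * ?B $$ (i, j)" if ij: "i < n" "j < n" for i j
  proof (cases "i = j")
    case True
    thus ?thesis using \<xi>(4)[OF ij(1)] adj_diag[OF H ij(1)] by simp
  next
    case False
    have "{i, j} \<in> F \<longleftrightarrow> \<xi> i \<bullet> (?A *\<^sub>v \<xi> j) = L\<^sup>2"
      unfolding F_def using False ij symA[OF ij] by (auto simp: doubleton_eq_iff)
    thus ?thesis using edges[OF ij False] ij L0 unfolding L_def[symmetric] by (auto simp: adj_def)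
  qed
  define N where "N = mat n n (\<lambda>(r, i). \<xi> i $ r)"
  have N: "N \<in> carrier_mat n n" unfolding N_def by simp
  have Nt: "N\<^sup>T \<in> carrier_mat n n" using N by simp
  have col: "col N i = \<xi> i" if "i < n" for i using that \<xi>(1)[OF that] by (intro eq_vecI) (auto simp: N_def)
  have dimN: "dim_row N = n" "dim_col N = n" using N by auto
  have NtN: "N\<^sup>T * N = (L * L) \<cdot>\<^sub>m 1\<^sub>m n"
    using \<xi>(2) orth by (intro eq_matI) (auto simp: dimN col power2_eq_square)
  have LL: "L * L \<noteq> 0" using L0 by simp
  have NNt: "N * N\<^sup>T = (L * L) \<cdot>\<^sub>m 1\<^sub>m n" "det N \<noteq> 0"
    using scaled_orthogonal_transpose[OF Nt _ LL] NtN det_transpose[OF N] by auto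
  have Ne: "N\<^sup>T *\<^sub>v ones n = L \<cdot>\<^sub>v ones n"
  proof (rule eq_vecI)
    fix i assume "i < dim_vec (L \<cdot>\<^sub>v ones n)"
    hence i: "i < n" by (simp add: ones_def)
    have "(N\<^sup>T *\<^sub>v ones n) $ i = \<xi> i \<bullet> ones n" using i by (simp add: dimN col)
    also have "\<dots> = L" using comm_scalar_prod[OF \<xi>(1)[OF i] ones_carrier] \<xi>(3)[OF i] by simp
    finally show "(N\<^sup>T *\<^sub>v ones n) $ i = (L \<cdot>\<^sub>v ones n) $ i" using i by (simp add: ones_def)
  qed (simp add: dimN ones_def)
  have NtAN: "N\<^sup>T * (?A * N) = (L * L) \<cdot>\<^sub>m ?B"
    by (intro eq_matI) (simp_all add: dimN col col_mult2[OF adj_carrier N] B power2_eq_square)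
  have AN: "?A * N = N * ?B"
  proof -
    have "(L * L) \<cdot>\<^sub>m (?A * N) = ((L * L) \<cdot>\<^sub>m 1\<^sub>m n) * (?A * N)"
      using mult_smult_assoc_mat[OF one_carrier_mat mult_carrier_mat[OF adj_carrier[of n E] N], of "L * L"] mult_carrier_mat[OF adj_carrier N, of E] by simp
    also have "\<dots> = N * (N\<^sup>T * (?A * N))"
      unfolding NNt(1)[symmetric] by (rule assoc_mult_mat[OF N Nt mult_carrier_mat[OF adj_carrier N]])
    also have "\<dots> = (L * L) \<cdot>\<^sub>m (N * ?B)" unfolding NtAN by (rule mult_smult_distrib[OF N adj_carrier])
    finally show ?thesis
      using smult_mat_cancel[OF LL mult_carrier_mat[OF adj_carrier N] mult_carrier_mat[OF N adj_carrier]] by blast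
  qed
  \<comment> \<open>By orthogonality e is fixed by Q as well as by Q^T. Both facts enter J N = N J,
    which carries the intertwining over to the complements.\<close>
  have Ne': "N *\<^sub>v ones n = L \<cdot>\<^sub>v ones n"
  proof -
    have "L \<cdot>\<^sub>v (N *\<^sub>v ones n) = N *\<^sub>v (N\<^sup>T *\<^sub>v ones n)"
      unfolding Ne by (rule mult_mat_vec_smult[OF N ones_carrier, symmetric])
    also have "\<dots> = (L * L) \<cdot>\<^sub>v ones n"
      unfolding assoc_mult_mat_vec[OF N Nt ones_carrier, symmetric] NNt(1) by (rule smult_one_mat_mult_vec[OF ones_carrier])
    finally have e: "(L \<cdot>\<^sub>v (N *\<^sub>v ones n)) $ i = ((L * L) \<cdot>\<^sub>v ones n) $ i" for i by simp
    have "(N *\<^sub>v ones n) $ i = L" if "i < n" for i using e[of i] that L0 by (simp add: ones_def dimN)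
    thus ?thesis by (intro eq_vecI) (auto simp: dimN ones_def)
  qed
  have JN: "all_ones_mat n * N = N * all_ones_mat n"
  proof (rule eq_matI)
    fix i j assume "i < dim_row (N * all_ones_mat n)" "j < dim_col (N * all_ones_mat n)"
    hence ij: "i < n" "j < n" by (simp_all add: dimN all_ones_mat_def)
    have r: "row (all_ones_mat n) i = ones n" "col (all_ones_mat n) j = ones n"
      using ij by (auto simp: all_ones_mat_def ones_def)
    have d: "dim_row (all_ones_mat n) = n" "dim_col (all_ones_mat n) = n" by (simp_all add: all_ones_mat_def)
    have "(all_ones_mat n * N) $$ (i, j) = L" using ij \<xi>(3) by (simp add: dimN d r col)
    moreover have "(N * all_ones_mat n) $$ (i, j) = (N *\<^sub>v ones n) $ i" using ij by (simp add: dimN d r)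
    ultimately show "(all_ones_mat n * N) $$ (i, j) = (N * all_ones_mat n) $$ (i, j)"
      unfolding Ne' using ij by (simp add: ones_def)
  qed (simp_all add: dimN all_ones_mat_def)
  have c1: "char_poly ?A = char_poly ?B"
    by (rule char_poly_intertwine[OF adj_carrier adj_carrier N AN NNt(2)])
  have c2: "char_poly (adj n (complement_edges n E)) = char_poly (adj n (complement_edges n F))"
  proof (rule char_poly_intertwine[OF adj_carrier adj_carrier N _ NNt(2)])
    let ?J = "all_ones_mat n"
    have J: "?J \<in> carrier_mat n n" by simp
    have J1: "?J - 1\<^sub>m n \<in> carrier_mat n n" by (rule minus_carrier_mat[OF one_carrier_mat])
    have "(?J - 1\<^sub>m n - ?A) * N = ?J * N - N - ?A * N"
      using minus_mult_distrib_mat[OF J1 adj_carrier N, of E] minus_mult_distrib_mat[OF J one_carrier_mat N] N by simp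
    also have "\<dots> = N * ?J - N - N * ?B" unfolding JN AN ..
    also have "\<dots> = N * (?J - 1\<^sub>m n - ?B)"
      using mult_minus_distrib_mat[OF N J1 adj_carrier, of F] mult_minus_distrib_mat[OF N J one_carrier_mat] N by simp
    finally show "adj n (complement_edges n E) * N = N * adj n (complement_edges n F)"
      unfolding adj_complement_edges[OF G] adj_complement_edges[OF H] .
  qed
  have "\<not> graph_iso n E n F"
  proof
    assume "graph_iso n E n F"
    then obtain f where bij: "bij_betw f {..<n} {..<n}"
      and iso: "\<And>u v. u < n \<Longrightarrow> v < n \<Longrightarrow> {u, v} \<in> E \<longleftrightarrow> {f u, f v} \<in> F"
      unfolding graph_iso_def by auto
    have fn: "f u < n" if "u < n" for u using bij that unfolding bij_betw_def by auto
    have AB: "?A $$ (u, v) = ?B $$ (f u, f v)" if "u < n" "v < n" for u v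
      using that fn iso by (simp add: adj_def)
    \<comment> \<open>An isomorphism permutes the rows of the walk matrix: row \<open>f u\<close> of
      W(H) is row u of W(G).\<close>
    have pow: "((?B ^\<^sub>m k) *\<^sub>v ones n) $ f u = ((?A ^\<^sub>m k) *\<^sub>v ones n) $ u" if "u < n" for u k
      using that
    proof (induction k arbitrary: u)
      case 0
      thus ?case using fn by (simp add: ones_def)
    next
      case (Suc k)
      have s: "walk_vec n E (Suc k) $ w = (\<Sum>v\<in>{0..<n}. adj n E $$ (w, v) * walk_vec n E k $ v)"
        if "w < n" for w E
      proof -
        have "walk_vec n E (Suc k) = adj n E *\<^sub>v (walk_vec n E k)"
          unfolding pow_mat_Suc_left[OF adj_carrier]
          by (rule assoc_mult_mat_vec[OF adj_carrier _ ones_carrier]) simp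
        thus ?thesis using mult_mat_vec_index_sum[OF adj_carrier pow_mult_ones_carrier that] by metis
      qed
      have "((?B ^\<^sub>m Suc k) *\<^sub>v ones n) $ f u = (\<Sum>v\<in>{0..<n}. ?B $$ (f u, v) * ((?B ^\<^sub>m k) *\<^sub>v ones n) $ v)"
        by (rule s[OF fn[OF Suc.prems]])
      also have "\<dots> = (\<Sum>v\<in>{0..<n}. ?B $$ (f u, f v) * ((?B ^\<^sub>m k) *\<^sub>v ones n) $ f v)"
        by (rule sum.reindex_bij_betw[symmetric]) (use bij in \<open>simp add: lessThan_atLeast0\<close>)
      also have "\<dots> = (\<Sum>v\<in>{0..<n}. ?A $$ (u, v) * ((?A ^\<^sub>m k) *\<^sub>v ones n) $ v)"
        by (rule sum.cong) (use Suc in \<open>simp_all add: AB del: index_mult_mat_vec\<close>)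
      also have "\<dots> = ((?A ^\<^sub>m Suc k) *\<^sub>v ones n) $ u" by (rule s[OF Suc.prems, symmetric])
      finally show ?case .
    qed
    have "trivial_solution n E (\<xi> i)" if i: "i < n" for i
    proof -
      obtain u where u: "u < n" "i = f u" using bij i unfolding bij_betw_def by (metis imageE lessThan_iff)
      \<comment> \<open>W(G)^T maps both \<open>\<xi> i\<close> and L e_u to L times row i of W(H),
        so the nonsingularity of W(G) makes them equal.\<close>
      define y where "y = \<xi> i - L \<cdot>\<^sub>v unit_vec n u"
      have y: "y \<in> carrier_vec n" unfolding y_def using \<xi>(1)[OF i] by simp
      have Wt: "(walk_matrix n E)\<^sup>T \<in> carrier_mat n n" by simp
      have "(walk_matrix n E)\<^sup>T *\<^sub>v y = 0\<^sub>v n"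
      proof (rule eq_vecI)
        fix k assume "k < dim_vec (0\<^sub>v n :: int vec)"
        hence k: "k < n" by simp
        have cW: "col (walk_matrix n E) k \<in> carrier_vec n" by (auto intro: carrier_vecI)
        have "((walk_matrix n E)\<^sup>T *\<^sub>v y) $ k = col (walk_matrix n E) k \<bullet> y" using k by simp
        also have "\<dots> = col (walk_matrix n E) k \<bullet> \<xi> i - col (walk_matrix n E) k \<bullet> (L \<cdot>\<^sub>v unit_vec n u)"
          unfolding y_def by (rule scalar_prod_minus_distrib[OF cW \<xi>(1)[OF i]]) simp
        also have "col (walk_matrix n E) k \<bullet> (L \<cdot>\<^sub>v unit_vec n u) = L * walk_matrix n E $$ (u, k)"
          using u k cW by (simp add: scalar_prod_right_unit[of _ n])
        also have "col (walk_matrix n E) k \<bullet> \<xi> i = (N\<^sup>T * walk_matrix n E) $$ (i, k)"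
          using comm_scalar_prod[OF cW \<xi>(1)[OF i]] i k by (simp add: dimN col)
        also have "\<dots> = L * walk_matrix n F $$ (i, k)"
          unfolding transpose_mult_walk_matrix[OF N AN Ne] using i k by simp
        also have "walk_matrix n F $$ (i, k) = walk_matrix n E $$ (u, k)"
          using pow[OF u(1), of k] i k u by (simp add: walk_matrix_def del: index_mult_mat_vec)
        finally show "((walk_matrix n E)\<^sup>T *\<^sub>v y) $ k = 0\<^sub>v n $ k" using k by simp
      qed simp
      hence "y = 0\<^sub>v n"
        using det_0_iff_vec_prod_zero[OF Wt] det_transpose[OF walk_matrix_carrier] det0 y by metis
      hence e: "y $ r = 0" if "r < n" for r using that by simp
      have "\<xi> i $ r = (L \<cdot>\<^sub>v unit_vec n u) $ r" if "r < n" for r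
        using e[OF that] that \<xi>(1)[OF i] unfolding y_def by simp
      hence "\<xi> i = L \<cdot>\<^sub>v unit_vec n u" using \<xi>(1)[OF i] by (intro eq_vecI) auto
      thus ?thesis unfolding trivial_solution_def L_def using u by blast
    qed
    thus False using nontriv by blast
  qed
  moreover have "graph_spectrum n F = graph_spectrum n E"
    "graph_spectrum n (complement_edges n F) = graph_spectrum n (complement_edges n E)"
    unfolding graph_spectrum_hom c1 c2 by simp_all
  ultimately show ?thesis unfolding gen_cospectral_mate_def using H by blast
qed

theorem theorem2:
  fixes n :: nat and E :: "nat set set"
  assumes "simple_graph n E" and "controllable n E"
  shows "(\<exists>m F. gen_cospectral_mate n E m F) \<longleftrightarrow>
    (\<exists>\<xi> :: nat \<Rightarrow> int vec.
       (\<forall>i<n. system_solution n E (\<xi> i)) \<and>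
       \<not> (\<forall>i<n. trivial_solution n E (\<xi> i)) \<and>
       (\<forall>i<n. \<forall>j<n. i \<noteq> j \<longrightarrow>
          \<xi> i \<bullet> \<xi> j = 0 \<and>
          \<xi> i \<bullet> (adj n E *\<^sub>v \<xi> j) \<in> {0, (system_level n E)\<^sup>2}))"
  (is "?mate \<longleftrightarrow> ?solutions")
proof (cases "n = 0")
  case True
  \<comment> \<open>For n = 0 both sides are false: a mate would have no vertices either and hence
    be isomorphic, and an empty family of solutions consists of trivial ones. The case is separate
    because last invariant factors require a nonempty matrix.\<close>
  have "graph_iso 0 E 0 F" for F unfolding graph_iso_def by (rule exI[of _ id]) simp
  hence "\<not> ?mate" using graph_spectrum_eqD(1) True unfolding gen_cospectral_mate_def by blast
  thus ?thesis using True by simp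
next
  case False
  hence n: "n > 0" by simp
  note det0 = controllable_det_nonzero[OF assms(2)]
  show ?thesis
  proof
    assume ?mate
    then obtain m F where "gen_cospectral_mate n E m F" by blast
    thus ?solutions by (rule solutions_of_mate[OF assms(1) n det0])
  next
    assume ?solutions
    then obtain \<xi> where "\<And>i. i < n \<Longrightarrow> system_solution n E (\<xi> i)" "\<not> (\<forall>i<n. trivial_solution n E (\<xi> i))"
      "\<And>i j. i < n \<Longrightarrow> j < n \<Longrightarrow> i \<noteq> j \<Longrightarrow> \<xi> i \<bullet> \<xi> j = 0"
      "\<And>i j. i < n \<Longrightarrow> j < n \<Longrightarrow> i \<noteq> j \<Longrightarrow> \<xi> i \<bullet> (adj n E *\<^sub>v \<xi> j) \<in> {0, (system_level n E)\<^sup>2}"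
      by blast
    from mate_of_solutions[OF assms(1) n det0 this] show ?mate by blast
  qed
qed

end
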